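(* Let $A\subset \mathbb{R}^p$ be a compact set of positive $s$-capacity, where $0\leqslant p-2<s<d\leqslant \ell\leqslant p$, and let $\mu_s$ be the $s$-equilibrium measure on $A$. Let $A'\subset A$. Assume that $A$ is $\ell$-regular at every $x\in A'$ and that $\mu_s$ is upper $d$-regular at every $x\in A'$ with constants $c(x)$ satisfying $\sup_{x\in A'}c(x)\leqslant c$ for some $c>0$. Then there exists a positive constant $C$ (independent of $N$) such that for every $N\geqslant 2$, every optimal $N$-point $s$-energy configuration $\omega^*_N=\{x^*_1, \ldots, x^*_N\}\subset A$, every $x^*_j \in A'$ and every $x^*_k\in A$ with $k\neq j$, $$|x^*_j-x^*_k|>C N^{-1/d}.$$
   Context: Measures are finite nonnegative Borel measures; $B(x,r):=\{y\in\mathbb{R}^p: |y-x|<r\}$; $p$ is a positive integer and $s,d,\ell$ are real numbers. For a measure $\mu$ supported on a compact set $A$, $U_s^\mu(x):=\int_A |x-y|^{-s}\,d\mu(y)$ and $I_s[\mu]:=\int_A U_s^\mu(x)\,d\mu(x)$. The $s$-Wiener constant is $W_s(A):=\inf I_s[\mu]$ over all probability measures $\mu$ supported on $A$, and $\mathrm{cap}_s(A):=1/W_s(A)$; positive $s$-capacity means $W_s(A)<\infty$. In that case there is a unique probability measure $\mu_s$ supported on $A$ attaining $W_s(A)$, called the $s$-equilibrium measure on $A$. An optimal $N$-point $s$-energy configuration is an $N$-point configuration $\omega_N^*=\{x_1^*,\dots,x_N^*\}\subset A$ minimizing $E_s(\omega_N):=\sum_{i\neq j}|x_i-x_j|^{-s}$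 over all $N$-point configurations $\omega_N=\{x_1,\dots,x_N\}\subset A$. A set $E\subset\mathbb{R}^p$ (bounded) is $\ell$-regular ($\ell>0$) if for some measure $\lambda$ supported on $E$ there is a positive constant $C_0$ such that $C_0^{-1}r^\ell\leqslant \lambda(B(x,r))\leqslant C_0r^\ell$ for all $x\in E$ and $0<r<\mathrm{diam}(E)$. A compact set $A$ is $\ell$-regular at $x\in A$ if for some $r_1>0$ the set $A\cap B(x,r_1)$ is $\ell$-regular. A measure $\mu$ is upper $d$-regular at $x$ with constant $c(x)$ if $\mu(B(x,r))\leqslant c(x)r^d$ for all $r>0$.
   Formalization: An ℓ-regular set is additionally required to have positive diameter, so isolated points of A do not count as points of ℓ-regularity; with one-point sets vacuously ℓ-regular, the claim fails for suitable A with close pairs of isolated points. *)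

theory Defs
  imports "HOL-Probability.Probability"
begin

text \<open>The kernel takes the value \<^term>\<open>\<infinity>\<close> on the diagonal (it is used for \<open>s > 0\<close> only); the case
  distinction is needed because \<^term>\<open>0 powr a = (0::real)\<close> for every exponent.\<close>

definition riesz_kernel :: "real \<Rightarrow> 'a::metric_space \<Rightarrow> 'a \<Rightarrow> ennreal" where
  "riesz_kernel s x y = (if x = y then \<infinity> else ennreal (dist x y powr (- s)))"

definition finite_borel_measure :: "'a::topological_space measure \<Rightarrow> bool" where
  "finite_borel_measure \<mu> \<longleftrightarrow> finite_measure \<mu> \<and> sets \<mu> = sets borel"

text \<open>No mass outside \<open>E\<close>; the set \<open>E\<close> need not be closed.\<close>

definition supported_on :: "'a measure \<Rightarrow> 'a set \<Rightarrow> bool" where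
  "supported_on \<mu> E \<longleftrightarrow> (AE x in \<mu>. x \<in> E)"

definition borel_probs_on :: "'a::topological_space set \<Rightarrow> 'a measure set" where
  "borel_probs_on A = {\<mu>. prob_space \<mu> \<and> finite_borel_measure \<mu> \<and> supported_on \<mu> A}"

definition riesz_potential :: "real \<Rightarrow> 'a::metric_space set \<Rightarrow> 'a measure \<Rightarrow> 'a \<Rightarrow> ennreal" where
  "riesz_potential s A \<mu> x = (\<integral>\<^sup>+ y\<in>A. riesz_kernel s x y \<partial>\<mu>)"

definition riesz_energy :: "real \<Rightarrow> 'a::metric_space set \<Rightarrow> 'a measure \<Rightarrow> ennreal" where
  "riesz_energy s A \<mu> = (\<integral>\<^sup>+ x\<in>A. riesz_potential s A \<mu> x \<partial>\<mu>)"

definition wiener_const :: "real \<Rightarrow> 'a::metric_space set \<Rightarrow> ennreal" where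
  "wiener_const s A = (INF \<mu>\<in>borel_probs_on A. riesz_energy s A \<mu>)"

definition riesz_capacity :: "real \<Rightarrow> 'a::metric_space set \<Rightarrow> ennreal" where
  "riesz_capacity s A = 1 / wiener_const s A"

definition equilibrium_measure :: "real \<Rightarrow> 'a::metric_space set \<Rightarrow> 'a measure \<Rightarrow> bool" where
  "equilibrium_measure s A \<mu> \<longleftrightarrow>
     \<mu> \<in> borel_probs_on A \<and> riesz_energy s A \<mu> = wiener_const s A"

text \<open>An \<open>N\<close>-point configuration is an indexed family \<open>x 1, \<dots>, x N\<close>. Repetitions are not
  forbidden, but make the energy infinite (for \<open>N \<ge> 2\<close>).\<close>

definition point_config :: "'a set \<Rightarrow> nat \<Rightarrow> (nat \<Rightarrow> 'a) \<Rightarrow> bool" where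
  "point_config A N x \<longleftrightarrow> (\<forall>i\<in>{1..N}. x i \<in> A)"

definition config_energy :: "real \<Rightarrow> nat \<Rightarrow> (nat \<Rightarrow> 'a::metric_space) \<Rightarrow> ennreal" where
  "config_energy s N x = (\<Sum>i\<in>{1..N}. \<Sum>j\<in>{1..N} - {i}. riesz_kernel s (x i) (x j))"

definition optimal_config :: "real \<Rightarrow> 'a::metric_space set \<Rightarrow> nat \<Rightarrow> (nat \<Rightarrow> 'a) \<Rightarrow> bool" where
  "optimal_config s A N x \<longleftrightarrow>
     point_config A N x \<and>
     (\<forall>y. point_config A N y \<longrightarrow> config_energy s N x \<le> config_energy s N y)"

text \<open>The condition \<open>0 < diameter E\<close> excludes one-point sets, for which the range of radii is
  empty and which would be vacuously regular of every dimension; without it, isolated points of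
  \<open>A\<close> would count as points of \<open>l\<close>-regularity.\<close>

definition regular_set :: "real \<Rightarrow> 'a::metric_space set \<Rightarrow> bool" where
  "regular_set l E \<longleftrightarrow>
     0 < l \<and> bounded E \<and> 0 < diameter E \<and>
     (\<exists>\<nu> C\<^sub>0. finite_borel_measure \<nu> \<and> supported_on \<nu> E \<and> 0 < C\<^sub>0 \<and>
        (\<forall>x\<in>E. \<forall>r. 0 < r \<and> r < diameter E \<longrightarrow>
           inverse C\<^sub>0 * r powr l \<le> measure \<nu> (ball x r) \<and>
           measure \<nu> (ball x r) \<le> C\<^sub>0 * r powr l))"

definition regular_at :: "real \<Rightarrow> 'a::metric_space set \<Rightarrow> 'a \<Rightarrow> bool" where
  "regular_at l A x \<longleftrightarrow> (\<exists>r\<^sub>1>0. regular_set l (A \<inter> ball x r\<^sub>1))"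

definition upper_regular_at :: "real \<Rightarrow> 'a::metric_space measure \<Rightarrow> 'a \<Rightarrow> real \<Rightarrow> bool" where
  "upper_regular_at d \<mu> x c \<longleftrightarrow> (\<forall>r>0. measure \<mu> (ball x r) \<le> c * r powr d)"

end

theory Submission
  imports Defs
begin

text \<open>For \<open>p - 2 < s < p\<close> the Riesz kernel \<open>k\<close> obeys a domination principle: if the potential of a
  measure \<open>\<sigma>\<close> lies below a positive constant plus another potential \<open>\<sigma>\<close>-almost everywhere, it does so
  everywhere. It rests on the Poisson kernel \<open>P\<^sub>y\<close> of the Caffarelli-Silvestre extension, for which
  \<open>P\<^sub>y * k = (|x|\<^sup>2 + y\<^sup>2) powr (- s / 2) \<le> k\<close>.

  The equilibrium potential is at most \<open>W\<close> everywhere, and equals \<open>W\<close> at the points of \<open>A'\<close> by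
  regularity. Let \<open>a = x j\<close>, \<open>b = x k\<close> and \<open>\<epsilon> = N powr (- 1 / d)\<close>, and let \<open>M \<le> N W\<close> be the minimum over
  \<open>A\<close>, attained at \<open>a\<close>, of the potential \<open>F\<close> of the points other than \<open>a\<close>. If \<open>|a - b| < \<epsilon> / 2\<close>, then
  outside the ball \<open>B(a, \<epsilon>)\<close> the point \<open>b\<close> contributes at most \<open>(\<epsilon> / 2) powr (- s)\<close> to \<open>F \<ge> M\<close>, so domination
  compares the part of \<open>(M / W) \<mu>\<^sub>s\<close> outside this ball with \<open>F\<close> without \<open>b\<close>. Evaluating at \<open>a\<close>, where the
  part inside the ball contributes \<open>O(N \<epsilon> powr (d - s)) = O(\<epsilon> powr (- s))\<close> by upper regularity, yields
  \<open>|a - b| powr (- s) = O(\<epsilon> powr (- s))\<close>.\<close>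

section \<open>The Poisson kernel of the Riesz kernel\<close>

text \<open>The hypothesis \<open>p - 2 < s\<close> enters through the exponent \<open>p - s\<close>
  of the extension problem, which has to lie in \<open>(0, 2)\<close>: it makes an average of
  Poisson kernels over the heights \<open>t y\<close> converge that dominates
  \<open>k - P_y * k\<close>. The domination principle is an energy argument, and its difficulty is
  the scale: the energy of the truncated difference \<open>v\<close> at height \<open>y\<close> is
  bounded below only by a multiple of \<open>y powr (p - s)\<close>, and the error carries the same
  factor. What has to tend to 0 is therefore the remaining factor, an average of integrals of
  Poisson means of \<open>v\<close> against the measure. The positive constant in the principle
  makes \<open>v\<close> vanish far out, since potentials tend to 0 there; this gives finite
  integrals and rules out a nonzero constant \<open>v\<close>. The variational argument gives the
  value \<open>W\<close> of the equilibrium potential only almost everywhere, whereas the comparison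
  is evaluated at the single point \<open>a\<close>; this is what regularity of \<open>A\<close>
  near \<open>a\<close>, together with \<open>s < d\<close>, is for.\<close>

lemma nn_integral_lborel_translate:
  fixes f :: "'a::euclidean_space \<Rightarrow> ennreal"
  assumes [measurable]: "f \<in> borel_measurable borel"
  shows "(\<integral>\<^sup>+x. f (a + x) \<partial>lborel) = (\<integral>\<^sup>+x. f x \<partial>lborel)"
  by (subst (2) lborel_distr_plus[symmetric, of a]) (simp add: nn_integral_distr)

lemma nn_integral_lborel_scale:
  fixes f :: "'a::euclidean_space \<Rightarrow> ennreal"
  assumes [measurable]: "f \<in> borel_measurable borel" and "c > 0"
  shows "(\<integral>\<^sup>+x. f x \<partial>lborel) = ennreal (c ^ DIM('a)) * (\<integral>\<^sup>+x. f (c *\<^sub>R x) \<partial>lborel)"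
  using assms(2)
  by (subst lborel_affine[of c 0])
     (auto simp add: nn_integral_density nn_integral_distr nn_integral_cmult)

lemma nn_integral_halfline_scale:
  fixes f :: "real \<Rightarrow> real"
  assumes [measurable]: "f \<in> borel_measurable borel" and "c > 0"
  shows "(\<integral>\<^sup>+t\<in>{0<..}. ennreal (f t) \<partial>lborel) = (\<integral>\<^sup>+t\<in>{0<..}. ennreal (c * f (c * t)) \<partial>lborel)"
proof -
  have "(\<integral>\<^sup>+t\<in>{0<..}. ennreal (f t) \<partial>lborel)
      = ennreal c * (\<integral>\<^sup>+t. ennreal (f (c * t)) * indicator {0<..} (c * t) \<partial>lborel)"
    using assms(2) by (subst nn_integral_real_affine[of _ c 0]) auto
  also have "\<dots> = (\<integral>\<^sup>+t\<in>{0<..}. ennreal (c * f (c * t)) \<partial>lborel)"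
    using assms(2) by (subst nn_integral_cmult[symmetric])
      (auto intro!: nn_integral_cong simp: ennreal_mult' indicator_def zero_less_mult_iff)
  finally show ?thesis .
qed

lemma nn_integral_halfline_cong:
  fixes f g :: "real \<Rightarrow> ennreal"
  assumes "\<And>t. t > 0 \<Longrightarrow> f t = g t"
  shows "(\<integral>\<^sup>+t\<in>{0<..}. f t \<partial>lborel) = (\<integral>\<^sup>+t\<in>{0<..}. g t \<partial>lborel)"
  using assms by (intro nn_integral_cong) (auto simp: indicator_def)

text \<open>With \<open>X = |z|^2 + y^2\<close> this writes an inverse power as a superposition of
  Gaussians in \<open>z\<close>. Scaling the variable by \<open>X\<close> reduces it to the Gamma
  integral.\<close>

lemma nn_integral_powr_exp:
  assumes "X > 0" "b > 0"
  shows "(\<integral>\<^sup>+t\<in>{0<..}. ennreal (t powr (b - 1) * exp (- t * X)) \<partial>lborel)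
       = ennreal (Gamma b * X powr (- b))"
proof -
  have "ennreal (Gamma b) = (\<integral>\<^sup>+t\<in>{0<..}. ennreal (t powr (b - 1) * exp (- t)) \<partial>lborel)"
    using assms(2) unfolding Gamma_conv_nn_integral_real[OF assms(2)]
    by (intro nn_integral_cong) (auto simp: indicator_def exp_minus divide_inverse)
  also have "\<dots> = (\<integral>\<^sup>+t\<in>{0<..}. ennreal (X * ((X * t) powr (b - 1) * exp (- (X * t)))) \<partial>lborel)"
    using assms(1) by (rule nn_integral_halfline_scale[rotated]) measurable
  also have "\<dots> = (\<integral>\<^sup>+t. ennreal (X powr b) * (ennreal (t powr (b - 1) * exp (- t * X)) * indicator {0<..} t) \<partial>lborel)"
    using assms(1)
    by (intro nn_integral_cong)
       (auto simp: indicator_def powr_mult powr_diff ennreal_mult'[symmetric] mult.commute mult.assoc)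
  also have "\<dots> = ennreal (X powr b) * (\<integral>\<^sup>+t\<in>{0<..}. ennreal (t powr (b - 1) * exp (- t * X)) \<partial>lborel)"
    by (rule nn_integral_cmult) measurable
  finally have *: "ennreal (Gamma b) = ennreal (X powr b) * (\<integral>\<^sup>+t\<in>{0<..}. ennreal (t powr (b - 1) * exp (- t * X)) \<partial>lborel)" .
  have "ennreal (Gamma b * X powr (- b)) = ennreal (X powr (- b)) * ennreal (Gamma b)"
    using assms by (simp add: ennreal_mult'[symmetric] mult.commute)
  also have "\<dots> = ennreal (X powr (- b)) * ennreal (X powr b) * (\<integral>\<^sup>+t\<in>{0<..}. ennreal (t powr (b - 1) * exp (- t * X)) \<partial>lborel)"
    by (simp only: * mult.assoc)
  also have "ennreal (X powr (- b)) * ennreal (X powr b) = 1"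
    using assms by (simp add: ennreal_mult'[symmetric] powr_add[symmetric])
  finally show ?thesis by simp
qed

text \<open>The normal density of variance \<open>1 / (2 t)\<close> has total mass 1, which is the
  one-dimensional case; the general one is a product over the basis.\<close>

lemma nn_integral_gaussian:
  assumes "t > 0"
  shows "(\<integral>\<^sup>+z. ennreal (exp (- t * (norm (z::'a::euclidean_space))\<^sup>2)) \<partial>lborel)
       = ennreal ((pi / t) powr (DIM('a) / 2))"
proof -
  have 1: "(\<integral>\<^sup>+x. ennreal (exp (- t * x\<^sup>2)) \<partial>lborel) = ennreal (sqrt (pi / t))"
  proof -
    define \<sigma> where "\<sigma> = sqrt (1 / (2 * t))"
    have \<sigma>: "\<sigma> > 0" "2 * \<sigma>\<^sup>2 = 1 / t" using assms by (auto simp: \<sigma>_def)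
    have "(\<integral>\<^sup>+x. ennreal (normal_density 0 \<sigma> x) \<partial>lborel) = 1"
      using \<sigma> by (subst nn_integral_eq_integral) auto
    moreover have "normal_density 0 \<sigma> x = inverse (sqrt (pi / t)) * exp (- t * x\<^sup>2)" for x
    proof -
      have "2 * pi * \<sigma>\<^sup>2 = pi / t" using \<sigma> by (metis (no_types, lifting) mult.assoc mult.commute times_divide_eq_right mult.right_neutral)
      then show ?thesis unfolding normal_density_def \<sigma>(2) by (simp add: divide_inverse mult.commute)
    qed
    ultimately have "(\<integral>\<^sup>+x. ennreal (inverse (sqrt (pi / t))) * ennreal (exp (- t * x\<^sup>2)) \<partial>lborel) = 1"
      using assms by (simp add: ennreal_mult')
    then have *: "ennreal (inverse (sqrt (pi / t))) * (\<integral>\<^sup>+x. ennreal (exp (- t * x\<^sup>2)) \<partial>lborel) = 1"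
      by (subst (asm) nn_integral_cmult) auto
    have "(\<integral>\<^sup>+x. ennreal (exp (- t * x\<^sup>2)) \<partial>lborel)
        = ennreal (sqrt (pi / t)) * ennreal (inverse (sqrt (pi / t))) * (\<integral>\<^sup>+x. ennreal (exp (- t * x\<^sup>2)) \<partial>lborel)"
      using assms by (subst ennreal_mult'[symmetric]) auto
    also have "\<dots> = ennreal (sqrt (pi / t))" by (simp only: mult.assoc * mult_1_right)
    finally show ?thesis .
  qed
  have "(\<integral>\<^sup>+z. ennreal (exp (- t * (norm (z::'a))\<^sup>2)) \<partial>lborel)
      = (\<integral>\<^sup>+z. (\<Prod>b\<in>Basis. ennreal (exp (- t * ((z::'a) \<bullet> b)\<^sup>2))) \<partial>lborel)"
  proof (intro nn_integral_cong)
    fix z :: 'a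
    have "(norm z)\<^sup>2 = (\<Sum>b\<in>Basis. (z \<bullet> b)\<^sup>2)"
      by (metis (no_types, lifting) dot_square_norm euclidean_inner power2_eq_square sum.cong)
    then show "ennreal (exp (- t * (norm z)\<^sup>2)) = (\<Prod>b\<in>Basis. ennreal (exp (- t * (z \<bullet> b)\<^sup>2)))"
      by (simp add: sum_distrib_left exp_sum[symmetric] prod_ennreal sum_negf)
  qed
  also have "\<dots> = (\<Prod>b\<in>(Basis::'a set). ennreal (sqrt (pi / t)))"
    by (subst nn_integral_lborel_prod) (simp_all add: 1[simplified])
  also have "\<dots> = ennreal ((pi / t) powr (DIM('a) / 2))"
    using assms by (simp add: ennreal_power powr_half_sqrt[symmetric] powr_powr powr_realpow[symmetric])
  finally show ?thesis .
qed

text \<open>Completing the square centres the Gaussian at \<open>- a\<close> and leaves half the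
  harmonic mean of \<open>u\<close> and \<open>t\<close> as the rate in \<open>x\<close>.\<close>

lemma nn_integral_gaussian_mult:
  fixes x :: "'a::euclidean_space"
  assumes "u > 0" "t > 0"
  shows "(\<integral>\<^sup>+z. ennreal (exp (- u * (norm z)\<^sup>2 - t * (norm (x + z))\<^sup>2)) \<partial>lborel)
       = ennreal ((pi / (u + t)) powr (DIM('a) / 2) * exp (- (u * t / (u + t)) * (norm x)\<^sup>2))"
proof -
  define a where "a = (t / (u + t)) *\<^sub>R x"
  have eq: "- u * (norm z)\<^sup>2 - t * (norm (x + z))\<^sup>2
          = - (u + t) * (norm (a + z))\<^sup>2 + - (u * t / (u + t)) * (norm x)\<^sup>2" for z
  proof -
    have ut: "u + t \<noteq> 0" using assms by auto
    have "(norm (r *\<^sub>R x + z))\<^sup>2 = r\<^sup>2 * (norm x)\<^sup>2 + 2 * r * (x \<bullet> z) + (norm z)\<^sup>2" for r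
      unfolding power2_norm_eq_inner
      by (simp add: inner_add_left inner_add_right inner_commute power2_eq_square algebra_simps)
    then have "(norm (a + z))\<^sup>2 = (t / (u + t))\<^sup>2 * (norm x)\<^sup>2 + 2 * (t / (u + t)) * (x \<bullet> z) + (norm z)\<^sup>2"
      unfolding a_def by blast
    moreover have "(norm (x + z))\<^sup>2 = (norm x)\<^sup>2 + 2 * (x \<bullet> z) + (norm z)\<^sup>2"
      by (simp add: power2_norm_eq_inner inner_add_left inner_add_right inner_commute)
    moreover have "- u * c - t * (b + 2 * d + c) = - (u + t) * ((t / (u + t))\<^sup>2 * b + 2 * (t / (u + t)) * d + c) + - (u * t / (u + t)) * b" for b c d :: real
    proof -
      \<comment> \<open>In terms of the fraction \<open>r\<close> and the sum
        \<open>w = u + t\<close> the identity is polynomial.\<close>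
      define r where "r = t / (u + t)"
      have r: "t = r * (u + t)" using ut by (simp add: r_def)
      then have u: "u = (1 - r) * (u + t)" by (simp add: algebra_simps)
      have "- ((1 - r) * w) * c - r * w * (b + 2 * d + c) = - w * (r\<^sup>2 * b + 2 * r * d + c) + - ((1 - r) * w * r) * b" for w
        by (simp add: algebra_simps power2_eq_square)
      from this[of "u + t"] show ?thesis
        unfolding r[symmetric] u[symmetric] by (simp add: r_def)
    qed
    ultimately show ?thesis by simp
  qed
  have "(\<integral>\<^sup>+z. ennreal (exp (- u * (norm z)\<^sup>2 - t * (norm (x + z))\<^sup>2)) \<partial>lborel)
      = (\<integral>\<^sup>+z. ennreal (exp (- (u * t / (u + t)) * (norm x)\<^sup>2)) * ennreal (exp (- (u + t) * (norm (a + z))\<^sup>2)) \<partial>lborel)"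
    unfolding eq exp_add by (simp add: ennreal_mult' mult.commute)
  also have "\<dots> = ennreal (exp (- (u * t / (u + t)) * (norm x)\<^sup>2)) * (\<integral>\<^sup>+z. ennreal (exp (- (u + t) * (norm (a + z))\<^sup>2)) \<partial>lborel)"
    by (rule nn_integral_cmult) measurable
  also have "(\<integral>\<^sup>+z. ennreal (exp (- (u + t) * (norm (a + z))\<^sup>2)) \<partial>lborel) = (\<integral>\<^sup>+z. ennreal (exp (- (u + t) * (norm (z::'a))\<^sup>2)) \<partial>lborel)"
    by (rule nn_integral_lborel_translate) measurable
  also have "\<dots> = ennreal ((pi / (u + t)) powr (DIM('a) / 2))"
    using assms by (intro nn_integral_gaussian) auto
  finally show ?thesis by (simp add: ennreal_mult'[symmetric] mult.commute)
qed


lemma nn_integral_lborel_swap: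
  fixes f :: "'a::euclidean_space \<Rightarrow> 'b::euclidean_space \<Rightarrow> ennreal"
  assumes [measurable]: "(\<lambda>(x, y). f x y) \<in> borel_measurable (borel \<Otimes>\<^sub>M borel)" "S \<in> sets borel"
  shows "(\<integral>\<^sup>+x. (\<integral>\<^sup>+y\<in>S. f x y \<partial>lborel) \<partial>lborel) = (\<integral>\<^sup>+y\<in>S. (\<integral>\<^sup>+x. f x y \<partial>lborel) \<partial>lborel)"
proof -
  have "(\<integral>\<^sup>+x. (\<integral>\<^sup>+y\<in>S. f x y \<partial>lborel) \<partial>lborel) = (\<integral>\<^sup>+y. (\<integral>\<^sup>+x. f x y * indicator S y \<partial>lborel) \<partial>lborel)"
    by (intro lborel_pair.Fubini') measurable
  also have "\<dots> = (\<integral>\<^sup>+y\<in>S. (\<integral>\<^sup>+x. f x y \<partial>lborel) \<partial>lborel)"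
    by (intro nn_integral_cong nn_integral_multc) measurable
  finally show ?thesis .
qed

lemma nn_integral_lborel_swap_set:
  fixes f :: "'a::euclidean_space \<Rightarrow> 'b::euclidean_space \<Rightarrow> ennreal"
  assumes [measurable]: "(\<lambda>(x, y). f x y) \<in> borel_measurable (borel \<Otimes>\<^sub>M borel)"
    "S \<in> sets borel" "T \<in> sets borel"
  shows "(\<integral>\<^sup>+x\<in>T. (\<integral>\<^sup>+y\<in>S. f x y \<partial>lborel) \<partial>lborel) = (\<integral>\<^sup>+y\<in>S. (\<integral>\<^sup>+x\<in>T. f x y \<partial>lborel) \<partial>lborel)"
proof -
  have "(\<integral>\<^sup>+x\<in>T. (\<integral>\<^sup>+y\<in>S. f x y \<partial>lborel) \<partial>lborel)
      = (\<integral>\<^sup>+x. (\<integral>\<^sup>+y\<in>S. f x y * indicator T x \<partial>lborel) \<partial>lborel)"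
    by (intro nn_integral_cong, subst nn_integral_multc[symmetric]) (auto simp: mult_ac)
  also have "\<dots> = (\<integral>\<^sup>+y\<in>S. (\<integral>\<^sup>+x\<in>T. f x y \<partial>lborel) \<partial>lborel)"
    by (intro nn_integral_lborel_swap) measurable
  finally show ?thesis .
qed

lemma nn_integral_set_mult:
  fixes f g :: "_ \<Rightarrow> ennreal"
  assumes [measurable]: "f \<in> borel_measurable M" "g \<in> borel_measurable N" "S \<in> sets M" "T \<in> sets N"
  shows "(\<integral>\<^sup>+u\<in>S. f u \<partial>M) * (\<integral>\<^sup>+t\<in>T. g t \<partial>N) = (\<integral>\<^sup>+u\<in>S. (\<integral>\<^sup>+t\<in>T. f u * g t \<partial>N) \<partial>M)"
proof -
  have "(\<integral>\<^sup>+u\<in>S. f u \<partial>M) * (\<integral>\<^sup>+t\<in>T. g t \<partial>N) = (\<integral>\<^sup>+u. f u * indicator S u * (\<integral>\<^sup>+t\<in>T. g t \<partial>N) \<partial>M)"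
    by (intro nn_integral_multc[symmetric]) measurable
  also have "\<dots> = (\<integral>\<^sup>+u\<in>S. (\<integral>\<^sup>+t\<in>T. f u * g t \<partial>N) \<partial>M)"
  proof (intro nn_integral_cong)
    fix u
    have "(\<integral>\<^sup>+t\<in>T. f u * g t \<partial>N) = f u * (\<integral>\<^sup>+t\<in>T. g t \<partial>N)"
      unfolding mult.assoc by (rule nn_integral_cmult) measurable
    then show "f u * indicator S u * (\<integral>\<^sup>+t\<in>T. g t \<partial>N) = (\<integral>\<^sup>+t\<in>T. f u * g t \<partial>N) * indicator S u"
      by (simp add: mult_ac)
  qed
  finally show ?thesis .
qed

text \<open>Integrating the superposition of Gaussians over \<open>z\<close> contributes
  \<open>(pi / t) powr (p / 2)\<close>, which lowers the Gamma parameter from \<open>b\<close> to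
  \<open>b - p / 2\<close>. For \<open>b = p - s / 2\<close> the value normalises the Poisson
  kernel.\<close>

lemma nn_integral_inverse_power:
  fixes y b :: real
  assumes "y > 0" "b > real DIM('a) / 2"
  shows "(\<integral>\<^sup>+z. ennreal (((norm (z::'a::euclidean_space))\<^sup>2 + y\<^sup>2) powr (- b)) \<partial>lborel)
       = ennreal (pi powr (DIM('a) / 2) * Gamma (b - DIM('a) / 2) / Gamma b * y powr (DIM('a) - 2 * b))"
proof -
  define p where "p = real DIM('a)"
  have b: "b > 0" "b - p / 2 > 0" using assms by (auto simp: p_def intro: le_less_trans[rotated])
  have G: "Gamma b > 0" "Gamma (b - p / 2) > 0" using b by (auto intro: Gamma_real_pos)
  have pos: "(norm z)\<^sup>2 + y\<^sup>2 > 0" for z :: 'a using assms(1) by (simp add: add_nonneg_pos)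
  have "ennreal (Gamma b) * (\<integral>\<^sup>+z. ennreal (((norm (z::'a))\<^sup>2 + y\<^sup>2) powr (- b)) \<partial>lborel)
      = (\<integral>\<^sup>+z. ennreal (Gamma b * ((norm (z::'a))\<^sup>2 + y\<^sup>2) powr (- b)) \<partial>lborel)"
    using G by (subst nn_integral_cmult[symmetric]) (auto intro!: nn_integral_cong simp: ennreal_mult')
  also have "\<dots> = (\<integral>\<^sup>+z. (\<integral>\<^sup>+t\<in>{0<..}. ennreal (t powr (b - 1) * exp (- t * ((norm (z::'a))\<^sup>2 + y\<^sup>2))) \<partial>lborel) \<partial>lborel)"
    by (intro nn_integral_cong nn_integral_powr_exp[symmetric] pos b)
  also have "\<dots> = (\<integral>\<^sup>+t\<in>{0<..}. (\<integral>\<^sup>+z. ennreal (t powr (b - 1) * exp (- t * ((norm (z::'a))\<^sup>2 + y\<^sup>2))) \<partial>lborel) \<partial>lborel)"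
    by (rule nn_integral_lborel_swap) measurable
  also have "\<dots> = (\<integral>\<^sup>+t\<in>{0<..}. ennreal (pi powr (p / 2) * (t powr (b - p / 2 - 1) * exp (- t * y\<^sup>2))) \<partial>lborel)"
  proof (rule nn_integral_halfline_cong)
    fix t :: real assume t: "0 < t"
    have "(\<integral>\<^sup>+z. ennreal (t powr (b - 1) * exp (- t * ((norm (z::'a))\<^sup>2 + y\<^sup>2))) \<partial>lborel)
        = (\<integral>\<^sup>+z. ennreal (t powr (b - 1) * exp (- t * y\<^sup>2)) * ennreal (exp (- t * (norm (z::'a))\<^sup>2)) \<partial>lborel)"
      by (intro nn_integral_cong) (simp add: ennreal_mult'[symmetric] exp_add[symmetric] algebra_simps)
    also have "\<dots> = ennreal (t powr (b - 1) * exp (- t * y\<^sup>2)) * (\<integral>\<^sup>+z. ennreal (exp (- t * (norm (z::'a))\<^sup>2)) \<partial>lborel)"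
      by (rule nn_integral_cmult) measurable
    also have "\<dots> = ennreal (t powr (b - 1) * exp (- t * y\<^sup>2) * (pi / t) powr (p / 2))"
      unfolding nn_integral_gaussian[OF t] p_def by (simp add: ennreal_mult'[symmetric])
    also have "t powr (b - 1) * exp (- t * y\<^sup>2) * (pi / t) powr (p / 2) = pi powr (p / 2) * (t powr (b - p / 2 - 1) * exp (- t * y\<^sup>2))"
    proof -
      have "(pi / t) powr (p / 2) = pi powr (p / 2) * t powr (- (p / 2))"
        using t by (simp add: powr_divide powr_minus_divide)
      moreover have "t powr (b - 1) * t powr (- (p / 2)) = t powr (b - p / 2 - 1)"
        by (simp add: powr_add[symmetric] algebra_simps)
      ultimately show ?thesis by (simp add: mult_ac)
    qed
    finally show "(\<integral>\<^sup>+z. ennreal (t powr (b - 1) * exp (- t * ((norm (z::'a))\<^sup>2 + y\<^sup>2))) \<partial>lborel)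
        = ennreal (pi powr (p / 2) * (t powr (b - p / 2 - 1) * exp (- t * y\<^sup>2)))" by simp
  qed
  also have "\<dots> = ennreal (pi powr (p / 2)) * (\<integral>\<^sup>+t\<in>{0<..}. ennreal (t powr (b - p / 2 - 1) * exp (- t * y\<^sup>2)) \<partial>lborel)"
    by (subst nn_integral_cmult[symmetric]) (auto simp: ennreal_mult' mult.assoc)
  also have "\<dots> = ennreal (pi powr (p / 2)) * ennreal (Gamma (b - p / 2) * (y\<^sup>2) powr (- (b - p / 2)))"
    using assms(1) b by (subst nn_integral_powr_exp) auto
  also have "(y\<^sup>2) powr (- (b - p / 2)) = y powr (p - 2 * b)"
    using assms(1) by (simp add: powr_numeral[symmetric] powr_powr del: powr_numeral)
  finally have *: "ennreal (Gamma b) * (\<integral>\<^sup>+z. ennreal (((norm (z::'a))\<^sup>2 + y\<^sup>2) powr (- b)) \<partial>lborel)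
     = ennreal (pi powr (p / 2)) * ennreal (Gamma (b - p / 2) * y powr (p - 2 * b))" .
  have "ennreal (pi powr (p / 2) * Gamma (b - p / 2) / Gamma b * y powr (p - 2 * b))
      = ennreal (1 / Gamma b) * (ennreal (pi powr (p / 2)) * ennreal (Gamma (b - p / 2) * y powr (p - 2 * b)))"
    using G by (simp add: ennreal_mult'[symmetric])
  also have "\<dots> = ennreal (1 / Gamma b) * ennreal (Gamma b) * (\<integral>\<^sup>+z. ennreal (((norm (z::'a))\<^sup>2 + y\<^sup>2) powr (- b)) \<partial>lborel)"
    by (simp only: * mult.assoc)
  also have "ennreal (1 / Gamma b) * ennreal (Gamma b) = 1"
    using G by (simp add: ennreal_mult'[symmetric])
  finally show ?thesis by (simp add: p_def)
qed

text \<open>Both factors become Gamma integrals, in \<open>u\<close> and in \<open>t\<close>, which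
  makes the integral over \<open>z\<close> Gaussian. The substitutions \<open>t = u v\<close> and
  \<open>u = (1 + v) w\<close> then decouple the variables. They succeed because the parameters
  \<open>b = p - s / 2\<close> and \<open>s / 2\<close> add up to \<open>p\<close>: all powers of
  \<open>1 + v\<close> cancel, and two Gamma integrals remain.\<close>

lemma nn_integral_inverse_power_mult:
  fixes x :: "'a::euclidean_space" and y s :: real
  assumes "y > 0" "0 < s" "s < DIM('a)"
  shows "(\<integral>\<^sup>+z. ennreal (((norm z)\<^sup>2 + y\<^sup>2) powr (s / 2 - DIM('a)) * norm (x + z) powr (- s)) \<partial>lborel)
       = ennreal (pi powr (DIM('a) / 2) * Gamma ((DIM('a) - s) / 2) / Gamma (DIM('a) - s / 2)
           * y powr (s - DIM('a)) * ((norm x)\<^sup>2 + y\<^sup>2) powr (- s / 2))"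
    (is "?I = _")
proof -
  define p where "p = real DIM('a)"
  define b where "b = p - s / 2"
  define R where "R = (norm x)\<^sup>2 + y\<^sup>2"
  have p: "p > 0" "s < p" using assms by (auto simp: p_def)
  have b: "b > 0" using p assms by (simp add: b_def)
  have R: "R > 0" using assms(1) by (simp add: R_def add_nonneg_pos)
  have G: "Gamma b > 0" "Gamma (s / 2) > 0" "Gamma (p / 2) > 0" "Gamma ((p - s) / 2) > 0"
    using b assms p by (auto intro!: Gamma_real_pos)
  have pos: "(norm z)\<^sup>2 + y\<^sup>2 > 0" for z :: 'a using assms(1) by (simp add: add_nonneg_pos)
  define e where "e u t z = ennreal (u powr (b - 1) * exp (- u * y\<^sup>2) * t powr (s / 2 - 1)
      * exp (- u * (norm z)\<^sup>2 - t * (norm (x + z))\<^sup>2))" for u t :: real and z :: 'a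
  have [measurable (raw)]: "(\<lambda>x. e (f x) (g x) (h x)) \<in> borel_measurable M"
    if [measurable]: "f \<in> borel_measurable M" "g \<in> borel_measurable M" "h \<in> borel_measurable M"
    for f g h and M :: "'z measure"
    unfolding e_def by measurable
  have "ennreal (Gamma b * Gamma (s / 2)) * ?I
      = (\<integral>\<^sup>+z. ennreal (Gamma b * ((norm z)\<^sup>2 + y\<^sup>2) powr (- b)) * ennreal (Gamma (s / 2) * norm (x + z) powr (- s)) \<partial>lborel)"
    using G by (subst nn_integral_cmult[symmetric])
      (auto intro!: nn_integral_cong simp: ennreal_mult'[symmetric] b_def p_def algebra_simps)
  also have "\<dots> = (\<integral>\<^sup>+z. (\<integral>\<^sup>+u\<in>{0<..}. (\<integral>\<^sup>+t\<in>{0<..}. e u t z \<partial>lborel) \<partial>lborel) \<partial>lborel)"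
  proof (rule nn_integral_cong_AE)
    \<comment> \<open>At \<open>z = - x\<close> the left side is 0, by the convention
      \<open>0 powr a = 0\<close>, while the Gamma integral in \<open>t\<close> diverges; a single
      point is null.\<close>
    show "AE z in lborel. ennreal (Gamma b * ((norm z)\<^sup>2 + y\<^sup>2) powr (- b)) * ennreal (Gamma (s / 2) * norm (x + z) powr (- s))
      = (\<integral>\<^sup>+u\<in>{0<..}. (\<integral>\<^sup>+t\<in>{0<..}. e u t z \<partial>lborel) \<partial>lborel)"
      using AE_lborel_singleton[of "- x"]
    proof eventually_elim
      case (elim z)
      then have nz: "(norm (x + z))\<^sup>2 > 0" by (auto simp: add_eq_0_iff)
      have 1: "ennreal (Gamma b * ((norm z)\<^sup>2 + y\<^sup>2) powr (- b)) = (\<integral>\<^sup>+u\<in>{0<..}. ennreal (u powr (b - 1) * exp (- u * ((norm z)\<^sup>2 + y\<^sup>2))) \<partial>lborel)"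
        by (rule nn_integral_powr_exp[OF pos b, symmetric])
      have 2: "ennreal (Gamma (s / 2) * norm (x + z) powr (- s)) = (\<integral>\<^sup>+t\<in>{0<..}. ennreal (t powr (s / 2 - 1) * exp (- t * (norm (x + z))\<^sup>2)) \<partial>lborel)"
      proof -
        have "norm (x + z) powr (- s) = ((norm (x + z))\<^sup>2) powr (- (s / 2))"
          using nz by (simp add: powr_numeral[symmetric] powr_powr del: powr_numeral)
        then show ?thesis using nn_integral_powr_exp[OF nz, of "s / 2"] assms by simp
      qed
      have 3: "e u t z = ennreal (u powr (b - 1) * exp (- u * ((norm z)\<^sup>2 + y\<^sup>2))) * ennreal (t powr (s / 2 - 1) * exp (- t * (norm (x + z))\<^sup>2))" for u t
      proof -
        have "exp (- u * y\<^sup>2) * exp (- u * (norm z)\<^sup>2 - t * (norm (x + z))\<^sup>2) = exp (- u * ((norm z)\<^sup>2 + y\<^sup>2)) * exp (- t * (norm (x + z))\<^sup>2)"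
          by (simp add: exp_add[symmetric] algebra_simps)
        then show ?thesis unfolding e_def by (simp add: ennreal_mult'[symmetric] mult_ac)
      qed
      show ?case unfolding 1 2 3 by (rule nn_integral_set_mult) measurable
    qed
  qed
  also have "\<dots> = (\<integral>\<^sup>+u\<in>{0<..}. (\<integral>\<^sup>+t\<in>{0<..}. (\<integral>\<^sup>+z. e u t z \<partial>lborel) \<partial>lborel) \<partial>lborel)"
  proof -
    have "(\<integral>\<^sup>+z. (\<integral>\<^sup>+u\<in>{0<..}. (\<integral>\<^sup>+t\<in>{0<..}. e u t z \<partial>lborel) \<partial>lborel) \<partial>lborel)
      = (\<integral>\<^sup>+u\<in>{0<..}. (\<integral>\<^sup>+z. (\<integral>\<^sup>+t\<in>{0<..}. e u t z \<partial>lborel) \<partial>lborel) \<partial>lborel)"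
      by (rule nn_integral_lborel_swap) measurable
    moreover have "(\<integral>\<^sup>+z. (\<integral>\<^sup>+t\<in>{0<..}. e u t z \<partial>lborel) \<partial>lborel) = (\<integral>\<^sup>+t\<in>{0<..}. (\<integral>\<^sup>+z. e u t z \<partial>lborel) \<partial>lborel)" for u
      by (rule nn_integral_lborel_swap) measurable
    ultimately show ?thesis by simp
  qed
  also have "\<dots> = (\<integral>\<^sup>+u\<in>{0<..}. (\<integral>\<^sup>+v\<in>{0<..}. ennreal (pi powr (p / 2) * (v powr (s / 2 - 1) * (1 + v) powr (- p / 2) *
       (u powr (p / 2 - 1) * exp (- u * (y\<^sup>2 + v / (1 + v) * (norm x)\<^sup>2))))) \<partial>lborel) \<partial>lborel)"
  proof (rule nn_integral_halfline_cong)
    fix u :: real assume u: "0 < u"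
    define f where "f t = u powr (b - 1) * exp (- u * y\<^sup>2) * t powr (s / 2 - 1)
      * ((pi / (u + t)) powr (p / 2) * exp (- (u * t / (u + t)) * (norm x)\<^sup>2))" for t
    have [measurable]: "f \<in> borel_measurable borel" unfolding f_def by measurable
    have "(\<integral>\<^sup>+z. e u t z \<partial>lborel) = ennreal (f t)" if "t > 0" for t
    proof -
      have "(\<integral>\<^sup>+z. e u t z \<partial>lborel) = ennreal (u powr (b - 1) * exp (- u * y\<^sup>2) * t powr (s / 2 - 1)) *
        (\<integral>\<^sup>+z. ennreal (exp (- u * (norm z)\<^sup>2 - t * (norm (x + z))\<^sup>2)) \<partial>lborel)"
        unfolding e_def by (subst nn_integral_cmult[symmetric]) (auto simp: ennreal_mult')
      then show ?thesis unfolding nn_integral_gaussian_mult[OF u that] f_def p_def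
        by (simp add: ennreal_mult'[symmetric] algebra_simps)
    qed
    then have "(\<integral>\<^sup>+t\<in>{0<..}. (\<integral>\<^sup>+z. e u t z \<partial>lborel) \<partial>lborel) = (\<integral>\<^sup>+t\<in>{0<..}. ennreal (f t) \<partial>lborel)"
      by (intro nn_integral_cong) (auto simp: indicator_def)
    also have "\<dots> = (\<integral>\<^sup>+v\<in>{0<..}. ennreal (u * f (u * v)) \<partial>lborel)"
      using u by (intro nn_integral_halfline_scale) auto
    also have "\<dots> = (\<integral>\<^sup>+v\<in>{0<..}. ennreal (pi powr (p / 2) * (v powr (s / 2 - 1) * (1 + v) powr (- p / 2) *
       (u powr (p / 2 - 1) * exp (- u * (y\<^sup>2 + v / (1 + v) * (norm x)\<^sup>2))))) \<partial>lborel)"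
    proof (rule nn_integral_halfline_cong)
      fix v :: real assume v: "0 < v"
      have 1: "u + u * v = u * (1 + v)" by (simp add: algebra_simps)
      have 2: "u * (u * v) / (u * (1 + v)) = u * (v / (1 + v))" using u by simp
      have "u * f (u * v) = u * u powr (b - 1) * u powr (s / 2 - 1) * u powr (- p / 2) *
         (pi powr (p / 2) * (v powr (s / 2 - 1) * (1 + v) powr (- p / 2) *
         (exp (- u * y\<^sup>2) * exp (- (u * (v / (1 + v))) * (norm x)\<^sup>2))))"
        unfolding f_def 1 2 using u v by (simp add: powr_divide powr_mult powr_minus_divide)
      \<comment> \<open>The exponents collect to \<open>p / 2 - 1\<close> because
        \<open>b + s / 2 = p\<close>.\<close>
      also have "u * u powr (b - 1) * u powr (s / 2 - 1) * u powr (- p / 2) = u powr (p / 2 - 1)"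
      proof -
        have "u * u powr (b - 1) * u powr (s / 2 - 1) * u powr (- p / 2) = u powr (1 + (b - 1) + (s / 2 - 1) + (- p / 2))"
          unfolding powr_add using u by simp
        also have "1 + (b - 1) + (s / 2 - 1) + (- p / 2) = p / 2 - 1" by (simp add: b_def field_simps)
        finally show ?thesis .
      qed
      also have "exp (- u * y\<^sup>2) * exp (- (u * (v / (1 + v))) * (norm x)\<^sup>2) = exp (- u * (y\<^sup>2 + v / (1 + v) * (norm x)\<^sup>2))"
        by (simp add: exp_add[symmetric] algebra_simps)
      finally show "ennreal (u * f (u * v)) = ennreal (pi powr (p / 2) * (v powr (s / 2 - 1) * (1 + v) powr (- p / 2) *
       (u powr (p / 2 - 1) * exp (- u * (y\<^sup>2 + v / (1 + v) * (norm x)\<^sup>2)))))"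
        by (simp add: mult_ac)
    qed
    finally show "(\<integral>\<^sup>+t\<in>{0<..}. (\<integral>\<^sup>+z. e u t z \<partial>lborel) \<partial>lborel) = \<dots>" .
  qed
  also have "\<dots> = (\<integral>\<^sup>+v\<in>{0<..}. (\<integral>\<^sup>+u\<in>{0<..}. ennreal (pi powr (p / 2) * (v powr (s / 2 - 1) * (1 + v) powr (- p / 2) *
       (u powr (p / 2 - 1) * exp (- u * (y\<^sup>2 + v / (1 + v) * (norm x)\<^sup>2))))) \<partial>lborel) \<partial>lborel)"
    by (rule nn_integral_lborel_swap_set) measurable
  also have "\<dots> = (\<integral>\<^sup>+v\<in>{0<..}. (\<integral>\<^sup>+w\<in>{0<..}. ennreal (pi powr (p / 2) * (w powr (p / 2 - 1) * exp (- w * y\<^sup>2) *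
       (v powr (s / 2 - 1) * exp (- v * (w * R))))) \<partial>lborel) \<partial>lborel)"
  proof (rule nn_integral_halfline_cong)
    fix v :: real assume v: "0 < v"
    define f where "f u = pi powr (p / 2) * (v powr (s / 2 - 1) * (1 + v) powr (- p / 2) *
       (u powr (p / 2 - 1) * exp (- u * (y\<^sup>2 + v / (1 + v) * (norm x)\<^sup>2))))" for u
    have [measurable]: "f \<in> borel_measurable borel" unfolding f_def by measurable
    have "(\<integral>\<^sup>+u\<in>{0<..}. ennreal (f u) \<partial>lborel) = (\<integral>\<^sup>+w\<in>{0<..}. ennreal ((1 + v) * f ((1 + v) * w)) \<partial>lborel)"
      using v by (intro nn_integral_halfline_scale) auto
    also have "\<dots> = (\<integral>\<^sup>+w\<in>{0<..}. ennreal (pi powr (p / 2) * (w powr (p / 2 - 1) * exp (- w * y\<^sup>2) *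
       (v powr (s / 2 - 1) * exp (- v * (w * R))))) \<partial>lborel)"
    proof (rule nn_integral_halfline_cong)
      fix w :: real assume w: "0 < w"
      \<comment> \<open>With \<open>u = (1 + v) w\<close> the fraction \<open>v / (1 + v)\<close> is
        cleared, and the exponent splits into a part with \<open>y\<close> alone and a part with
        \<open>R\<close>.\<close>
      have 1: "(1 + v) * w * (y\<^sup>2 + v / (1 + v) * (norm x)\<^sup>2) = w * y\<^sup>2 + v * (w * R)"
        using v unfolding R_def by (simp add: field_simps)
      have "(1 + v) * f ((1 + v) * w) = ((1 + v) * (1 + v) powr (- p / 2) * (1 + v) powr (p / 2 - 1)) *
         (pi powr (p / 2) * (v powr (s / 2 - 1) * (w powr (p / 2 - 1) * exp (- ((1 + v) * w * (y\<^sup>2 + v / (1 + v) * (norm x)\<^sup>2))))))"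
        unfolding f_def using v w by (simp add: powr_mult mult_ac)
      also have "(1 + v) * (1 + v) powr (- p / 2) * (1 + v) powr (p / 2 - 1) = 1"
        using v by (simp add: powr_diff powr_minus_divide)
      also have "exp (- ((1 + v) * w * (y\<^sup>2 + v / (1 + v) * (norm x)\<^sup>2))) = exp (- w * y\<^sup>2) * exp (- v * (w * R))"
        unfolding 1 by (simp add: exp_add[symmetric])
      finally show "ennreal ((1 + v) * f ((1 + v) * w)) = ennreal (pi powr (p / 2) * (w powr (p / 2 - 1) * exp (- w * y\<^sup>2) *
       (v powr (s / 2 - 1) * exp (- v * (w * R)))))" by (simp add: mult_ac)
    qed
    finally show "(\<integral>\<^sup>+u\<in>{0<..}. ennreal (pi powr (p / 2) * (v powr (s / 2 - 1) * (1 + v) powr (- p / 2) *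
       (u powr (p / 2 - 1) * exp (- u * (y\<^sup>2 + v / (1 + v) * (norm x)\<^sup>2))))) \<partial>lborel) =
       (\<integral>\<^sup>+w\<in>{0<..}. ennreal (pi powr (p / 2) * (w powr (p / 2 - 1) * exp (- w * y\<^sup>2) *
       (v powr (s / 2 - 1) * exp (- v * (w * R))))) \<partial>lborel)" unfolding f_def by simp
  qed
  also have "\<dots> = (\<integral>\<^sup>+w\<in>{0<..}. (\<integral>\<^sup>+v\<in>{0<..}. ennreal (pi powr (p / 2) * (w powr (p / 2 - 1) * exp (- w * y\<^sup>2) *
       (v powr (s / 2 - 1) * exp (- v * (w * R))))) \<partial>lborel) \<partial>lborel)"
    by (rule nn_integral_lborel_swap_set) measurable
  also have "\<dots> = (\<integral>\<^sup>+w\<in>{0<..}. ennreal (pi powr (p / 2) * Gamma (s / 2) * R powr (- s / 2) *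
      (w powr ((p - s) / 2 - 1) * exp (- w * y\<^sup>2))) \<partial>lborel)"
  proof (rule nn_integral_halfline_cong)
    fix w :: real assume w: "0 < w"
    have "(\<integral>\<^sup>+v\<in>{0<..}. ennreal (pi powr (p / 2) * (w powr (p / 2 - 1) * exp (- w * y\<^sup>2) *
       (v powr (s / 2 - 1) * exp (- v * (w * R))))) \<partial>lborel)
      = ennreal (pi powr (p / 2) * (w powr (p / 2 - 1) * exp (- w * y\<^sup>2))) *
        (\<integral>\<^sup>+v\<in>{0<..}. ennreal (v powr (s / 2 - 1) * exp (- v * (w * R))) \<partial>lborel)"
      by (subst nn_integral_cmult[symmetric]) (auto simp: ennreal_mult' mult_ac)
    also have "\<dots> = ennreal (pi powr (p / 2) * (w powr (p / 2 - 1) * exp (- w * y\<^sup>2)) * (Gamma (s / 2) * (w * R) powr (- (s / 2))))"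
      using w R assms G by (subst nn_integral_powr_exp) (auto simp: ennreal_mult'[symmetric])
    also have "pi powr (p / 2) * (w powr (p / 2 - 1) * exp (- w * y\<^sup>2)) * (Gamma (s / 2) * (w * R) powr (- (s / 2)))
      = (w powr (p / 2 - 1) * w powr (- (s / 2))) * (pi powr (p / 2) * Gamma (s / 2) * R powr (- s / 2) * exp (- w * y\<^sup>2))"
      using w R by (simp add: powr_mult mult_ac)
    also have "w powr (p / 2 - 1) * w powr (- (s / 2)) = w powr ((p - s) / 2 - 1)"
    proof -
      have "p / 2 - 1 + - (s / 2) = (p - s) / 2 - 1" by (simp add: diff_divide_distrib)
      then show ?thesis by (simp only: powr_add[symmetric])
    qed
    finally show "(\<integral>\<^sup>+v\<in>{0<..}. ennreal (pi powr (p / 2) * (w powr (p / 2 - 1) * exp (- w * y\<^sup>2) *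
       (v powr (s / 2 - 1) * exp (- v * (w * R))))) \<partial>lborel) = ennreal (pi powr (p / 2) * Gamma (s / 2) * R powr (- s / 2) *
      (w powr ((p - s) / 2 - 1) * exp (- w * y\<^sup>2)))" by (simp add: mult_ac)
  qed
  also have "\<dots> = ennreal (pi powr (p / 2) * Gamma (s / 2) * R powr (- s / 2)) *
      (\<integral>\<^sup>+w\<in>{0<..}. ennreal (w powr ((p - s) / 2 - 1) * exp (- w * y\<^sup>2)) \<partial>lborel)"
    using G by (subst nn_integral_cmult[symmetric]) (auto simp: ennreal_mult' mult_ac)
  also have "\<dots> = ennreal (pi powr (p / 2) * Gamma (s / 2) * R powr (- s / 2) * (Gamma ((p - s) / 2) * (y\<^sup>2) powr (- ((p - s) / 2))))"
    using G assms p by (subst nn_integral_powr_exp) (auto simp: ennreal_mult'[symmetric])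
  also have "(y\<^sup>2) powr (- ((p - s) / 2)) = y powr (s - p)"
  proof -
    have "2 * (- ((p - s) / 2)) = s - p" by (simp add: field_simps)
    then have "(y powr 2) powr (- ((p - s) / 2)) = y powr (s - p)" by (simp only: powr_powr)
    then show ?thesis using assms(1) by simp
  qed
  finally have *: "ennreal (Gamma b * Gamma (s / 2)) * ?I =
     ennreal (pi powr (p / 2) * Gamma (s / 2) * R powr (- s / 2) * (Gamma ((p - s) / 2) * y powr (s - p)))" .
  have "ennreal (pi powr (p / 2) * Gamma ((p - s) / 2) / Gamma b * y powr (s - p) * R powr (- s / 2))
    = ennreal (1 / (Gamma b * Gamma (s / 2))) * ennreal (pi powr (p / 2) * Gamma (s / 2) * R powr (- s / 2) * (Gamma ((p - s) / 2) * y powr (s - p)))"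
    using G by (simp add: ennreal_mult'[symmetric])
  also have "\<dots> = ennreal (1 / (Gamma b * Gamma (s / 2))) * ennreal (Gamma b * Gamma (s / 2)) * ?I"
    by (simp only: * mult.assoc)
  also have "ennreal (1 / (Gamma b * Gamma (s / 2))) * ennreal (Gamma b * Gamma (s / 2)) = 1"
    using G by (simp add: ennreal_mult'[symmetric])
  finally show ?thesis by (simp add: p_def R_def b_def)
qed

section \<open>The Riesz kernel and its Poisson means\<close>

lemma borel_measurable_riesz_kernel [measurable (raw)]:
  fixes f g :: "'b \<Rightarrow> 'a::euclidean_space"
  assumes [measurable]: "f \<in> borel_measurable M" "g \<in> borel_measurable M"
  shows "(\<lambda>x. riesz_kernel s (f x) (g x)) \<in> borel_measurable M"
proof -
  have "(\<lambda>x. riesz_kernel s (f x) (g x)) = (\<lambda>x. if dist (f x) (g x) = 0 then \<infinity> else ennreal (dist (f x) (g x) powr (- s)))"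
    by (auto simp: riesz_kernel_def)
  also have "\<dots> \<in> borel_measurable M" by measurable
  finally show ?thesis .
qed

lemma riesz_kernel_commute: "riesz_kernel s x y = riesz_kernel s y x"
  by (simp add: riesz_kernel_def dist_commute)

lemma power2_powr:
  assumes "0 < (y::real)"
  shows "(y\<^sup>2) powr e = y powr (2 * e)"
proof -
  have "(y powr 2) powr e = y powr (2 * e)" by (rule powr_powr)
  then show ?thesis using assms by simp
qed

text \<open>Combines \<open>ln (1 + x) \<le> x\<close> with \<open>1 + z \<le> exp z\<close>. It
  supplies the inverse-square decay of \<open>k - P_y * k\<close> relative to
  \<open>k\<close>.\<close>

lemma one_minus_powr_le:
  assumes "0 \<le> x" "0 \<le> b"
  shows "1 - (1 + x) powr (- b) \<le> b * (x::real)"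
proof -
  have "1 - b * x \<le> 1 + (- b) * ln (1 + x)"
    using assms by (simp add: ln_add_one_self_le_self mult_left_mono)
  also have "\<dots> \<le> exp ((- b) * ln (1 + x))" by (rule exp_ge_add_one_self)
  also have "\<dots> = (1 + x) powr (- b)" using assms by (simp add: powr_def)
  finally show ?thesis by simp
qed

text \<open>The Poisson kernel of the degenerate elliptic extension problem of Caffarelli and Silvestre
  for the Riesz kernel of exponent \<open>s\<close>.\<close>

definition poisson :: "real \<Rightarrow> real \<Rightarrow> 'a::euclidean_space \<Rightarrow> real" where
  "poisson s y z = Gamma (real DIM('a) - s / 2) / (pi powr (real DIM('a) / 2) * Gamma ((real DIM('a) - s) / 2))
     * y powr (real DIM('a) - s) * ((norm z)\<^sup>2 + y\<^sup>2) powr (s / 2 - real DIM('a))"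

text \<open>Since \<open>poisson s y\<close> is even, this is the convolution
  \<open>P_y * u\<close>.\<close>

definition poisson_mean :: "real \<Rightarrow> real \<Rightarrow> ('a::euclidean_space \<Rightarrow> ennreal) \<Rightarrow> 'a \<Rightarrow> ennreal" where
  "poisson_mean s y u x = (\<integral>\<^sup>+z. ennreal (poisson s y z) * u (x + z) \<partial>lborel)"

text \<open>For \<open>y > 0\<close>, the Riesz kernel between the points \<open>(x, y)\<close> and
  \<open>(b, 0)\<close> in one dimension more.\<close>

definition smooth_kernel :: "real \<Rightarrow> real \<Rightarrow> 'a::real_normed_vector \<Rightarrow> 'a \<Rightarrow> ennreal" where
  "smooth_kernel s y x b = ennreal (((dist x b)\<^sup>2 + y\<^sup>2) powr (- s / 2))"

locale riesz =
  fixes s :: real and T :: "'a::euclidean_space itself"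
  assumes s_pos: "0 < s" and s_gt: "real DIM('a) - 2 < s" and s_less: "s < real DIM('a)"
begin

lemma Gamma_pos: "Gamma (DIM('a) - s / 2) > 0" "Gamma ((DIM('a) - s) / 2) > 0"
  using s_pos s_less by (auto intro!: Gamma_real_pos)

lemma borel_measurable_poisson [measurable (raw)]:
  fixes f :: "'b \<Rightarrow> 'a"
  assumes [measurable]: "f \<in> borel_measurable M" "g \<in> borel_measurable M"
  shows "(\<lambda>x. poisson s (g x) (f x)) \<in> borel_measurable M"
  unfolding poisson_def by measurable

lemma borel_measurable_smooth_kernel [measurable (raw)]:
  fixes f g :: "'b \<Rightarrow> 'a"
  assumes [measurable]: "f \<in> borel_measurable M" "g \<in> borel_measurable M"
  shows "(\<lambda>x. smooth_kernel s y (f x) (g x)) \<in> borel_measurable M"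
  unfolding smooth_kernel_def by measurable

lemma borel_measurable_poisson_mean [measurable (raw)]:
  fixes u :: "'a \<Rightarrow> ennreal"
  assumes [measurable]: "u \<in> borel_measurable borel" "f \<in> borel_measurable M" "g \<in> borel_measurable M"
  shows "(\<lambda>x. poisson_mean s (g x) u (f x)) \<in> borel_measurable M"
  unfolding poisson_mean_def by measurable

lemma poisson_nonneg: "0 \<le> poisson s y (z::'a)"
  unfolding poisson_def using Gamma_pos by simp

lemma poisson_pos: "y > 0 \<Longrightarrow> 0 < poisson s y (z::'a)"
  unfolding poisson_def using Gamma_pos by (auto simp: add_nonneg_eq_0_iff)

lemma nn_integral_poisson:
  assumes "y > 0"
  shows "(\<integral>\<^sup>+z. ennreal (poisson s y (z::'a)) \<partial>lborel) = 1"
proof -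
  define K where "K = Gamma (DIM('a) - s / 2) / (pi powr (DIM('a) / 2) * Gamma ((DIM('a) - s) / 2)) * y powr (DIM('a) - s)"
  have K: "K \<ge> 0" unfolding K_def using Gamma_pos by simp
  have eq: "DIM('a) - s / 2 - DIM('a) / 2 = (DIM('a) - s) / 2" "DIM('a) - 2 * (DIM('a) - s / 2) = - (DIM('a) - s)"
    by (auto simp: field_simps)
  have "(\<integral>\<^sup>+z. ennreal (poisson s y (z::'a)) \<partial>lborel)
      = ennreal K * (\<integral>\<^sup>+z. ennreal (((norm (z::'a))\<^sup>2 + y\<^sup>2) powr (- (DIM('a) - s / 2))) \<partial>lborel)"
  proof -
    have "poisson s y z = K * ((norm z)\<^sup>2 + y\<^sup>2) powr (- (DIM('a) - s / 2))" for z :: 'a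
      unfolding poisson_def K_def by simp
    then have "(\<integral>\<^sup>+z. ennreal (poisson s y (z::'a)) \<partial>lborel)
        = (\<integral>\<^sup>+z. ennreal K * ennreal (((norm (z::'a))\<^sup>2 + y\<^sup>2) powr (- (DIM('a) - s / 2))) \<partial>lborel)"
      using K by (simp only: ennreal_mult')
    also have "\<dots> = ennreal K * (\<integral>\<^sup>+z. ennreal (((norm (z::'a))\<^sup>2 + y\<^sup>2) powr (- (DIM('a) - s / 2))) \<partial>lborel)"
      by (rule nn_integral_cmult) measurable
    finally show ?thesis .
  qed
  also have "(\<integral>\<^sup>+z. ennreal (((norm (z::'a))\<^sup>2 + y\<^sup>2) powr (- (DIM('a) - s / 2))) \<partial>lborel)
      = ennreal (pi powr (DIM('a) / 2) * Gamma ((DIM('a) - s) / 2) / Gamma (DIM('a) - s / 2) * y powr (- (DIM('a) - s)))"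
    using s_less assms by (subst nn_integral_inverse_power) (auto simp: eq)
  also have "ennreal K * \<dots> = ennreal (K * (pi powr (DIM('a) / 2) * Gamma ((DIM('a) - s) / 2) / Gamma (DIM('a) - s / 2) * y powr (- (DIM('a) - s))))"
    using K by (simp only: ennreal_mult')
  also have "\<dots> = 1"
  proof -
    have "y powr (DIM('a) - s) * y powr (- (DIM('a) - s)) = 1"
      using assms by (subst powr_add[symmetric]) simp
    then show ?thesis unfolding K_def using Gamma_pos by (simp add: field_simps)
  qed
  finally show ?thesis .
qed

lemma poisson_mean_const:
  "y > 0 \<Longrightarrow> poisson_mean s y (\<lambda>_. c) (x::'a) = c"
  unfolding poisson_mean_def by (subst nn_integral_multc) (auto simp: nn_integral_poisson)

lemma poisson_mean_mono:
  "(\<And>x. u x \<le> u' x) \<Longrightarrow> poisson_mean s y u x \<le> poisson_mean s y u' x"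
  unfolding poisson_mean_def by (intro nn_integral_mono mult_left_mono) auto

lemma poisson_mean_add:
  fixes x :: 'a
  assumes [measurable]: "u \<in> borel_measurable borel" "u' \<in> borel_measurable borel"
  shows "poisson_mean s y (\<lambda>x. u x + u' x) x = poisson_mean s y u x + poisson_mean s y u' x"
  unfolding poisson_mean_def by (subst nn_integral_add[symmetric]) (auto simp: distrib_left)

text \<open>The Gamma factors of the convolution integral are those that normalise the Poisson
  kernel, so the resulting constant is 1.\<close>

lemma poisson_mean_kernel:
  fixes x b :: 'a
  assumes "y > 0"
  shows "poisson_mean s y (\<lambda>x. riesz_kernel s x b) x = smooth_kernel s y x b"
proof -
  define K where "K = Gamma (DIM('a) - s / 2) / (pi powr (DIM('a) / 2) * Gamma ((DIM('a) - s) / 2)) * y powr (DIM('a) - s)"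
  have K: "K \<ge> 0" unfolding K_def using Gamma_pos by simp
  have "poisson_mean s y (\<lambda>x. riesz_kernel s x b) x
    = (\<integral>\<^sup>+z. ennreal K * ennreal (((norm z)\<^sup>2 + y\<^sup>2) powr (s / 2 - DIM('a)) * norm ((x - b) + z) powr (- s)) \<partial>lborel)"
    unfolding poisson_mean_def
  proof (rule nn_integral_cong_AE)
    show "AE z in lborel. ennreal (poisson s y z) * riesz_kernel s (x + z) b =
        ennreal K * ennreal (((norm z)\<^sup>2 + y\<^sup>2) powr (s / 2 - DIM('a)) * norm ((x - b) + z) powr (- s))"
      using AE_lborel_singleton[of "b - x"]
    proof eventually_elim
      case (elim z)
      then have "x + z \<noteq> b" by auto
      then show ?case using K unfolding riesz_kernel_def
        by (simp add: ennreal_mult'[symmetric] ennreal_mult[symmetric] poisson_def K_def dist_norm algebra_simps)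
    qed
  qed
  also have "\<dots> = ennreal K * (\<integral>\<^sup>+z. ennreal (((norm z)\<^sup>2 + y\<^sup>2) powr (s / 2 - DIM('a)) * norm ((x - b) + z) powr (- s)) \<partial>lborel)"
    by (rule nn_integral_cmult) measurable
  also have "\<dots> = ennreal (K * (pi powr (DIM('a) / 2) * Gamma ((DIM('a) - s) / 2) / Gamma (DIM('a) - s / 2)
           * y powr (s - DIM('a)) * ((norm (x - b))\<^sup>2 + y\<^sup>2) powr (- s / 2)))"
    using s_pos s_less assms K by (subst nn_integral_inverse_power_mult) (simp_all only: ennreal_mult')
  also have "\<dots> = smooth_kernel s y x b"
  proof -
    have "y powr (DIM('a) - s) * y powr (s - DIM('a)) = 1"
      using assms by (simp add: powr_add[symmetric])
    then have "K * (pi powr (DIM('a) / 2) * Gamma ((DIM('a) - s) / 2) / Gamma (DIM('a) - s / 2) * y powr (s - DIM('a))) = 1"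
      unfolding K_def using Gamma_pos by (simp add: field_simps)
    then have "K * (pi powr (DIM('a) / 2) * Gamma ((DIM('a) - s) / 2) / Gamma (DIM('a) - s / 2) * y powr (s - DIM('a)) * R) = R" for R
      by (simp only: mult.assoc[symmetric] mult_1_left)
    then show ?thesis unfolding smooth_kernel_def dist_norm by simp
  qed
  finally show ?thesis .
qed

lemma smooth_kernel_le: "smooth_kernel s y x b \<le> riesz_kernel s x (b::'a)"
proof (cases "x = b")
  case False
  then have "((dist x b)\<^sup>2 + y\<^sup>2) powr (- s / 2) \<le> ((dist x b)\<^sup>2) powr (- s / 2)"
    using s_pos by (intro powr_mono2') auto
  also have "\<dots> = dist x b powr (- s)"
    using False by (simp add: power2_powr)
  finally show ?thesis using False by (simp add: smooth_kernel_def riesz_kernel_def ennreal_leI)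
qed (simp add: riesz_kernel_def)

text \<open>\<open>P_y\<close> is the mass-preserving dilation of \<open>P_1\<close>. With
  \<open>y\<close> moved into the argument of \<open>u\<close>, the limit \<open>y -> 0\<close> can
  be taken under a fixed weight.\<close>

lemma poisson_mean_scale:
  fixes u :: "'a \<Rightarrow> ennreal"
  assumes [measurable]: "u \<in> borel_measurable borel" and "y > 0"
  shows "poisson_mean s y u x = (\<integral>\<^sup>+z. ennreal (poisson s 1 z) * u (x + y *\<^sub>R z) \<partial>lborel)"
proof -
  have eq: "y ^ DIM('a) * poisson s y (y *\<^sub>R z) = poisson s 1 z" for z :: 'a
  proof -
    have "(norm (y *\<^sub>R z))\<^sup>2 + y\<^sup>2 = y\<^sup>2 * ((norm z)\<^sup>2 + 1\<^sup>2)"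
      by (simp add: power_mult_distrib algebra_simps)
    then have "((norm (y *\<^sub>R z))\<^sup>2 + y\<^sup>2) powr (s / 2 - DIM('a)) = y powr (s - 2 * DIM('a)) * ((norm z)\<^sup>2 + 1\<^sup>2) powr (s / 2 - DIM('a))"
      using assms(2) by (simp add: powr_mult power2_powr right_diff_distrib mult.commute)
    moreover have "y ^ DIM('a) * y powr (DIM('a) - s) * y powr (s - 2 * DIM('a)) = 1"
      using assms(2) by (simp add: powr_realpow[symmetric] powr_add[symmetric])
    then have "y ^ DIM('a) * (G * y powr (DIM('a) - s) * (y powr (s - 2 * DIM('a)) * A)) = G * 1 powr (DIM('a) - s) * A" for G A :: real
      by (metis (no_types, lifting) mult.assoc mult.commute mult.right_neutral powr_one_eq_one)
    ultimately show ?thesis unfolding poisson_def by presburger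
  qed
  have "poisson_mean s y u x = ennreal (y ^ DIM('a)) * (\<integral>\<^sup>+z. ennreal (poisson s y (y *\<^sub>R z)) * u (x + y *\<^sub>R z) \<partial>lborel)"
    unfolding poisson_mean_def using assms(2) by (intro nn_integral_lborel_scale) auto
  also have "\<dots> = (\<integral>\<^sup>+z. ennreal (poisson s 1 z) * u (x + y *\<^sub>R z) \<partial>lborel)"
    using assms(2) by (subst nn_integral_cmult[symmetric])
      (auto intro!: nn_integral_cong simp: mult.assoc[symmetric] ennreal_mult[symmetric] poisson_nonneg eq)
  finally show ?thesis .
qed

text \<open>Lowering \<open>y\<close> inside the negative power only increases it, and the prefactor
  scales by \<open>y powr (p - s)\<close>. This factor matches the one in the bound for the error
  term, so the two cancel in the energy estimate.\<close>

lemma poisson_ge: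
  fixes z :: 'a
  assumes "0 < y" "y \<le> 1"
  shows "y powr (DIM('a) - s) * poisson s 1 z \<le> poisson s y z"
proof -
  have "((norm z)\<^sup>2 + 1\<^sup>2) powr (s / 2 - DIM('a)) \<le> ((norm z)\<^sup>2 + y\<^sup>2) powr (s / 2 - DIM('a))"
    using assms s_less by (intro powr_mono2') (auto simp: add_nonneg_pos power_le_one)
  then have "G * y powr (DIM('a) - s) * ((norm z)\<^sup>2 + 1\<^sup>2) powr (s / 2 - DIM('a)) \<le> G * y powr (DIM('a) - s) * ((norm z)\<^sup>2 + y\<^sup>2) powr (s / 2 - DIM('a))" if "G \<ge> 0" for G
    using that by (intro mult_left_mono) auto
  from this[of "Gamma (DIM('a) - s / 2) / (pi powr (DIM('a) / 2) * Gamma ((DIM('a) - s) / 2))"]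
  show ?thesis unfolding poisson_def using Gamma_pos by (simp add: mult_ac)
qed

text \<open>Any average of dilated Poisson kernels keeps the potential of \<open>k\<close> below \<open>k\<close>. This weight has the decay
  that makes such an average dominate \<open>k - P\<^sub>y * k\<close>, which no single Poisson kernel does.\<close>

definition scale_weight :: "real \<Rightarrow> real" where
  "scale_weight t = t powr (DIM('a) - s - 1) * (1 + t) powr (- 2)"

lemma borel_measurable_scale_weight [measurable]: "scale_weight \<in> borel_measurable borel"
  unfolding scale_weight_def by measurable

lemma scale_weight_nonneg: "0 \<le> scale_weight t"
  by (simp add: scale_weight_def)

text \<open>A Beta integral: writing \<open>(1 + t) powr (- 2)\<close> as a Gamma integral yields
  \<open>Gamma a * Gamma (2 - a)\<close> with \<open>a = p - s\<close>, finite since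
  \<open>0 < a < 2\<close>. The bound \<open>a < 2\<close> is the hypothesis
  \<open>p - 2 < s\<close>.\<close>

lemma nn_integral_scale_weight: "(\<integral>\<^sup>+t\<in>{0<..}. ennreal (scale_weight t) \<partial>lborel) < \<infinity>"
proof -
  define a where "a = DIM('a) - s"
  have a: "0 < a" "a < 2" using s_less s_gt by (auto simp: a_def)
  have "(\<integral>\<^sup>+t\<in>{0<..}. ennreal (scale_weight t) \<partial>lborel)
      = (\<integral>\<^sup>+t\<in>{0<..}. (\<integral>\<^sup>+w\<in>{0<..}. ennreal (w * exp (- w) * (t powr (a - 1) * exp (- t * w))) \<partial>lborel) \<partial>lborel)"
  proof (rule nn_integral_halfline_cong)
    fix t :: real assume t: "0 < t"
    have "(\<integral>\<^sup>+w\<in>{0<..}. ennreal (w * exp (- w) * (t powr (a - 1) * exp (- t * w))) \<partial>lborel)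
      = (\<integral>\<^sup>+w. ennreal (t powr (a - 1)) * (ennreal (w powr (2 - 1) * exp (- w * (1 + t))) * indicator {0<..} w) \<partial>lborel)"
      by (intro nn_integral_cong) (auto simp: indicator_def ennreal_mult'[symmetric] exp_add[symmetric] algebra_simps simp flip: exp_diff)
    also have "\<dots> = ennreal (t powr (a - 1)) * ennreal (Gamma 2 * (1 + t) powr (- 2))"
    proof -
      have "(\<integral>\<^sup>+w\<in>{0<..}. ennreal (w powr (2 - 1) * exp (- w * (1 + t))) \<partial>lborel) = ennreal (Gamma 2 * (1 + t) powr (- 2))"
        using t by (intro nn_integral_powr_exp) auto
      then show ?thesis by (subst nn_integral_cmult) auto
    qed
    also have "\<dots> = ennreal (scale_weight t)"
      unfolding scale_weight_def a_def by (simp add: ennreal_mult'[symmetric] Gamma_numeral)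
    finally show "ennreal (scale_weight t) = (\<integral>\<^sup>+w\<in>{0<..}. ennreal (w * exp (- w) * (t powr (a - 1) * exp (- t * w))) \<partial>lborel)"
      by simp
  qed
  also have "\<dots> = (\<integral>\<^sup>+w\<in>{0<..}. (\<integral>\<^sup>+t\<in>{0<..}. ennreal (w * exp (- w) * (t powr (a - 1) * exp (- t * w))) \<partial>lborel) \<partial>lborel)"
    by (rule nn_integral_lborel_swap_set) measurable
  also have "\<dots> = (\<integral>\<^sup>+w\<in>{0<..}. ennreal (Gamma a * (w powr ((2 - a) - 1) * exp (- w * 1))) \<partial>lborel)"
  proof (rule nn_integral_halfline_cong)
    fix w :: real assume w: "0 < w"
    have "(\<integral>\<^sup>+t\<in>{0<..}. ennreal (w * exp (- w) * (t powr (a - 1) * exp (- t * w))) \<partial>lborel)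
      = ennreal (w * exp (- w)) * (\<integral>\<^sup>+t\<in>{0<..}. ennreal (t powr (a - 1) * exp (- t * w)) \<partial>lborel)"
      using w by (subst nn_integral_cmult[symmetric]) (auto simp: ennreal_mult' mult_ac)
    also have "\<dots> = ennreal (w * exp (- w) * (Gamma a * w powr (- a)))"
      using w a by (subst nn_integral_powr_exp) (auto simp: ennreal_mult')
    also have "w * exp (- w) * (Gamma a * w powr (- a)) = Gamma a * ((w powr 1 * w powr (- a)) * exp (- w))"
      using w by simp
    also have "w powr 1 * w powr (- a) = w powr (1 - a)" by (subst powr_add[symmetric]) simp
    finally show "(\<integral>\<^sup>+t\<in>{0<..}. ennreal (w * exp (- w) * (t powr (a - 1) * exp (- t * w))) \<partial>lborel)
       = ennreal (Gamma a * (w powr ((2 - a) - 1) * exp (- w * 1)))" by (simp add: algebra_simps)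
  qed
  also have "\<dots> = ennreal (Gamma a) * ennreal (Gamma (2 - a) * 1 powr (- (2 - a)))"
    using a Gamma_real_pos[of a]
    by (subst nn_integral_powr_exp[symmetric]; simp?; subst nn_integral_cmult[symmetric]) (auto simp: ennreal_mult' mult_ac)
  also have "\<dots> < \<infinity>" by (simp add: ennreal_mult_less_top)
  finally show ?thesis .
qed

section \<open>The kernel defect and its domination by averaged Poisson kernels\<close>

text \<open>On the diagonal the value is \<open>\<infinity>\<close>, since the subtracted term is
  finite there.\<close>

definition kernel_defect :: "real \<Rightarrow> 'a \<Rightarrow> 'a \<Rightarrow> ennreal" where
  "kernel_defect y x b = riesz_kernel s x b - smooth_kernel s y x b"

lemma borel_measurable_kernel_defect [measurable (raw)]:
  fixes f g :: "'b \<Rightarrow> 'a"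
  assumes [measurable]: "f \<in> borel_measurable M" "g \<in> borel_measurable M"
  shows "(\<lambda>x. kernel_defect y (f x) (g x)) \<in> borel_measurable M"
  unfolding kernel_defect_def by measurable

lemma kernel_defect_add: "smooth_kernel s y x b + kernel_defect y x b = riesz_kernel s x b"
  unfolding kernel_defect_def by (rule add_diff_inverse_ennreal[OF smooth_kernel_le])

text \<open>With \<open>r = \<rho> / y\<close> the left side is \<open>\<rho> powr (- s)\<close>
  times \<open>1 - (1 + 1 / r^2) powr (- (s / 2))\<close>. This factor is at most 1, which serves
  for \<open>r \<le> 1\<close>, and at most \<open>s / (2 r^2)\<close>, which serves for
  \<open>r > 1\<close>.\<close>

lemma kernel_defect_real_le:
  assumes "\<rho> > 0" "y > 0"
  shows "\<rho> powr (- s) - (\<rho>\<^sup>2 + y\<^sup>2) powr (- s / 2) \<le> (1 + s) * (\<rho> powr (- s) / (max 1 (\<rho> / y))\<^sup>2)"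
proof -
  define r where "r = \<rho> / y"
  have r: "r > 0" using assms by (simp add: r_def)
  have "(\<rho>\<^sup>2 + y\<^sup>2) = \<rho>\<^sup>2 * (1 + 1 / r\<^sup>2)"
    using assms by (simp add: r_def field_simps power_divide)
  then have "(\<rho>\<^sup>2 + y\<^sup>2) powr (- s / 2) = \<rho> powr (- s) * (1 + 1 / r\<^sup>2) powr (- (s / 2))"
    using assms r by (simp add: powr_mult power2_powr)
  then have eq: "\<rho> powr (- s) - (\<rho>\<^sup>2 + y\<^sup>2) powr (- s / 2) = \<rho> powr (- s) * (1 - (1 + 1 / r\<^sup>2) powr (- (s / 2)))"
    by (simp add: algebra_simps)
  have "1 - (1 + 1 / r\<^sup>2) powr (- (s / 2)) \<le> (1 + s) / (max 1 r)\<^sup>2"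
  proof (cases "r \<le> 1")
    case True
    then show ?thesis using s_pos by (simp add: max_def add_increasing2)
  next
    case False
    have "1 - (1 + 1 / r\<^sup>2) powr (- (s / 2)) \<le> s / 2 * (1 / r\<^sup>2)"
      using r s_pos by (intro one_minus_powr_le) auto
    also have "\<dots> \<le> (1 + s) / r\<^sup>2" using r s_pos by (simp add: divide_simps)
    finally show ?thesis using False by (simp add: max_def)
  qed
  then have "\<rho> powr (- s) * (1 - (1 + 1 / r\<^sup>2) powr (- (s / 2))) \<le> \<rho> powr (- s) * ((1 + s) / (max 1 r)\<^sup>2)"
    by (intro mult_left_mono) auto
  then show ?thesis unfolding eq r_def by (simp add: mult_ac)
qed

text \<open>It suffices to keep the heights \<open>t y\<close> between \<open>|z|\<close> and
  \<open>2 |z|\<close>, that is \<open>t\<close> in \<open>[r, 2 r]\<close> with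
  \<open>r = |z| / y\<close>. There \<open>P_(t y)\<close> at \<open>z\<close> is of order
  \<open>|z| powr (- p)\<close> and the weight of order \<open>r powr (a - 1) / (max 1 r)^2\<close>
  with \<open>a = p - s\<close>; multiplied by the length \<open>r\<close> of the interval and by
  \<open>y powr a\<close>, this is the required profile.\<close>

lemma poisson_mixture_ge:
  "\<exists>c>0. \<forall>y>0. \<forall>z::'a. z \<noteq> 0 \<longrightarrow>
     ennreal (c * (norm z powr (- s) / (max 1 (norm z / y))\<^sup>2))
       \<le> ennreal (y powr (DIM('a) - s)) * (\<integral>\<^sup>+t\<in>{0<..}. ennreal (scale_weight t * poisson s (t * y) z) \<partial>lborel)"
proof -
  define p where "p = real DIM('a)"
  define a where "a = p - s"
  have a: "0 < a" "a < 2" "p > 0" using s_less s_gt by (auto simp: a_def p_def)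
  define G where "G = Gamma (p - s / 2) / (pi powr (p / 2) * Gamma ((p - s) / 2))"
  have G: "G > 0" using Gamma_pos by (simp add: G_def p_def)
  \<comment> \<open>The 5 comes from \<open>|z|^2 + (t y)^2 \<le> 5 |z|^2\<close>, the 9 from
    \<open>1 + t \<le> 3 max 1 r\<close>, and \<open>2 powr (a - 2)\<close> from
    \<open>t \<le> 2 r\<close>, the exponent \<open>a - 2\<close> being negative.\<close>
  define c where "c = G * 5 powr (s / 2 - p) * (2 powr (a - 2) / 9)"
  have c: "c > 0" using G by (simp add: c_def)
  have "ennreal (c * (norm z powr (- s) / (max 1 (norm z / y))\<^sup>2))
       \<le> ennreal (y powr a) * (\<integral>\<^sup>+t\<in>{0<..}. ennreal (scale_weight t * poisson s (t * y) z) \<partial>lborel)"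
    if y: "y > 0" and z: "z \<noteq> 0" for y and z :: 'a
  proof -
    define \<rho> where "\<rho> = norm z"
    define r where "r = \<rho> / y"
    define m where "m = max 1 r"
    have \<rho>: "\<rho> > 0" using z by (simp add: \<rho>_def)
    have r: "r > 0" "r * y = \<rho>" using y \<rho> by (auto simp: r_def)
    have m: "m \<ge> 1" "m \<ge> r" by (auto simp: m_def)
    define B where "B = (2 powr (a - 2) * r powr (a - 1) / (9 * m\<^sup>2)) * (G * 5 powr (s / 2 - p) * \<rho> powr (- p))"
    have B: "B \<ge> 0" using G by (simp add: B_def)
    have *: "B \<le> scale_weight t * poisson s (t * y) z" if t: "r \<le> t" "t \<le> 2 * r" for t
    proof -
      have t0: "t > 0" using t r by auto
      have 1: "2 powr (a - 2) * r powr (a - 1) / (9 * m\<^sup>2) \<le> scale_weight t"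
      proof -
        have "(1 + t)\<^sup>2 \<le> (3 * m)\<^sup>2" using t m t0 by (intro power_mono) auto
        then have q: "(1 + t) powr (- 2) \<ge> 1 / (9 * m\<^sup>2)"
          using t0 by (simp add: powr_minus powr_numeral power_mult_distrib divide_inverse[symmetric] inverse_eq_divide frac_le)
        have "(2 * r) powr (a - 2) * r powr 1 \<le> t powr (a - 2) * t powr 1"
          using t t0 r a by (intro mult_mono powr_mono2' powr_mono2) auto
        also have "\<dots> = t powr (a - 1)" by (subst powr_add[symmetric]) (simp add: algebra_simps)
        also have "(2 * r) powr (a - 2) * r powr 1 = 2 powr (a - 2) * r powr (a - 1)"
        proof -
          have "r powr (a - 2) * r powr 1 = r powr (a - 1)" by (subst powr_add[symmetric]) (simp add: algebra_simps)
          then show ?thesis using r by (simp add: powr_mult mult.assoc del: powr_one)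
        qed
        finally have "2 powr (a - 2) * r powr (a - 1) * (1 / (9 * m\<^sup>2)) \<le> t powr (a - 1) * (1 + t) powr (- 2)"
          using q by (intro mult_mono) auto
        then show ?thesis unfolding scale_weight_def a_def p_def by simp
      qed
      have ty: "\<rho> \<le> t * y" "t * y \<le> 2 * \<rho>"
        using t y r by (metis mult_le_cancel_right_pos) (use t y r in \<open>metis mult.assoc mult_le_cancel_right_pos\<close>)
      have 2: "G * 5 powr (s / 2 - p) * \<rho> powr (- p) \<le> poisson s (t * y) z"
      proof -
        have "\<rho>\<^sup>2 + (t * y)\<^sup>2 \<le> \<rho>\<^sup>2 + (2 * \<rho>)\<^sup>2" using ty \<rho> by (intro add_left_mono power_mono) auto
        then have "(5 * \<rho>\<^sup>2) powr (s / 2 - p) \<le> (\<rho>\<^sup>2 + (t * y)\<^sup>2) powr (s / 2 - p)"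
          using \<rho> s_less s_pos by (intro powr_mono2') (auto simp: add_pos_nonneg p_def)
        moreover have "\<rho> powr a \<le> (t * y) powr a" using ty \<rho> a by (intro powr_mono2) auto
        ultimately have "\<rho> powr a * (5 * \<rho>\<^sup>2) powr (s / 2 - p) \<le> (t * y) powr a * (\<rho>\<^sup>2 + (t * y)\<^sup>2) powr (s / 2 - p)"
          by (intro mult_mono) auto
        then have "G * (\<rho> powr a * (5 * \<rho>\<^sup>2) powr (s / 2 - p)) \<le> G * ((t * y) powr a * (\<rho>\<^sup>2 + (t * y)\<^sup>2) powr (s / 2 - p))"
          using G by (intro mult_left_mono) auto
        also have "\<dots> = poisson s (t * y) z" unfolding poisson_def G_def a_def p_def \<rho>_def by simp
        also have "\<rho> powr a * (5 * \<rho>\<^sup>2) powr (s / 2 - p) = 5 powr (s / 2 - p) * (\<rho> powr a * \<rho> powr (s - 2 * p))"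
          using \<rho> by (simp add: powr_mult power2_powr algebra_simps)
        also have "\<rho> powr a * \<rho> powr (s - 2 * p) = \<rho> powr (- p)"
          by (simp add: powr_add[symmetric] a_def)
        finally show ?thesis by (simp add: mult_ac)
      qed
      show ?thesis unfolding B_def using 1 2 G scale_weight_nonneg by (intro mult_mono) auto
    qed
    have "ennreal (B * r) = (\<integral>\<^sup>+t. ennreal B * indicator {r..2 * r} t \<partial>lborel)"
      using r B by (simp add: nn_integral_cmult_indicator ennreal_mult')
    also have "\<dots> \<le> (\<integral>\<^sup>+t\<in>{0<..}. ennreal (scale_weight t * poisson s (t * y) z) \<partial>lborel)"
      using r by (intro nn_integral_mono) (auto simp: indicator_def intro!: ennreal_leI *)
    finally have "ennreal (y powr a) * ennreal (B * r) \<le> ennreal (y powr a) * (\<integral>\<^sup>+t\<in>{0<..}. ennreal (scale_weight t * poisson s (t * y) z) \<partial>lborel)"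
      by (intro mult_left_mono) auto
    moreover have "y powr a * (B * r) = c * (\<rho> powr (- s) / m\<^sup>2)"
    proof -
      have "y powr a * (B * r) = c / m\<^sup>2 * ((y powr a * (r powr (a - 1) * r)) * \<rho> powr (- p))"
        unfolding B_def c_def by (simp add: mult_ac)
      also have "y powr a * (r powr (a - 1) * r) = \<rho> powr a"
        using r y by (simp add: powr_diff powr_mult[symmetric] mult.commute)
      also have "\<rho> powr a * \<rho> powr (- p) = \<rho> powr (- s)" by (simp add: powr_add[symmetric] a_def)
      finally show ?thesis by simp
    qed
    ultimately show ?thesis using B r by (simp add: ennreal_mult'[symmetric] \<rho>_def m_def r_def)
  qed
  then show ?thesis using c unfolding a_def p_def by blast
qed

text \<open>The preceding upper and lower bounds have the same profile in \<open>|b - x|\<close>.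
  Once the defect is expressed by Poisson kernels, integrating it against a function produces
  Poisson means of that function, which excessive functions control.\<close>

lemma kernel_defect_le_mixture:
  "\<exists>C>0. \<forall>y>0. \<forall>x b::'a. x \<noteq> b \<longrightarrow> kernel_defect y x b
     \<le> ennreal (C * y powr (DIM('a) - s)) * (\<integral>\<^sup>+t\<in>{0<..}. ennreal (scale_weight t * poisson s (t * y) (b - x)) \<partial>lborel)"
proof -
  obtain c where c: "c > 0" and *: "\<And>y z. y > 0 \<Longrightarrow> z \<noteq> (0::'a) \<Longrightarrow>
     ennreal (c * (norm z powr (- s) / (max 1 (norm z / y))\<^sup>2))
       \<le> ennreal (y powr (DIM('a) - s)) * (\<integral>\<^sup>+t\<in>{0<..}. ennreal (scale_weight t * poisson s (t * y) z) \<partial>lborel)"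
    using poisson_mixture_ge by blast
  have "kernel_defect y x b \<le> ennreal ((1 + s) / c * y powr (DIM('a) - s)) * (\<integral>\<^sup>+t\<in>{0<..}. ennreal (scale_weight t * poisson s (t * y) (b - x)) \<partial>lborel)"
    if y: "y > 0" and ne: "x \<noteq> b" for y and x b :: 'a
  proof -
    have "kernel_defect y x b = ennreal (norm (b - x) powr (- s) - ((norm (b - x))\<^sup>2 + y\<^sup>2) powr (- s / 2))"
      using ne unfolding kernel_defect_def riesz_kernel_def smooth_kernel_def
      by (simp add: ennreal_minus dist_norm norm_minus_commute)
    also have "\<dots> \<le> ennreal ((1 + s) * (norm (b - x) powr (- s) / (max 1 (norm (b - x) / y))\<^sup>2))"
      using ne y by (intro ennreal_leI kernel_defect_real_le) auto
    also have "\<dots> = ennreal ((1 + s) / c) * ennreal (c * (norm (b - x) powr (- s) / (max 1 (norm (b - x) / y))\<^sup>2))"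
      using c s_pos by (subst ennreal_mult'[symmetric]) auto
    also have "\<dots> \<le> ennreal ((1 + s) / c) * (ennreal (y powr (DIM('a) - s)) * (\<integral>\<^sup>+t\<in>{0<..}. ennreal (scale_weight t * poisson s (t * y) (b - x)) \<partial>lborel))"
      using ne y by (intro mult_left_mono *) auto
    also have "\<dots> = ennreal ((1 + s) / c * y powr (DIM('a) - s)) * (\<integral>\<^sup>+t\<in>{0<..}. ennreal (scale_weight t * poisson s (t * y) (b - x)) \<partial>lborel)"
      unfolding mult.assoc[symmetric] using c s_pos by (subst ennreal_mult'[symmetric]) auto
    finally show ?thesis .
  qed
  then show ?thesis using c s_pos by (intro exI[of _ "(1 + s) / c"]) auto
qed

end

section \<open>Potentials and the domination principle\<close>

text \<open>The restriction to \<open>A\<close> in \<open>riesz_potential\<close> is dropped, so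
  that restricted and reweighted measures need no carrier in the notation;
  \<open>riesz_energy_eq\<close> reconciles the two.\<close>

definition potential :: "real \<Rightarrow> 'a::metric_space measure \<Rightarrow> 'a \<Rightarrow> ennreal" where
  "potential s \<mu> x = (\<integral>\<^sup>+y. riesz_kernel s x y \<partial>\<mu>)"

text \<open>The sequential form, as it feeds directly into Fatou's lemma.\<close>

definition lsc :: "('a::metric_space \<Rightarrow> ennreal) \<Rightarrow> bool" where
  "lsc f \<longleftrightarrow> (\<forall>x X. X \<longlonglongrightarrow> x \<longrightarrow> f x \<le> liminf (\<lambda>n. f (X n)))"

lemma lsc_min: "lsc f \<Longrightarrow> lsc g \<Longrightarrow> lsc (\<lambda>x. min (f x) (g x))"
  unfolding lsc_def le_Liminf_iff by (auto intro: eventually_conj)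

lemma liminf_add_ennreal:
  fixes f g :: "nat \<Rightarrow> ennreal"
  shows "liminf f + liminf g \<le> liminf (\<lambda>n. f n + g n)"
proof -
  have "liminf f + liminf g = (SUP n. (INF i\<in>{n..}. f i) + (INF i\<in>{n..}. g i))"
    unfolding liminf_SUP_INF
    by (rule ennreal_SUP_add[symmetric]) (auto simp: incseq_def intro!: INF_superset_mono)
  also have "\<dots> \<le> (SUP n. INF i\<in>{n..}. f i + g i)"
    by (intro SUP_mono') (auto intro!: INF_greatest add_mono INF_lower)
  finally show ?thesis unfolding liminf_SUP_INF .
qed

lemma lsc_add:
  assumes "lsc f" "lsc g"
  shows "lsc (\<lambda>x. f x + g x)"
  unfolding lsc_def
proof (intro allI impI)
  fix x X assume X: "X \<longlonglongrightarrow> (x::'a)"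
  have "f x + g x \<le> liminf (\<lambda>n. f (X n)) + liminf (\<lambda>n. g (X n))"
    using assms X unfolding lsc_def by (intro add_mono) auto
  also have "\<dots> \<le> liminf (\<lambda>n. f (X n) + g (X n))"
    by (rule liminf_add_ennreal)
  finally show "f x + g x \<le> liminf (\<lambda>n. f (X n) + g (X n))" .
qed

lemma lsc_const: "lsc (\<lambda>_. c)"
  unfolding lsc_def by (simp add: Liminf_const)

text \<open>In \<open>ennreal\<close> the inverse of 0 is \<open>\<infinity>\<close>, so the case
  distinction disappears and continuity of the kernel, on the diagonal too, follows from that of
  \<open>inverse\<close>.\<close>

lemma riesz_kernel_conv_inverse:
  "0 < s \<Longrightarrow> riesz_kernel s x y = inverse (ennreal (dist x y powr s))"
  by (auto simp: riesz_kernel_def inverse_ennreal powr_minus)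

lemma tendsto_riesz_kernel:
  assumes "0 < s" "X \<longlonglongrightarrow> x"
  shows "(\<lambda>n. riesz_kernel s (X n) y) \<longlonglongrightarrow> riesz_kernel s x y"
proof -
  have "continuous_on UNIV (inverse :: ennreal \<Rightarrow> ennreal)"
    by (intro continuous_on_inverse_ennreal continuous_on_id)
  moreover have "(\<lambda>n. ennreal (dist (X n) y powr s)) \<longlonglongrightarrow> ennreal (dist x y powr s)"
    using assms by (intro tendsto_ennrealI tendsto_powr' tendsto_dist tendsto_const) auto
  ultimately show ?thesis unfolding riesz_kernel_conv_inverse[OF assms(1)]
    by (rule continuous_on_tendsto_compose) auto
qed

lemma lsc_riesz_kernel: "0 < s \<Longrightarrow> lsc (\<lambda>x. riesz_kernel s x y)"
  unfolding lsc_def by (metis lim_imp_Liminf order_refl tendsto_riesz_kernel trivial_limit_sequentially)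

context riesz
begin

lemma borel_measurable_potential:
  assumes "finite_measure \<mu>" and [measurable_cong]: "sets \<mu> = sets (borel :: 'a measure)"
  shows "potential s \<mu> \<in> borel_measurable borel"
proof -
  interpret finite_measure \<mu> by fact
  show ?thesis unfolding potential_def by measurable
qed

lemma lsc_potential:
  assumes [measurable_cong]: "sets \<mu> = sets (borel :: 'a measure)"
  shows "lsc (potential s \<mu>)"
  unfolding lsc_def
proof (intro allI impI)
  fix x :: 'a and X assume X: "X \<longlonglongrightarrow> x"
  have "potential s \<mu> x = (\<integral>\<^sup>+y. liminf (\<lambda>n. riesz_kernel s (X n) y) \<partial>\<mu>)"
    unfolding potential_def using tendsto_riesz_kernel[OF s_pos X]
    by (intro nn_integral_cong) (metis lim_imp_Liminf trivial_limit_sequentially)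
  also have "\<dots> \<le> liminf (\<lambda>n. potential s \<mu> (X n))"
    unfolding potential_def by (rule nn_integral_liminf) measurable
  finally show "potential s \<mu> x \<le> liminf (\<lambda>n. potential s \<mu> (X n))" .
qed

lemma poisson_mean_potential:
  assumes "finite_measure \<mu>" and [measurable_cong]: "sets \<mu> = sets (borel :: 'a measure)" and "y > 0"
  shows "poisson_mean s y (potential s \<mu>) x = (\<integral>\<^sup>+b. smooth_kernel s y x b \<partial>\<mu>)"
proof -
  interpret finite_measure \<mu> by fact
  interpret pair_sigma_finite "lborel :: 'a measure" \<mu> by unfold_locales
  have "poisson_mean s y (potential s \<mu>) x
      = (\<integral>\<^sup>+z. (\<integral>\<^sup>+b. ennreal (poisson s y z) * riesz_kernel s (x + z) b \<partial>\<mu>) \<partial>lborel)"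
    unfolding poisson_mean_def potential_def by (intro nn_integral_cong nn_integral_cmult[symmetric]) measurable
  also have "\<dots> = (\<integral>\<^sup>+b. (\<integral>\<^sup>+z. ennreal (poisson s y z) * riesz_kernel s (x + z) b \<partial>lborel) \<partial>\<mu>)"
    by (rule Fubini'[symmetric]) measurable
  also have "\<dots> = (\<integral>\<^sup>+b. smooth_kernel s y x b \<partial>\<mu>)"
    using poisson_mean_kernel[OF assms(3)] unfolding poisson_mean_def by simp
  finally show ?thesis .
qed

lemma potential_eq_mean_add_defect:
  assumes "finite_measure \<mu>" and [measurable_cong]: "sets \<mu> = sets (borel :: 'a measure)" and "y > 0"
  shows "potential s \<mu> x = poisson_mean s y (potential s \<mu>) x + (\<integral>\<^sup>+b. kernel_defect y x b \<partial>\<mu>)"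
  unfolding poisson_mean_potential[OF assms] potential_def
  by (subst nn_integral_add[symmetric]) (simp_all add: kernel_defect_add)

section \<open>Excessive functions\<close>

text \<open>The nonlocal counterpart of superharmonicity, with Poisson means in the role of averages
  over balls. Semicontinuity is included so that values at single points can be recovered from the
  means.\<close>

definition excessive :: "('a \<Rightarrow> ennreal) \<Rightarrow> bool" where
  "excessive w \<longleftrightarrow> w \<in> borel_measurable borel \<and> lsc w \<and> (\<forall>y>0. \<forall>x. poisson_mean s y w x \<le> w x)"

lemma excessive_const: "excessive (\<lambda>_. c)"
  unfolding excessive_def by (simp add: lsc_const poisson_mean_const)

lemma excessive_kernel: "excessive (\<lambda>x. riesz_kernel s x b)"
  unfolding excessive_def using lsc_riesz_kernel[OF s_pos] smooth_kernel_le
  by (auto simp: poisson_mean_kernel)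

lemma excessive_add: "excessive u \<Longrightarrow> excessive w \<Longrightarrow> excessive (\<lambda>x. u x + w x)"
  unfolding excessive_def by (auto simp: poisson_mean_add lsc_add intro: add_mono)

lemma excessive_sum: "finite I \<Longrightarrow> (\<And>i. i \<in> I \<Longrightarrow> excessive (u i)) \<Longrightarrow> excessive (\<lambda>x. \<Sum>i\<in>I. u i x)"
  by (induction I rule: finite_induct) (auto simp: excessive_const excessive_add)

text \<open>Fatou's lemma after rescaling: for fixed \<open>z\<close> the arguments
  \<open>x + Y n *\<^sub>R z\<close> tend to \<open>x\<close>, and the weight \<open>P_1\<close> has
  mass 1.\<close>

lemma poisson_mean_liminf:
  assumes [measurable]: "u \<in> borel_measurable borel" and "lsc u"
    and Y: "\<And>n. Y n > 0" "Y \<longlonglongrightarrow> 0"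
  shows "u x \<le> liminf (\<lambda>n. poisson_mean s (Y n) u (x::'a))"
proof -
  have "u x = (\<integral>\<^sup>+z. ennreal (poisson s 1 (z::'a)) * u x \<partial>lborel)"
    by (subst nn_integral_multc) (auto simp: nn_integral_poisson)
  also have "\<dots> \<le> (\<integral>\<^sup>+z. liminf (\<lambda>n. ennreal (poisson s 1 z) * u (x + Y n *\<^sub>R z)) \<partial>lborel)"
  proof (rule nn_integral_mono)
    fix z :: 'a
    have "(\<lambda>n. x + Y n *\<^sub>R z) \<longlonglongrightarrow> x + 0 *\<^sub>R z" using Y by (intro tendsto_intros)
    then have *: "u x \<le> liminf (\<lambda>n. u (x + Y n *\<^sub>R z))"
      using \<open>lsc u\<close> unfolding lsc_def by simp
    show "ennreal (poisson s 1 z) * u x \<le> liminf (\<lambda>n. ennreal (poisson s 1 z) * u (x + Y n *\<^sub>R z))"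
      unfolding le_Liminf_iff
    proof (intro allI impI)
      fix r assume r: "r < ennreal (poisson s 1 z) * u x"
      have P: "0 < ennreal (poisson s 1 z)" "ennreal (poisson s 1 z) < \<infinity>" using poisson_pos[of 1 z] by auto
      then have "r / ennreal (poisson s 1 z) < u x"
        using r by (simp add: divide_less_ennreal mult.commute)
      then have "eventually (\<lambda>n. r / ennreal (poisson s 1 z) < u (x + Y n *\<^sub>R z)) sequentially"
        using * unfolding le_Liminf_iff by blast
      then show "eventually (\<lambda>n. r < ennreal (poisson s 1 z) * u (x + Y n *\<^sub>R z)) sequentially"
        by eventually_elim (use P in \<open>simp add: divide_less_ennreal mult.commute\<close>)
    qed
  qed
  also have "\<dots> \<le> liminf (\<lambda>n. \<integral>\<^sup>+z. ennreal (poisson s 1 z) * u (x + Y n *\<^sub>R z) \<partial>lborel)"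
    by (rule nn_integral_liminf) measurable
  also have "\<dots> = liminf (\<lambda>n. poisson_mean s (Y n) u x)"
    using Y by (simp add: poisson_mean_scale)
  finally show ?thesis .
qed

section \<open>Boundedness and decay of potentials\<close>

text \<open>A weak maximum principle, available before the domination principle. The set
  \<open>F\<close> where the bound holds carries the measure. On the closure of \<open>F\<close>
  semicontinuity suffices; for another \<open>x\<close>, a point \<open>x'\<close> of
  \<open>F\<close> within twice the distance from \<open>x\<close> to \<open>F\<close> satisfies
  \<open>|x' - y| \<le> 3 |x - y|\<close> for all \<open>y\<close> in \<open>F\<close>, which
  compares the kernels.\<close>

lemma potential_le_three_powr:
  assumes "finite_measure \<mu>" and [measurable_cong]: "sets \<mu> = sets (borel :: 'a measure)"
    and K: "AE x in \<mu>. potential s \<mu> x \<le> ennreal K" "K \<ge> 0"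
  shows "potential s \<mu> x \<le> ennreal (3 powr s * K)"
proof -
  have [measurable]: "potential s \<mu> \<in> borel_measurable borel" by (rule borel_measurable_potential) fact+
  define F where "F = {x. potential s \<mu> x \<le> ennreal K}"
  have 3: "1 \<le> (3::real) powr s" using s_pos by (simp add: ge_one_powr_ge_zero)
  show ?thesis
  proof (cases "F = {}")
    case True
    then have "AE x in \<mu>. False" using K by (simp add: F_def)
    then have "potential s \<mu> x = (\<integral>\<^sup>+y. 0 \<partial>\<mu>)" unfolding potential_def by (intro nn_integral_cong_AE) auto
    then show ?thesis by simp
  next
    case F: False
    show ?thesis
    proof (cases "x \<in> closure F")
      case True
      then obtain X where X: "\<And>n. X n \<in> F" "X \<longlonglongrightarrow> x" unfolding closure_sequential by auto
      have "potential s \<mu> x \<le> liminf (\<lambda>n. potential s \<mu> (X n))"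
        using lsc_potential[OF assms(2)] X unfolding lsc_def by auto
      also have "\<dots> \<le> ennreal K" using X by (intro Liminf_le) (auto simp: F_def)
      also have "\<dots> \<le> ennreal (3 powr s * K)" using 3 K by (intro ennreal_leI) (simp add: mult_le_cancel_right1)
      finally show ?thesis .
    next
      case False
      define \<delta> where "\<delta> = infdist x F"
      have \<delta>: "\<delta> > 0" using False F unfolding \<delta>_def by (simp add: in_closure_iff_infdist_zero less_le infdist_nonneg)
      then have "infdist x F < 2 * \<delta>" by (simp add: \<delta>_def)
      then obtain x' where x': "x' \<in> F" "dist x x' < 2 * \<delta>"
      proof -
        have "\<exists>x'\<in>F. dist x x' < 2 * \<delta>"
        proof (rule ccontr)
          assume "\<not> ?thesis"
          then have "2 * \<delta> \<le> infdist x F"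
            using F unfolding infdist_notempty[OF F] by (intro cINF_greatest) (auto simp: not_less)
          then show False using \<open>infdist x F < 2 * \<delta>\<close> by simp
        qed
        then show thesis using that by blast
      qed
      have le: "riesz_kernel s x y \<le> ennreal (3 powr s) * riesz_kernel s x' y" if "y \<in> F" for y
      proof (cases "x' = y")
        case False
        have "\<delta> \<le> dist x y" unfolding \<delta>_def using that by (rule infdist_le)
        then have "dist x' y \<le> 3 * dist x y" "x \<noteq> y"
          using x'(2) dist_triangle[of x' y x] \<delta> by (auto simp: dist_commute)
        then have "(3 * dist x y) powr (- s) \<le> dist x' y powr (- s)"
          using False s_pos by (intro powr_mono2') auto
        then have "3 powr s * (3 powr (- s) * dist x y powr (- s)) \<le> 3 powr s * dist x' y powr (- s)"
          by (intro mult_left_mono) (auto simp: powr_mult)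
        moreover have "3 powr s * (3 powr (- s) * dist x y powr (- s)) = dist x y powr (- s)"
          by (simp add: powr_minus)
        ultimately show ?thesis using False \<open>x \<noteq> y\<close>
          unfolding riesz_kernel_def by (simp add: ennreal_mult'[symmetric] ennreal_leI)
      qed (simp add: riesz_kernel_def ennreal_mult_top)
      have "potential s \<mu> x \<le> (\<integral>\<^sup>+y. ennreal (3 powr s) * riesz_kernel s x' y \<partial>\<mu>)"
        unfolding potential_def using K(1) by (intro nn_integral_mono_AE) (auto simp: F_def intro: le[unfolded F_def])
      also have "\<dots> = ennreal (3 powr s) * potential s \<mu> x'"
        unfolding potential_def by (rule nn_integral_cmult) measurable
      also have "\<dots> \<le> ennreal (3 powr s) * ennreal K" using x' by (intro mult_left_mono) (auto simp: F_def)
      also have "\<dots> = ennreal (3 powr s * K)" by (simp add: ennreal_mult')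
      finally show ?thesis .
    qed
  qed
qed

text \<open>Far from \<open>S\<close> the kernel is uniformly small on \<open>S\<close>. Combined
  with a positive lower bound for \<open>w\<close>, this confines the set where the potential
  exceeds \<open>w\<close> to a ball.\<close>

lemma potential_vanishes:
  assumes "finite_measure \<mu>" and [measurable_cong]: "sets \<mu> = sets (borel :: 'a measure)"
    and "bounded S" "AE x in \<mu>. x \<in> S" and c: "c > 0"
  shows "\<exists>R. \<forall>x. norm x > R \<longrightarrow> potential s \<mu> x < ennreal c"
proof -
  interpret finite_measure \<mu> by fact
  \<comment> \<open>The summand 1 keeps \<open>M\<close> positive for the null measure and the final
    inequality strict; \<open>\<rho>\<close> below solves
    \<open>M * \<rho> powr (- s) = c\<close>.\<close>
  define M where "M = measure \<mu> (space \<mu>) + 1"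
  have M: "M > 0" by (simp add: M_def add_nonneg_pos)
  obtain R where R: "\<And>x. x \<in> S \<Longrightarrow> norm x \<le> R" using assms(3) unfolding bounded_iff by auto
  define \<rho> where "\<rho> = (M / c) powr (1 / s)"
  have \<rho>: "\<rho> > 0" "\<rho> powr (- s) = c / M"
    using M c s_pos by (auto simp: \<rho>_def powr_powr powr_minus)
  have "potential s \<mu> x < ennreal c" if x: "norm x > R + \<rho>" for x
  proof -
    have "riesz_kernel s x y \<le> ennreal (c / M)" if "y \<in> S" for y
    proof -
      have "\<rho> \<le> dist x y" using R[OF that] x norm_triangle_ineq2[of x y] by (simp add: dist_norm)
      then have "dist x y powr (- s) \<le> \<rho> powr (- s)" "x \<noteq> y" using \<rho>(1) s_pos by (auto intro!: powr_mono2')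
      then show ?thesis unfolding riesz_kernel_def \<rho>(2) by (auto intro: ennreal_leI)
    qed
    then have "potential s \<mu> x \<le> (\<integral>\<^sup>+y. ennreal (c / M) \<partial>\<mu>)"
      unfolding potential_def using assms(4) by (intro nn_integral_mono_AE) auto
    also have "\<dots> = ennreal (c / M * measure \<mu> (space \<mu>))"
      using c M by (simp add: emeasure_eq_measure ennreal_mult'[symmetric])
    also have "\<dots> < ennreal c"
      using c M by (intro ennreal_lessI) (auto simp: M_def field_simps)
    finally show ?thesis .
  qed
  then show ?thesis by blast
qed

section \<open>The nonlocal Dirichlet energy\<close>

text \<open>For nonnegative square integrable \<open>f\<close> this is twice the inner product of
  \<open>f\<close> with \<open>f - P_y * f\<close>.\<close>

definition jump_energy :: "real \<Rightarrow> ('a \<Rightarrow> real) \<Rightarrow> ennreal" where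
  "jump_energy y f = (\<integral>\<^sup>+x. (\<integral>\<^sup>+z. ennreal (poisson s y z) * ennreal ((f x - f (x + z))\<^sup>2) \<partial>lborel) \<partial>lborel)"

text \<open>Expand the square: unit mass of \<open>P_y\<close> and translation invariance of
  Lebesgue measure turn each of the two square terms into the integral of \<open>f^2\<close>. The
  cross term is kept on the left, as \<open>ennreal\<close> has no negative values.\<close>

lemma jump_energy_add:
  assumes [measurable]: "f \<in> borel_measurable borel" and f: "\<And>x. 0 \<le> f x" and y: "y > 0"
  shows "jump_energy y f + 2 * (\<integral>\<^sup>+x. ennreal (f x) * poisson_mean s y (\<lambda>x. ennreal (f x)) x \<partial>lborel)
       = 2 * (\<integral>\<^sup>+x. ennreal ((f x)\<^sup>2) \<partial>lborel)"
proof -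
  have Q: "2 * (\<integral>\<^sup>+x. ennreal (f x) * poisson_mean s y (\<lambda>x. ennreal (f x)) x \<partial>lborel)
      = (\<integral>\<^sup>+x. (\<integral>\<^sup>+z. ennreal (poisson s y z) * ennreal (2 * f x * f (x + z)) \<partial>lborel) \<partial>lborel)"
  proof -
    have "2 * (ennreal (f x) * poisson_mean s y (\<lambda>x. ennreal (f x)) x)
       = (\<integral>\<^sup>+z. ennreal (poisson s y z) * ennreal (2 * f x * f (x + z)) \<partial>lborel)" for x
    proof -
      have "2 * (ennreal (f x) * poisson_mean s y (\<lambda>x. ennreal (f x)) x)
        = (\<integral>\<^sup>+z. ennreal (2 * f x) * (ennreal (poisson s y z) * ennreal (f (x + z))) \<partial>lborel)"
        unfolding poisson_mean_def using f by (subst nn_integral_cmult) (auto simp: ennreal_mult' mult.assoc)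
      also have "\<dots> = (\<integral>\<^sup>+z. ennreal (poisson s y z) * ennreal (2 * f x * f (x + z)) \<partial>lborel)"
        using f by (intro nn_integral_cong) (simp add: ennreal_mult'[symmetric] mult_ac)
      finally show ?thesis .
    qed
    then show ?thesis by (subst nn_integral_cmult[symmetric]) auto
  qed
  have "jump_energy y f + 2 * (\<integral>\<^sup>+x. ennreal (f x) * poisson_mean s y (\<lambda>x. ennreal (f x)) x \<partial>lborel)
      = (\<integral>\<^sup>+x. (\<integral>\<^sup>+z. ennreal (poisson s y z) * ennreal ((f x - f (x + z))\<^sup>2) \<partial>lborel)
          + (\<integral>\<^sup>+z. ennreal (poisson s y z) * ennreal (2 * f x * f (x + z)) \<partial>lborel) \<partial>lborel)"
    unfolding Q jump_energy_def by (rule nn_integral_add[symmetric]) measurable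
  also have "\<dots> = (\<integral>\<^sup>+x. ennreal ((f x)\<^sup>2) + (\<integral>\<^sup>+z. ennreal (poisson s y z) * ennreal ((f (x + z))\<^sup>2) \<partial>lborel) \<partial>lborel)"
  proof (rule nn_integral_cong)
    fix x
    have "(\<integral>\<^sup>+z. ennreal (poisson s y z) * ennreal ((f x - f (x + z))\<^sup>2) \<partial>lborel)
          + (\<integral>\<^sup>+z. ennreal (poisson s y z) * ennreal (2 * f x * f (x + z)) \<partial>lborel)
       = (\<integral>\<^sup>+z. ennreal (poisson s y z) * ennreal ((f x - f (x + z))\<^sup>2)
          + ennreal (poisson s y z) * ennreal (2 * f x * f (x + z)) \<partial>lborel)"
      by (rule nn_integral_add[symmetric]) measurable
    also have "\<dots> = (\<integral>\<^sup>+z. ennreal (poisson s y z) * ennreal ((f x)\<^sup>2) + ennreal (poisson s y z) * ennreal ((f (x + z))\<^sup>2) \<partial>lborel)"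
    proof (rule nn_integral_cong)
      fix z
      have "ennreal ((f x - f (x + z))\<^sup>2) + ennreal (2 * f x * f (x + z)) = ennreal ((f x)\<^sup>2) + ennreal ((f (x + z))\<^sup>2)"
      proof -
        have "(f x - f (x + z))\<^sup>2 + 2 * f x * f (x + z) = (f x)\<^sup>2 + (f (x + z))\<^sup>2"
          by (simp add: power2_diff)
        moreover have "0 \<le> 2 * f x * f (x + z)" using f by simp
        ultimately show ?thesis by (metis ennreal_plus zero_le_power2)
      qed
      then show "ennreal (poisson s y z) * ennreal ((f x - f (x + z))\<^sup>2)
          + ennreal (poisson s y z) * ennreal (2 * f x * f (x + z))
         = ennreal (poisson s y z) * ennreal ((f x)\<^sup>2) + ennreal (poisson s y z) * ennreal ((f (x + z))\<^sup>2)"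
        by (simp only: distrib_left[symmetric])
    qed
    also have "\<dots> = (\<integral>\<^sup>+z. ennreal (poisson s y z) * ennreal ((f x)\<^sup>2) \<partial>(lborel :: 'a measure)) + (\<integral>\<^sup>+z. ennreal (poisson s y z) * ennreal ((f (x + z))\<^sup>2) \<partial>lborel)"
      by (rule nn_integral_add) measurable
    also have "(\<integral>\<^sup>+z. ennreal (poisson s y z) * ennreal ((f x)\<^sup>2) \<partial>(lborel :: 'a measure)) = ennreal ((f x)\<^sup>2)"
      using y by (subst nn_integral_multc) (auto simp: nn_integral_poisson)
    finally show "(\<integral>\<^sup>+z. ennreal (poisson s y z) * ennreal ((f x - f (x + z))\<^sup>2) \<partial>lborel)
          + (\<integral>\<^sup>+z. ennreal (poisson s y z) * ennreal (2 * f x * f (x + z)) \<partial>lborel)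
        = ennreal ((f x)\<^sup>2) + (\<integral>\<^sup>+z. ennreal (poisson s y z) * ennreal ((f (x + z))\<^sup>2) \<partial>lborel)" .
  qed
  also have "\<dots> = (\<integral>\<^sup>+x. ennreal ((f x)\<^sup>2) \<partial>lborel) + (\<integral>\<^sup>+x. (\<integral>\<^sup>+z. ennreal (poisson s y z) * ennreal ((f (x + z))\<^sup>2) \<partial>lborel) \<partial>lborel)"
    by (rule nn_integral_add) measurable
  also have "(\<integral>\<^sup>+x. (\<integral>\<^sup>+z. ennreal (poisson s y z) * ennreal ((f (x + z))\<^sup>2) \<partial>lborel) \<partial>lborel)
      = (\<integral>\<^sup>+z. (\<integral>\<^sup>+x. ennreal (poisson s y z) * ennreal ((f (x + z))\<^sup>2) \<partial>lborel) \<partial>lborel)"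
    by (rule lborel_pair.Fubini'[symmetric]) measurable
  also have "\<dots> = (\<integral>\<^sup>+z. ennreal (poisson s y (z::'a)) * (\<integral>\<^sup>+x. ennreal ((f x)\<^sup>2) \<partial>lborel) \<partial>lborel)"
  proof (rule nn_integral_cong)
    fix z :: 'a
    have "(\<integral>\<^sup>+x. ennreal (poisson s y z) * ennreal ((f (x + z))\<^sup>2) \<partial>lborel)
        = ennreal (poisson s y z) * (\<integral>\<^sup>+x. ennreal ((f (z + x))\<^sup>2) \<partial>lborel)"
      by (subst nn_integral_cmult) (auto simp: add.commute)
    also have "(\<integral>\<^sup>+x. ennreal ((f (z + x))\<^sup>2) \<partial>lborel) = (\<integral>\<^sup>+x. ennreal ((f x)\<^sup>2) \<partial>lborel)"
      by (rule nn_integral_lborel_translate) measurable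
    finally show "(\<integral>\<^sup>+x. ennreal (poisson s y z) * ennreal ((f (x + z))\<^sup>2) \<partial>lborel)
        = ennreal (poisson s y z) * (\<integral>\<^sup>+x. ennreal ((f x)\<^sup>2) \<partial>lborel)" .
  qed
  also have "\<dots> = (\<integral>\<^sup>+x. ennreal ((f x)\<^sup>2) \<partial>lborel)"
    using y by (subst nn_integral_multc) (auto simp: nn_integral_poisson)
  finally show ?thesis by (simp add: mult_2)
qed

lemma jump_energy_scale_le:
  assumes [measurable]: "f \<in> borel_measurable borel" and "0 < y" "y \<le> 1"
  shows "ennreal (y powr (DIM('a) - s)) * jump_energy 1 f \<le> jump_energy y f"
proof -
  have "ennreal (y powr (DIM('a) - s)) * jump_energy 1 f
     = (\<integral>\<^sup>+x. (\<integral>\<^sup>+z. ennreal (y powr (DIM('a) - s)) * (ennreal (poisson s 1 z) * ennreal ((f x - f (x + z))\<^sup>2)) \<partial>lborel) \<partial>lborel)"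
    unfolding jump_energy_def by (simp add: nn_integral_cmult)
  also have "\<dots> \<le> jump_energy y f"
    unfolding jump_energy_def mult.assoc[symmetric] using poisson_ge[OF assms(2,3)]
    by (intro nn_integral_mono mult_right_mono) (auto simp: ennreal_mult'[symmetric] intro!: ennreal_leI)
  finally show ?thesis .
qed

text \<open>As \<open>P_1\<close> is positive, zero energy makes \<open>f\<close> almost everywhere
  equal to \<open>f x\<close>, for almost every \<open>x\<close>. If \<open>f x\<close> were
  nonzero, almost all of the space would lie in a ball, whose Lebesgue measure is finite.\<close>

lemma jump_energy_eq_0_imp:
  assumes [measurable]: "f \<in> borel_measurable borel" and "jump_energy 1 f = 0"
    and R: "\<And>x. norm x > R \<Longrightarrow> f x = 0"
  shows "AE x in lborel. f x = 0"
proof -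
  have "AE x in lborel. (\<integral>\<^sup>+z. ennreal (poisson s 1 z) * ennreal ((f x - f (x + z))\<^sup>2) \<partial>lborel) = 0"
    using assms(2) unfolding jump_energy_def by (subst (asm) nn_integral_0_iff_AE) auto
  then show ?thesis
  proof eventually_elim
    case (elim x)
    then have "AE z in lborel. ennreal (poisson s 1 z) * ennreal ((f x - f (x + z))\<^sup>2) = 0"
      by (subst (asm) nn_integral_0_iff_AE) auto
    then have ae: "AE z in lborel. f x = f (x + z)"
    proof eventually_elim
      case (elim z)
      then show ?case using poisson_pos[of 1 z] by (auto simp: ennreal_eq_0_iff)
    qed
    show "f x = 0"
    proof (rule ccontr)
      assume "f x \<noteq> 0"
      from ae have "AE z in lborel. z \<in> cball (- x) R"
      proof eventually_elim
        case (elim z)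
        then have "\<not> R < norm (x + z)" using R[of "x + z"] \<open>f x \<noteq> 0\<close> by auto
        moreover have "dist (- x) z = norm (x + z)"
          unfolding dist_norm by (metis add.commute minus_add_distrib norm_minus_cancel uminus_add_conv_diff minus_diff_eq diff_minus_eq_add)
        ultimately show ?case by simp
      qed
      then have "emeasure lborel (UNIV :: 'a set) = emeasure lborel (cball (- x) R)"
        by (intro emeasure_eq_AE) auto
      moreover have "emeasure lborel (cball (- x) R) < \<infinity>" by (rule emeasure_bounded_finite) simp
      ultimately show False by (simp add: emeasure_lborel_UNIV)
    qed
  qed
qed

text \<open>Tonelli and the mixture bound replace the integral of \<open>v\<close> against the
  defect by Poisson means of \<open>v\<close> integrated against \<open>\<mu>\<close>. These tend to
  0 with \<open>y\<close> in the application, where \<open>v\<close> vanishes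
  \<open>\<mu>\<close>-almost everywhere.\<close>

lemma nn_integral_defect_le:
  "\<exists>C>0. \<forall>y>0. \<forall>v \<mu>. v \<in> borel_measurable borel \<longrightarrow> finite_measure \<mu> \<longrightarrow> sets \<mu> = sets (borel :: 'a measure) \<longrightarrow>
     (\<integral>\<^sup>+x. v x * (\<integral>\<^sup>+b. kernel_defect y x b \<partial>\<mu>) \<partial>lborel)
     \<le> ennreal (C * y powr (DIM('a) - s)) *
        (\<integral>\<^sup>+t\<in>{0<..}. ennreal (scale_weight t) * (\<integral>\<^sup>+b. poisson_mean s (t * y) v b \<partial>\<mu>) \<partial>lborel)"
proof -
  obtain C where C: "C > 0" and defect: "\<And>y x b. y > 0 \<Longrightarrow> x \<noteq> b \<Longrightarrow> kernel_defect y x b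
     \<le> ennreal (C * y powr (DIM('a) - s)) * (\<integral>\<^sup>+t\<in>{0<..}. ennreal (scale_weight t * poisson s (t * y) (b - x)) \<partial>lborel)"
    using kernel_defect_le_mixture by blast
  have "(\<integral>\<^sup>+x. v x * (\<integral>\<^sup>+b. kernel_defect y x b \<partial>\<mu>) \<partial>lborel)
     \<le> ennreal (C * y powr (DIM('a) - s)) *
        (\<integral>\<^sup>+t\<in>{0<..}. ennreal (scale_weight t) * (\<integral>\<^sup>+b. poisson_mean s (t * y) v b \<partial>\<mu>) \<partial>lborel)"
    if y: "y > 0" and [measurable]: "v \<in> borel_measurable borel" and "finite_measure \<mu>"
      and [measurable_cong]: "sets \<mu> = sets (borel :: 'a measure)" for y v \<mu>
  proof -
    interpret finite_measure \<mu> by fact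
    interpret P: pair_sigma_finite "lborel :: 'a measure" \<mu> by unfold_locales
    interpret P': pair_sigma_finite "lborel :: real measure" \<mu> by unfold_locales
    define K where "K = ennreal (C * y powr (DIM('a) - s))"
    have "(\<integral>\<^sup>+x. v x * (\<integral>\<^sup>+b. kernel_defect y x b \<partial>\<mu>) \<partial>lborel) = (\<integral>\<^sup>+x. (\<integral>\<^sup>+b. v x * kernel_defect y x b \<partial>\<mu>) \<partial>lborel)"
      by (intro nn_integral_cong nn_integral_cmult[symmetric]) measurable
    also have "\<dots> = (\<integral>\<^sup>+b. (\<integral>\<^sup>+x. v x * kernel_defect y x b \<partial>lborel) \<partial>\<mu>)"
      by (rule P.Fubini'[symmetric]) measurable
    also have "\<dots> \<le> (\<integral>\<^sup>+b. (\<integral>\<^sup>+t\<in>{0<..}. K * (ennreal (scale_weight t) * poisson_mean s (t * y) v b) \<partial>lborel) \<partial>\<mu>)"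
    proof (rule nn_integral_mono)
      fix b :: 'a
      have "(\<integral>\<^sup>+x. v x * kernel_defect y x b \<partial>lborel)
        \<le> (\<integral>\<^sup>+x. (\<integral>\<^sup>+t\<in>{0<..}. K * v x * ennreal (scale_weight t * poisson s (t * y) (b - x)) \<partial>lborel) \<partial>lborel)"
      proof (rule nn_integral_mono_AE)
        show "AE x in lborel. v x * kernel_defect y x b
           \<le> (\<integral>\<^sup>+t\<in>{0<..}. K * v x * ennreal (scale_weight t * poisson s (t * y) (b - x)) \<partial>lborel)"
          using AE_lborel_singleton[of b]
        proof eventually_elim
          case (elim x)
          have "v x * kernel_defect y x b \<le> v x * (K * (\<integral>\<^sup>+t\<in>{0<..}. ennreal (scale_weight t * poisson s (t * y) (b - x)) \<partial>lborel))"
            unfolding K_def using elim y by (intro mult_left_mono defect) auto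
          also have "\<dots> = (K * v x) * (\<integral>\<^sup>+t\<in>{0<..}. ennreal (scale_weight t * poisson s (t * y) (b - x)) \<partial>lborel)"
            by (simp add: mult_ac)
          also have "\<dots> = (\<integral>\<^sup>+t. K * v x * (ennreal (scale_weight t * poisson s (t * y) (b - x)) * indicator {0<..} t) \<partial>lborel)"
            by (rule nn_integral_cmult[symmetric]) measurable
          finally show ?case by (simp add: mult.assoc)
        qed
      qed
      also have "\<dots> = (\<integral>\<^sup>+t\<in>{0<..}. (\<integral>\<^sup>+x. K * v x * ennreal (scale_weight t * poisson s (t * y) (b - x)) \<partial>lborel) \<partial>lborel)"
        by (rule nn_integral_lborel_swap) measurable
      also have "\<dots> = (\<integral>\<^sup>+t\<in>{0<..}. K * (ennreal (scale_weight t) * poisson_mean s (t * y) v b) \<partial>lborel)"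
      proof (rule nn_integral_halfline_cong)
        fix t :: real assume t: "t > 0"
        \<comment> \<open>Translation by \<open>b\<close> and evenness of the Poisson kernel produce
          the Poisson mean at \<open>b\<close>.\<close>
        have "(\<integral>\<^sup>+x. K * v x * ennreal (scale_weight t * poisson s (t * y) (b - x)) \<partial>lborel)
            = (\<integral>\<^sup>+x. K * v (b + x) * ennreal (scale_weight t * poisson s (t * y) (b - (b + x))) \<partial>lborel)"
          by (rule nn_integral_lborel_translate[symmetric]) measurable
        also have "\<dots> = (\<integral>\<^sup>+x. (K * ennreal (scale_weight t)) * (ennreal (poisson s (t * y) x) * v (b + x)) \<partial>lborel)"
          proof (rule nn_integral_cong)
          fix x :: 'a
          have "poisson s (t * y) (b - (b + x)) = poisson s (t * y) x" by (simp add: poisson_def)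
          then show "K * v (b + x) * ennreal (scale_weight t * poisson s (t * y) (b - (b + x)))
              = (K * ennreal (scale_weight t)) * (ennreal (poisson s (t * y) x) * v (b + x))"
            by (simp add: ennreal_mult' scale_weight_nonneg mult_ac)
        qed
        also have "\<dots> = K * (ennreal (scale_weight t) * poisson_mean s (t * y) v b)"
          unfolding poisson_mean_def by (subst nn_integral_cmult) (auto simp: mult.assoc)
        finally show "(\<integral>\<^sup>+x. K * v x * ennreal (scale_weight t * poisson s (t * y) (b - x)) \<partial>lborel)
          = K * (ennreal (scale_weight t) * poisson_mean s (t * y) v b)" .
      qed
      finally show "(\<integral>\<^sup>+x. v x * kernel_defect y x b \<partial>lborel) \<le> (\<integral>\<^sup>+t\<in>{0<..}. K * (ennreal (scale_weight t) * poisson_mean s (t * y) v b) \<partial>lborel)" .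
    qed
    also have "\<dots> = (\<integral>\<^sup>+t. (\<integral>\<^sup>+b. K * (ennreal (scale_weight t) * poisson_mean s (t * y) v b) * indicator {0<..} t \<partial>\<mu>) \<partial>lborel)"
      by (rule P'.Fubini') measurable
    also have "\<dots> = (\<integral>\<^sup>+t. K * ((ennreal (scale_weight t) * (\<integral>\<^sup>+b. poisson_mean s (t * y) v b \<partial>\<mu>)) * indicator {0<..} t) \<partial>lborel)"
    proof (rule nn_integral_cong)
      fix t
      have "(\<integral>\<^sup>+b. K * (ennreal (scale_weight t) * poisson_mean s (t * y) v b) * indicator {0<..} t \<partial>\<mu>)
        = (\<integral>\<^sup>+b. (K * ennreal (scale_weight t) * indicator {0<..} t) * poisson_mean s (t * y) v b \<partial>\<mu>)"
        by (simp add: mult_ac)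
      also have "\<dots> = (K * ennreal (scale_weight t) * indicator {0<..} t) * (\<integral>\<^sup>+b. poisson_mean s (t * y) v b \<partial>\<mu>)"
        by (rule nn_integral_cmult) measurable
      finally show "(\<integral>\<^sup>+b. K * (ennreal (scale_weight t) * poisson_mean s (t * y) v b) * indicator {0<..} t \<partial>\<mu>)
         = K * ((ennreal (scale_weight t) * (\<integral>\<^sup>+b. poisson_mean s (t * y) v b \<partial>\<mu>)) * indicator {0<..} t)"
        by (simp add: mult_ac)
    qed
    also have "\<dots> = K * (\<integral>\<^sup>+t\<in>{0<..}. ennreal (scale_weight t) * (\<integral>\<^sup>+b. poisson_mean s (t * y) v b \<partial>\<mu>) \<partial>lborel)"
      by (rule nn_integral_cmult) measurable
    finally show ?thesis unfolding K_def .
  qed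
  then show ?thesis using C by blast
qed

lemma poisson_mean_excess_le:
  assumes "excessive h" and [measurable]: "u \<in> borel_measurable borel" "v \<in> borel_measurable borel"
    and "\<And>x. h x = v x + u x" "y > 0"
  shows "poisson_mean s y v x + poisson_mean s y u x \<le> h x"
proof -
  have "poisson_mean s y v x + poisson_mean s y u x = poisson_mean s y h x"
    using assms(4) by (subst poisson_mean_add[symmetric]) (auto simp flip: assms(4))
  then show ?thesis using assms(1,5) unfolding excessive_def by auto
qed

text \<open>In the application \<open>v\<close> is a difference of semicontinuous functions, so no
  direct limit is at hand. Instead, the means of \<open>v\<close> and \<open>u\<close> together stay
  below \<open>h\<close>, while Fatou's lemma forces the integrals of the means of \<open>u\<close>
  up to the integral of \<open>u\<close>, which equals that of \<open>h\<close>. This leaves no room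
  for \<open>v\<close>.\<close>

lemma nn_integral_poisson_mean_tendsto_0:
  assumes "finite_measure \<mu>" and [measurable_cong]: "sets \<mu> = sets (borel :: 'a measure)"
    and "excessive h" and fin: "(\<integral>\<^sup>+x. h x \<partial>\<mu>) < \<infinity>"
    and [measurable]: "u \<in> borel_measurable borel" "v \<in> borel_measurable borel" and "lsc u"
    and eq: "\<And>x. h x = v x + u x" and v0: "AE x in \<mu>. v x = 0"
    and Y: "\<And>n. Y n > 0" "Y \<longlonglongrightarrow> 0"
  shows "(\<lambda>n. \<integral>\<^sup>+x. poisson_mean s (Y n) v x \<partial>\<mu>) \<longlonglongrightarrow> 0"
proof -
  interpret finite_measure \<mu> by fact
  define H where "H = (\<integral>\<^sup>+x. h x \<partial>\<mu>)"
  define P where "P n = (\<integral>\<^sup>+x. poisson_mean s (Y n) u x \<partial>\<mu>)" for n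
  have sum: "(\<integral>\<^sup>+x. poisson_mean s (Y n) v x \<partial>\<mu>) + P n \<le> H" for n
  proof -
    have "(\<integral>\<^sup>+x. poisson_mean s (Y n) v x \<partial>\<mu>) + P n = (\<integral>\<^sup>+x. poisson_mean s (Y n) v x + poisson_mean s (Y n) u x \<partial>\<mu>)"
      unfolding P_def by (rule nn_integral_add[symmetric]) measurable
    also have "\<dots> \<le> H" unfolding H_def using Y
      by (intro nn_integral_mono poisson_mean_excess_le assms(3) eq) auto
    finally show ?thesis .
  qed
  have PH: "P n \<le> H" for n using sum[of n] by (metis add.commute le_iff_add order_trans)
  have "H = (\<integral>\<^sup>+x. u x \<partial>\<mu>)"
    unfolding H_def using v0 by (intro nn_integral_cong_AE) (auto simp: eq elim: eventually_mono)
  also have "\<dots> \<le> (\<integral>\<^sup>+x. liminf (\<lambda>n. poisson_mean s (Y n) u x) \<partial>\<mu>)"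
    by (intro nn_integral_mono poisson_mean_liminf assms)
  also have "\<dots> \<le> liminf P"
    unfolding P_def by (rule nn_integral_liminf) measurable
  finally have "H \<le> liminf P" .
  then have "P \<longlonglongrightarrow> H"
    unfolding le_Liminf_iff using PH by (intro order_tendstoI) (auto intro!: always_eventually intro: le_less_trans)
  then have "(\<lambda>n. H - P n) \<longlonglongrightarrow> H - H"
    using fin by (intro tendsto_diff_ennreal tendsto_const) (auto simp: H_def)
  then have lim: "(\<lambda>n. H - P n) \<longlonglongrightarrow> 0" using fin by (simp add: H_def)
  have le: "(\<integral>\<^sup>+x. poisson_mean s (Y n) v x \<partial>\<mu>) \<le> H - P n" for n
  proof -
    have "P n \<noteq> \<infinity>" using PH[of n] fin by (auto simp: H_def top_unique)
    then show ?thesis using sum[of n] PH[of n] by (simp add: ennreal_le_minus_iff add.commute)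
  qed
  show ?thesis
  proof (rule tendsto_sandwich[OF _ _ tendsto_const lim])
    show "\<forall>\<^sub>F n in sequentially. (\<integral>\<^sup>+x. poisson_mean s (Y n) v x \<partial>\<mu>) \<le> H - P n"
      using le by (intro always_eventually allI)
  qed simp
qed

text \<open>The domination principle. With \<open>v = (U - w)\<^sup>+\<close>, the truncated difference of the potential and
  the excessive function, \<open>v \<le> P\<^sub>y v + (k - P\<^sub>y k) * \<mu>\<close> holds everywhere; testing this against \<open>v\<close> bounds
  the nonlocal Dirichlet energy of \<open>v\<close> by \<open>\<integral> v d\<mu> = 0\<close>, up to an error that vanishes as
  \<open>y\<close> tends to 0.\<close>

theorem domination_principle:
  assumes "finite_measure \<mu>" and sets [measurable_cong]: "sets \<mu> = sets (borel :: 'a measure)"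
    and "bounded S" "AE x in \<mu>. x \<in> S"
    and K: "AE x in \<mu>. potential s \<mu> x \<le> ennreal K"
    and w: "excessive w" and c: "0 < c" "\<And>x. ennreal c \<le> w x"
    and le: "AE x in \<mu>. potential s \<mu> x \<le> w x"
  shows "potential s \<mu> x \<le> w x"
proof -
  interpret finite_measure \<mu> by fact
  define h where "h = potential s \<mu>"
  have h_meas [measurable]: "h \<in> borel_measurable borel" unfolding h_def by (rule borel_measurable_potential) fact+
  have w_meas [measurable]: "w \<in> borel_measurable borel" using w by (simp add: excessive_def)
  have h_lsc: "lsc h" unfolding h_def by (rule lsc_potential) fact
  have h_eq: "h x = poisson_mean s y h x + (\<integral>\<^sup>+b. kernel_defect y x b \<partial>\<mu>)" if "y > 0" for x y
    unfolding h_def by (rule potential_eq_mean_add_defect) fact+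
  have h_exc: "excessive h"
    unfolding excessive_def using h_meas h_lsc h_eq by (metis le_iff_add)
  \<comment> \<open>The bound almost everywhere becomes a bound everywhere, with a worse constant.
    It makes \<open>h\<close> finite, so that the subtraction defining \<open>v\<close> can be
    undone. \<open>max K 0\<close> covers a negative \<open>K\<close>, for which
    \<open>ennreal K = 0\<close>.\<close>
  define B where "B = 3 powr s * max K 0"
  have B: "h x \<le> ennreal B" "B \<ge> 0" for x
  proof -
    have "AE x in \<mu>. potential s \<mu> x \<le> ennreal (max K 0)"
      using K by eventually_elim (auto simp: max_def ennreal_neg)
    then show "h x \<le> ennreal B"
      unfolding h_def B_def by (intro potential_le_three_powr) (use assms(1) sets in auto)
  qed (simp add: B_def)
  have h_fin: "h x < \<infinity>" for x using B(1)[of x] by (auto intro: le_less_trans)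
  \<comment> \<open>Outside this ball \<open>h < c \<le> w\<close>, so \<open>v\<close> vanishes
    there; being bounded, it is square integrable.\<close>
  obtain R where R: "\<And>x. norm x > R \<Longrightarrow> h x < ennreal c"
    using potential_vanishes[OF assms(1) sets assms(3,4) c(1)] unfolding h_def by blast
  \<comment> \<open>Subtraction in \<open>ennreal\<close> truncates at 0 and so gives the positive
    part.\<close>
  define v where "v x = h x - w x" for x
  define u where "u x = min (h x) (w x)" for x
  have v_meas [measurable]: "v \<in> borel_measurable borel" unfolding v_def[abs_def] by measurable
  have u_meas [measurable]: "u \<in> borel_measurable borel" unfolding u_def[abs_def] by measurable
  have u_lsc: "lsc u" unfolding u_def[abs_def] using h_lsc w by (intro lsc_min) (auto simp: excessive_def)
  have hvu: "h x = v x + u x" for x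
    unfolding v_def u_def using h_fin[of x]
    by (cases "h x \<le> w x") (auto simp: min_def diff_add_cancel_ennreal diff_eq_0_iff_ennreal)
  have hvw: "h x \<le> v x + w x" for x unfolding hvu[of x] by (intro add_left_mono) (simp add: u_def)
  have v_le: "v x \<le> ennreal B" for x
    using B(1)[of x] unfolding v_def by (rule order_trans[OF diff_le_self_ennreal])
  define f where "f x = enn2real (v x)" for x
  have f: "v x = ennreal (f x)" "0 \<le> f x" for x
    using le_less_trans[OF v_le[of x] ennreal_less_top] unfolding f_def by (auto simp: less_top)
  have f_meas [measurable]: "f \<in> borel_measurable borel" unfolding f_def[abs_def] by measurable
  have v_out: "v x = 0" if "norm x > R" for x
  proof -
    have "h x \<le> w x" using R[OF that] c(2)[of x] by simp
    then show ?thesis using h_fin[of x] by (simp add: v_def diff_eq_0_iff_ennreal)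
  qed
  have f_out: "f x = 0" if "norm x > R" for x using v_out[OF that] by (simp add: f_def)
  define I where "I = (\<integral>\<^sup>+x. ennreal ((f x)\<^sup>2) \<partial>lborel)"
  have I: "I < \<infinity>"
  proof -
    have "f x \<le> B" for x using v_le[of x] f[of x] B(2) by (simp add: ennreal_le_iff)
    then have "ennreal ((f x)\<^sup>2) \<le> ennreal (B\<^sup>2) * indicator (cball 0 R) x" for x
      using f_out[of x] f(2)[of x] by (auto simp: indicator_def not_le intro!: ennreal_leI power_mono)
    then have "I \<le> (\<integral>\<^sup>+x. ennreal (B\<^sup>2) * indicator (cball 0 R) x \<partial>(lborel :: 'a measure))"
      unfolding I_def by (intro nn_integral_mono) auto
    also have "\<dots> = ennreal (B\<^sup>2) * emeasure lborel (cball (0::'a) R)"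
      by (rule nn_integral_cmult_indicator) auto
    also have "\<dots> < \<infinity>"
      using emeasure_bounded_finite[of "cball (0::'a) R"] by (auto simp: ennreal_mult_less_top)
    finally show ?thesis .
  qed
  \<comment> \<open>Where \<open>v\<close> is positive, \<open>w x\<close> is finite and
    \<open>h x = w x + v x\<close>. Inserting \<open>h \<le> v + w\<close> under the Poisson mean
    and using that \<open>w\<close> is excessive leaves \<open>w x\<close> on both sides, where it
    cancels.\<close>
  have v_mean: "v x \<le> poisson_mean s y v x + (\<integral>\<^sup>+b. kernel_defect y x b \<partial>\<mu>)" if y: "y > 0" for x y
  proof (cases "h x \<le> w x")
    case True
    then have "v x = 0" using h_fin[of x] unfolding v_def by (simp add: diff_eq_0_ennreal)
    then show ?thesis by simp
  next
    case False
    then have wx: "w x < \<infinity>" using h_fin[of x] by auto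
    have pw: "poisson_mean s y w x \<le> w x" using w y by (simp add: excessive_def)
    have "w x + v x = h x" using hvu[of x] False by (simp add: u_def min_def add.commute)
    also have "\<dots> = poisson_mean s y h x + (\<integral>\<^sup>+b. kernel_defect y x b \<partial>\<mu>)"
      by (rule h_eq[OF y])
    also have "\<dots> \<le> poisson_mean s y (\<lambda>x. v x + w x) x + (\<integral>\<^sup>+b. kernel_defect y x b \<partial>\<mu>)"
      by (intro add_right_mono poisson_mean_mono hvw)
    also have "\<dots> = poisson_mean s y w x + (poisson_mean s y v x + (\<integral>\<^sup>+b. kernel_defect y x b \<partial>\<mu>))"
      by (subst poisson_mean_add) (auto simp: ac_simps)
    also have "\<dots> \<le> w x + (poisson_mean s y v x + (\<integral>\<^sup>+b. kernel_defect y x b \<partial>\<mu>))"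
      using pw by (rule add_right_mono)
    finally show ?thesis using wx by (subst (asm) ennreal_add_left_cancel_le) auto
  qed
  obtain C where C: "C > 0" and defect: "\<And>y. y > 0 \<Longrightarrow> (\<integral>\<^sup>+x. v x * (\<integral>\<^sup>+b. kernel_defect y x b \<partial>\<mu>) \<partial>lborel)
     \<le> ennreal (C * y powr (DIM('a) - s)) *
        (\<integral>\<^sup>+t\<in>{0<..}. ennreal (scale_weight t) * (\<integral>\<^sup>+b. poisson_mean s (t * y) v b \<partial>\<mu>) \<partial>lborel)"
    using nn_integral_defect_le v_meas assms(1) sets by blast
  define G where "G y = (\<integral>\<^sup>+t\<in>{0<..}. ennreal (scale_weight t) * (\<integral>\<^sup>+b. poisson_mean s (t * y) v b \<partial>\<mu>) \<partial>lborel)" for y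
  \<comment> \<open>Testing \<open>v_mean\<close> against \<open>v\<close> gives
    \<open>I \<le> Q + D\<close>, and with \<open>jump_energy y f + 2 * Q = 2 * I\<close> the energy
    is at most \<open>2 * D\<close>. The lower bound for the energy and the upper bound for
    \<open>D\<close> both carry \<open>y powr (p - s)\<close>; after cancelling, a fixed energy is
    bounded by \<open>G y\<close>.\<close>
  have energy: "jump_energy 1 f \<le> ennreal (2 * C) * G y" if y: "0 < y" "y \<le> 1" for y
  proof -
    define Q where "Q = (\<integral>\<^sup>+x. ennreal (f x) * poisson_mean s y (\<lambda>x. ennreal (f x)) x \<partial>lborel)"
    define D where "D = (\<integral>\<^sup>+x. v x * (\<integral>\<^sup>+b. kernel_defect y x b \<partial>\<mu>) \<partial>lborel)"
    have vf: "v = (\<lambda>x. ennreal (f x))" using f by auto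
    have EQ: "jump_energy y f + 2 * Q = 2 * I"
      unfolding Q_def I_def using f y by (intro jump_energy_add) auto
    have "I = (\<integral>\<^sup>+x. v x * v x \<partial>lborel)"
      unfolding I_def using f by (intro nn_integral_cong) (simp add: power2_eq_square ennreal_mult')
    also have "\<dots> \<le> (\<integral>\<^sup>+x. v x * poisson_mean s y v x + v x * (\<integral>\<^sup>+b. kernel_defect y x b \<partial>\<mu>) \<partial>lborel)"
      unfolding distrib_left[symmetric] using y by (intro nn_integral_mono mult_left_mono v_mean) auto
    also have "\<dots> = Q + D"
      unfolding Q_def D_def vf[symmetric] by (subst nn_integral_add) (auto simp: f)
    finally have "I \<le> Q + D" .
    then have "2 * I \<le> 2 * (Q + D)" by (intro mult_left_mono) auto
    then have "2 * Q + jump_energy y f \<le> 2 * Q + 2 * D" unfolding EQ[symmetric] by (simp add: distrib_left add.commute)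
    moreover have "2 * Q < \<infinity>"
    proof -
      have "2 * Q \<le> 2 * I" unfolding EQ[symmetric] by simp
      also have "\<dots> < \<infinity>" using I by (simp add: ennreal_mult_less_top)
      finally show ?thesis .
    qed
    ultimately have "jump_energy y f \<le> 2 * D" by (subst (asm) ennreal_add_left_cancel_le) auto
    also have "D \<le> ennreal (C * y powr (DIM('a) - s)) * G y" unfolding D_def G_def using y by (intro defect)
    finally have 1: "jump_energy y f \<le> 2 * (ennreal (C * y powr (DIM('a) - s)) * G y)" by (simp add: mult_left_mono)
    have "ennreal (y powr (DIM('a) - s)) * jump_energy 1 f \<le> jump_energy y f"
      using y by (intro jump_energy_scale_le) auto
    also note 1
    also have "2 * (ennreal (C * y powr (DIM('a) - s)) * G y) = ennreal (y powr (DIM('a) - s)) * (ennreal (2 * C) * G y)"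
      using C by (simp add: ennreal_mult' mult_ac)
    finally show ?thesis
      using y by (subst (asm) ennreal_mult_le_mult_iff) auto
  qed
  have v0: "AE x in \<mu>. v x = 0"
    using le by eventually_elim (simp add: v_def h_def[symmetric] diff_eq_0_iff_ennreal h_fin[unfolded infinity_ennreal_def])
  have H: "(\<integral>\<^sup>+x. h x \<partial>\<mu>) < \<infinity>"
  proof -
    have "(\<integral>\<^sup>+x. h x \<partial>\<mu>) \<le> (\<integral>\<^sup>+x. ennreal B \<partial>\<mu>)" using B by (intro nn_integral_mono) auto
    also have "\<dots> < \<infinity>" by (simp add: ennreal_mult_less_top emeasure_eq_measure)
    finally show ?thesis .
  qed
  define Y where "Y n = inverse (real (Suc n))" for n
  have Y: "Y n > 0" "Y n \<le> 1" "Y \<longlonglongrightarrow> 0" for n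
    using LIMSEQ_inverse_real_of_nat unfolding Y_def[abs_def] by (auto simp: field_simps)
  \<comment> \<open>For each \<open>t\<close> the integral of the Poisson means tends to 0; it is at
    most the integral of \<open>h\<close>, so the integrable weight dominates.\<close>
  have "(\<lambda>n. G (Y n)) \<longlonglongrightarrow> (\<integral>\<^sup>+t\<in>{0<..}. 0 \<partial>(lborel :: real measure))"
    unfolding G_def
  proof (rule nn_integral_dominated_convergence)
    show "(\<integral>\<^sup>+t\<in>{0<..}. ennreal (scale_weight t) * (\<integral>\<^sup>+x. h x \<partial>\<mu>) \<partial>lborel) < \<infinity>"
    proof -
      have "(\<integral>\<^sup>+t\<in>{0<..}. ennreal (scale_weight t) * (\<integral>\<^sup>+x. h x \<partial>\<mu>) \<partial>lborel)
         = (\<integral>\<^sup>+t\<in>{0<..}. ennreal (scale_weight t) \<partial>lborel) * (\<integral>\<^sup>+x. h x \<partial>\<mu>)"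
      proof -
        have "(\<integral>\<^sup>+t\<in>{0<..}. ennreal (scale_weight t) * H' \<partial>lborel)
           = (\<integral>\<^sup>+t. (ennreal (scale_weight t) * indicator {0<..} t) * H' \<partial>lborel)" for H' :: ennreal
          by (simp add: mult_ac)
        then show ?thesis by (simp add: nn_integral_multc)
      qed
      also have "\<dots> < \<infinity>" using nn_integral_scale_weight H by (simp add: ennreal_mult_less_top)
      finally show ?thesis .
    qed
    show "AE t in lborel. ennreal (scale_weight t) * (\<integral>\<^sup>+b. poisson_mean s (t * Y n) v b \<partial>\<mu>) * indicator {0<..} t
        \<le> ennreal (scale_weight t) * (\<integral>\<^sup>+x. h x \<partial>\<mu>) * indicator {0<..} t" for n
    proof (rule AE_I2)
      fix t :: real
      show "ennreal (scale_weight t) * (\<integral>\<^sup>+b. poisson_mean s (t * Y n) v b \<partial>\<mu>) * indicator {0<..} t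
        \<le> ennreal (scale_weight t) * (\<integral>\<^sup>+x. h x \<partial>\<mu>) * indicator {0<..} t"
      proof (cases "t > 0")
        case True
        have "poisson_mean s (t * Y n) v b \<le> h b" for b
        proof -
          have "poisson_mean s (t * Y n) v b \<le> poisson_mean s (t * Y n) v b + poisson_mean s (t * Y n) u b" by simp
          also have "\<dots> \<le> h b"
            using True Y(1)[of n] by (intro poisson_mean_excess_le[OF h_exc u_meas v_meas hvu]) simp
          finally show ?thesis .
        qed
        then show ?thesis by (intro mult_right_mono mult_left_mono nn_integral_mono) auto
      qed simp
    qed
    show "AE t in lborel. (\<lambda>n. ennreal (scale_weight t) * (\<integral>\<^sup>+b. poisson_mean s (t * Y n) v b \<partial>\<mu>) * indicator {0<..} t) \<longlonglongrightarrow> 0 * indicator {0<..} t"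
    proof (rule AE_I2)
      fix t :: real
      show "(\<lambda>n. ennreal (scale_weight t) * (\<integral>\<^sup>+b. poisson_mean s (t * Y n) v b \<partial>\<mu>) * indicator {0<..} t) \<longlonglongrightarrow> 0 * indicator {0<..} t"
      proof (cases "t > 0")
        case True
        have "(\<lambda>n. \<integral>\<^sup>+b. poisson_mean s (t * Y n) v b \<partial>\<mu>) \<longlonglongrightarrow> 0"
        proof (rule nn_integral_poisson_mean_tendsto_0[OF assms(1) sets h_exc H u_meas v_meas u_lsc hvu v0])
          show "(\<lambda>n. t * Y n) \<longlonglongrightarrow> 0" using tendsto_mult_left[OF Y(3), of t] by simp
          show "0 < t * Y n" for n using True Y(1) by simp
        qed
        then have "(\<lambda>n. ennreal (scale_weight t) * (\<integral>\<^sup>+b. poisson_mean s (t * Y n) v b \<partial>\<mu>)) \<longlonglongrightarrow> ennreal (scale_weight t) * 0"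
          by (intro ennreal_tendsto_cmult) auto
        then show ?thesis using True by simp
      qed simp
    qed
  qed measurable
  then have "(\<lambda>n. ennreal (2 * C) * G (Y n)) \<longlonglongrightarrow> ennreal (2 * C) * 0"
    by (intro ennreal_tendsto_cmult) auto
  then have "jump_energy 1 f \<le> 0"
    by (intro tendsto_lowerbound[of _ _ sequentially]) (auto intro!: always_eventually energy Y)
  then have "AE x in lborel. f x = 0"
    using f_out by (intro jump_energy_eq_0_imp) auto
  then have "AE x in lborel. v x = 0" by eventually_elim (simp add: f)
  then have "(\<integral>\<^sup>+x. v x \<partial>lborel) = 0" by (subst nn_integral_0_iff_AE) auto
  then have "(\<integral>\<^sup>+z. v (x + z) \<partial>lborel) = 0" by (subst nn_integral_lborel_translate) auto
  then have vx: "AE z in lborel. v (x + z) = 0" by (subst (asm) nn_integral_0_iff_AE) auto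
  \<comment> \<open>Poisson means do not see Lebesgue null sets. They carry \<open>h \<le> w\<close>
    from almost everywhere to the point \<open>x\<close>, where semicontinuity of \<open>h\<close>
    recovers its value as \<open>y\<close> tends to 0.\<close>
  have "poisson_mean s y h x \<le> w x" if y: "y > 0" for y
  proof -
    have "poisson_mean s y h x \<le> poisson_mean s y w x"
      unfolding poisson_mean_def
    proof (rule nn_integral_mono_AE)
      show "AE z in lborel. ennreal (poisson s y z) * h (x + z) \<le> ennreal (poisson s y z) * w (x + z)"
        using vx by eventually_elim (use hvw in \<open>metis add_0 mult_left_mono zero_le\<close>)
    qed
    also have "\<dots> \<le> w x" using w y by (simp add: excessive_def)
    finally show ?thesis .
  qed
  then have "liminf (\<lambda>n. poisson_mean s (Y n) h x) \<le> w x"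
    using Y by (intro Liminf_le always_eventually) auto
  moreover have "h x \<le> liminf (\<lambda>n. poisson_mean s (Y n) h x)"
    using h_lsc Y by (intro poisson_mean_liminf) auto
  ultimately show ?thesis unfolding h_def by (rule order_trans[rotated])
qed

end

section \<open>Equilibrium measures\<close>

lemma two_power_powr: "((2::real) ^ n) powr x = (2 powr x) ^ n"
  by (simp add: powr_realpow[symmetric] powr_powr mult.commute)

lemma ex_dyadic_shell:
  fixes \<delta> \<epsilon> :: real
  assumes "0 < \<delta>" "\<delta> < \<epsilon>"
  shows "\<exists>n. \<epsilon> / 2 ^ Suc n \<le> \<delta> \<and> \<delta> < \<epsilon> / 2 ^ n"
proof -
  obtain m where "\<epsilon> / \<delta> < 2 ^ m" using real_arch_pow[of 2 "\<epsilon> / \<delta>"] by auto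
  then have "\<epsilon> < \<delta> * 2 ^ Suc m" using assms by (simp add: field_simps)
  then have ex: "\<exists>n. \<epsilon> / 2 ^ Suc n \<le> \<delta>" by (intro exI[of _ m]) (simp add: field_simps)
  define n where "n = (LEAST n. \<epsilon> / 2 ^ Suc n \<le> \<delta>)"
  have n: "\<epsilon> / 2 ^ Suc n \<le> \<delta>" unfolding n_def using ex by (rule LeastI_ex)
  moreover have "\<delta> < \<epsilon> / 2 ^ n"
  proof (cases n)
    case (Suc m)
    then have "\<not> \<epsilon> / 2 ^ Suc m \<le> \<delta>" using not_less_Least[of m "\<lambda>n. \<epsilon> / 2 ^ Suc n \<le> \<delta>"] unfolding n_def by auto
    then show ?thesis using Suc by simp
  qed (use assms in simp)
  ultimately show ?thesis by blast
qed

text \<open>On the shell between the radii \<open>\<epsilon> / 2 ^ Suc n\<close> and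
  \<open>\<epsilon> / 2 ^ n\<close> the kernel is bounded by its value at the inner radius and the
  mass by that of the outer ball. The products form a geometric sequence of ratio
  \<open>2 powr (s - d)\<close>; the factor \<open>2 powr s\<close> stems from the inner
  radius.\<close>

lemma near_potential_le:
  fixes a :: "'a::euclidean_space"
  assumes "finite_measure \<mu>" and [measurable_cong]: "sets \<mu> = sets borel"
    and s: "0 < s" "s < d" and "0 < \<epsilon>" "0 \<le> c"
    and upper: "\<And>t. 0 < t \<Longrightarrow> t \<le> \<epsilon> \<Longrightarrow> measure \<mu> (ball a t) \<le> c * t powr d"
  shows "(\<integral>\<^sup>+z\<in>ball a \<epsilon>. riesz_kernel s a z \<partial>\<mu>) \<le> ennreal (c * 2 powr s / (1 - 2 powr (s - d)) * \<epsilon> powr (d - s))"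
proof -
  interpret finite_measure \<mu> by fact
  define q :: real where "q = 2 powr (s - d)"
  have q: "0 < q" "q < 1" using s by (auto simp: q_def intro: powr_less_one)
  have q2: "2 powr (- d) < (1::real)" "0 < (2::real) powr (- d)" using s by (auto intro: powr_less_one)
  define g where "g n = (\<epsilon> / 2 ^ Suc n) powr (- s)" for n :: nat
  define B where "B n = ball a (\<epsilon> / 2 ^ n)" for n :: nat
  have Bm [measurable]: "B n \<in> sets borel" for n by (simp add: B_def)
  have B_le: "measure \<mu> (B n) \<le> c * \<epsilon> powr d * (2 powr (- d)) ^ n" for n
  proof -
    have "measure \<mu> (B n) \<le> c * (\<epsilon> / 2 ^ n) powr d"
      unfolding B_def using assms(5) by (intro upper) (auto simp: field_simps)
    also have "(\<epsilon> / 2 ^ n) powr d = \<epsilon> powr d * (2 powr (- d)) ^ n"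
      using assms(5) by (simp add: powr_divide two_power_powr powr_minus_divide power_one_over)
    finally show ?thesis by (simp add: mult.assoc)
  qed
  \<comment> \<open>The kernel is infinite at \<open>a\<close> and \<open>a\<close> lies in no
    shell, so the centre has to be a null set.\<close>
  have "measure \<mu> {a} \<le> 0"
  proof (rule LIMSEQ_le_const)
    have "(\<lambda>n. c * \<epsilon> powr d * (2 powr (- d)) ^ n) \<longlonglongrightarrow> c * \<epsilon> powr d * 0"
      using q2 by (intro tendsto_mult_left LIMSEQ_power_zero) auto
    then show "(\<lambda>n. c * \<epsilon> powr d * (2 powr (- d)) ^ n) \<longlonglongrightarrow> 0" by simp
    have "measure \<mu> {a} \<le> measure \<mu> (B n)" for n
      using assms(5) by (intro finite_measure_mono) (auto simp: B_def)
    then show "\<exists>N. \<forall>n\<ge>N. measure \<mu> {a} \<le> c * \<epsilon> powr d * (2 powr (- d)) ^ n"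
      using B_le order_trans by blast
  qed
  then have "emeasure \<mu> {a} = 0" by (simp add: emeasure_eq_measure measure_le_0_iff)
  then have AE_a: "AE z in \<mu>. z \<noteq> a" by (intro AE_I[of _ _ "{a}"]) auto
  have "(\<integral>\<^sup>+z\<in>ball a \<epsilon>. riesz_kernel s a z \<partial>\<mu>) \<le> (\<integral>\<^sup>+z. (\<Sum>n. ennreal (g n) * indicator (B n) z) \<partial>\<mu>)"
  proof (rule nn_integral_mono_AE)
    show "AE z in \<mu>. riesz_kernel s a z * indicator (ball a \<epsilon>) z \<le> (\<Sum>n. ennreal (g n) * indicator (B n) z)"
      using AE_a
    proof eventually_elim
      case (elim z)
      show ?case
      proof (cases "z \<in> ball a \<epsilon>")
        case True
        \<comment> \<open>The summand of the shell containing \<open>z\<close> already suffices. The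
          series runs over full balls, which overlap but whose masses are the ones that upper
          regularity bounds.\<close>
        then obtain n where n: "\<epsilon> / 2 ^ Suc n \<le> dist a z" "dist a z < \<epsilon> / 2 ^ n"
          using ex_dyadic_shell[of "dist a z" \<epsilon>] elim by auto
        have "riesz_kernel s a z * indicator (ball a \<epsilon>) z = ennreal (dist a z powr (- s))"
          using True elim by (auto simp: riesz_kernel_def)
        also have "\<dots> \<le> ennreal (g n)"
          unfolding g_def using n(1) assms(5) s by (intro ennreal_leI powr_mono2') auto
        also have "\<dots> = (\<Sum>i\<in>{n}. ennreal (g i) * indicator (B i) z)" using n(2) by (simp add: B_def)
        also have "\<dots> \<le> (\<Sum>n. ennreal (g n) * indicator (B n) z)" by (rule sum_le_suminf) auto
        finally show ?thesis .
      qed simp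
    qed
  qed
  also have "\<dots> = (\<Sum>n. ennreal (g n) * emeasure \<mu> (B n))"
    by (subst nn_integral_suminf) (auto simp: nn_integral_cmult_indicator)
  also have "\<dots> \<le> (\<Sum>n. ennreal (c * 2 powr s * \<epsilon> powr (d - s) * q ^ n))"
  proof (intro suminf_le summableI)
    fix n
    have "ennreal (g n) * emeasure \<mu> (B n) = ennreal (g n * measure \<mu> (B n))"
      by (simp add: emeasure_eq_measure ennreal_mult' g_def)
    also have "\<dots> \<le> ennreal (g n * (c * \<epsilon> powr d * (2 powr (- d)) ^ n))"
      by (intro ennreal_leI mult_left_mono B_le) (simp add: g_def)
    also have "g n * (c * \<epsilon> powr d * (2 powr (- d)) ^ n)
       = \<epsilon> powr (- s) * 2 powr s * (2 powr s) ^ n * (c * \<epsilon> powr d * (2 powr (- d)) ^ n)"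
    proof -
      have "(2 ^ Suc n) powr (- s) = inverse (2 powr s * (2 powr s) ^ n)"
        unfolding powr_minus two_power_powr by simp
      moreover have "(\<epsilon> / 2 ^ Suc n) powr (- s) = \<epsilon> powr (- s) / (2 ^ Suc n) powr (- s)"
        using assms(5) by (intro powr_divide)
      ultimately show ?thesis unfolding g_def by (simp del: power_Suc add: divide_inverse)
    qed
    also have "\<epsilon> powr (- s) * 2 powr s * (2 powr s) ^ n * (c * \<epsilon> powr d * (2 powr (- d)) ^ n)
       = c * 2 powr s * (\<epsilon> powr d * \<epsilon> powr (- s)) * (2 powr s * 2 powr (- d)) ^ n"
      by (simp add: power_mult_distrib mult_ac)
    also have "\<epsilon> powr d * \<epsilon> powr (- s) = \<epsilon> powr (d - s)" by (simp add: powr_add[symmetric])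
    also have "2 powr s * 2 powr (- d) = q" by (simp add: powr_add[symmetric] q_def)
    finally show "ennreal (g n) * emeasure \<mu> (B n) \<le> ennreal (c * 2 powr s * \<epsilon> powr (d - s) * q ^ n)" .
  qed
  also have "\<dots> = ennreal (\<Sum>n. c * 2 powr s * \<epsilon> powr (d - s) * q ^ n)"
    using q assms(6) by (intro suminf_ennreal2) (auto intro!: summable_mult summable_geometric)
  also have "(\<Sum>n. c * 2 powr s * \<epsilon> powr (d - s) * q ^ n) = c * 2 powr s * \<epsilon> powr (d - s) * (1 / (1 - q))"
    using q by (subst suminf_mult) (auto simp: suminf_geometric summable_geometric)
  finally show ?thesis by (simp add: q_def mult_ac)
qed

section \<open>Construction of trial measures\<close>

lemma borel_probs_on_I:
  fixes A :: "'a::topological_space set"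
  assumes [measurable]: "A \<in> sets borel" and sets: "sets \<mu> = sets borel"
    and "emeasure \<mu> UNIV = 1" "emeasure \<mu> (- A) = 0"
  shows "\<mu> \<in> borel_probs_on A"
proof -
  have sp: "space \<mu> = UNIV" using sets_eq_imp_space_eq[OF sets] by simp
  then have "prob_space \<mu>" using assms(3) by (intro prob_spaceI) simp
  moreover have "AE x in \<mu>. x \<in> A"
    using assms by (intro AE_I[of _ _ "- A"]) auto
  ultimately show ?thesis
    unfolding borel_probs_on_def finite_borel_measure_def supported_on_def
    using sets by (auto intro: prob_space.finite_measure)
qed

lemma emeasure_Compl_borel_probs_on:
  assumes "\<mu> \<in> borel_probs_on A" "A \<in> sets borel"
  shows "emeasure \<mu> (- A) = 0"
proof -
  have sets: "sets \<mu> = sets borel" and "AE x in \<mu>. x \<in> A"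
    using assms(1) by (auto simp: borel_probs_on_def finite_borel_measure_def supported_on_def)
  moreover have "{x \<in> space \<mu>. x \<notin> A} = - A" using sets_eq_imp_space_eq[OF sets] by auto
  ultimately show ?thesis using assms(2) by (subst (asm) AE_iff_measurable[of "- A"]) auto
qed

text \<open>The convex combination, realised as a Bernoulli mixture of the two measures and used
  through its integrals alone.\<close>

lemma borel_probs_on_mixture:
  fixes A :: "'a::topological_space set"
  assumes A: "A \<in> sets borel" and \<mu>: "\<mu> \<in> borel_probs_on A" and \<nu>: "\<nu> \<in> borel_probs_on A"
    and t: "0 \<le> t" "t \<le> (1::real)"
  shows "\<exists>m\<in>borel_probs_on A. \<forall>f\<in>borel_measurable borel.
    (\<integral>\<^sup>+x. f x \<partial>m) = ennreal (1 - t) * (\<integral>\<^sup>+x. f x \<partial>\<mu>) + ennreal t * (\<integral>\<^sup>+x. f x \<partial>\<nu>)"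
proof -
  define N where "N b = (if b then \<nu> else \<mu>)" for b
  define m where "m = measure_pmf (bernoulli_pmf t) \<bind> N"
  have sets: "sets \<mu> = sets borel" "sets \<nu> = sets borel"
    using \<mu> \<nu> by (auto simp: borel_probs_on_def finite_borel_measure_def)
  have "N b \<in> space (subprob_algebra borel)" for b
    using \<mu> \<nu> unfolding N_def borel_probs_on_def finite_borel_measure_def
    by (auto simp: space_subprob_algebra prob_space_imp_subprob_space)
  then have N: "N \<in> measurable (measure_pmf (bernoulli_pmf t)) (subprob_algebra borel)" by simp
  have m_sets: "sets m = sets borel" unfolding m_def using N by (intro sets_bind) (auto simp: sets N_def)
  have int: "(\<integral>\<^sup>+x. f x \<partial>m) = ennreal (1 - t) * (\<integral>\<^sup>+x. f x \<partial>\<mu>) + ennreal t * (\<integral>\<^sup>+x. f x \<partial>\<nu>)"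
    if f: "f \<in> borel_measurable borel" for f
    unfolding m_def nn_integral_bind[OF f N] using t by (simp add: N_def mult.commute add.commute)
  have em: "emeasure m X = ennreal (1 - t) * emeasure \<mu> X + ennreal t * emeasure \<nu> X" if "X \<in> sets borel" for X
    using int[of "indicator X"] that sets m_sets by simp
  have one: "emeasure \<mu> UNIV = 1" "emeasure \<nu> UNIV = 1"
    using \<mu> \<nu> sets_eq_imp_space_eq[OF sets(1)] sets_eq_imp_space_eq[OF sets(2)]
    by (auto simp: borel_probs_on_def dest: prob_space.emeasure_space_1)
  have zero: "emeasure \<mu> (- A) = 0" "emeasure \<nu> (- A) = 0"
    using \<mu> \<nu> A by (auto intro: emeasure_Compl_borel_probs_on)
  have "m \<in> borel_probs_on A"
    using A t by (intro borel_probs_on_I m_sets) (auto simp: em one zero ennreal_plus[symmetric] simp del: ennreal_plus)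
  then show ?thesis using int by blast
qed

text \<open>The source of both kinds of trial measure: the equilibrium measure conditioned on the
  set where its potential is low, and a regular measure conditioned on a small ball.\<close>

lemma normalized_restriction:
  fixes A :: "'a::topological_space set"
  assumes "finite_measure \<eta>" and [measurable_cong]: "sets \<eta> = sets borel"
    and [measurable]: "A \<in> sets borel" "B \<in> sets borel" and "AE x in \<eta>. x \<in> A" and b: "0 < measure \<eta> B"
  shows "\<exists>\<nu>\<in>borel_probs_on A. \<forall>f\<in>borel_measurable borel.
    (\<integral>\<^sup>+x. f x \<partial>\<nu>) = ennreal (1 / measure \<eta> B) * (\<integral>\<^sup>+x\<in>B. f x \<partial>\<eta>)"
proof -
  interpret finite_measure \<eta> by fact
  define b where "b = measure \<eta> B"
  define \<nu> where "\<nu> = density \<eta> (\<lambda>x. ennreal (1 / b) * indicator B x)"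
  have sets_\<nu>: "sets \<nu> = sets borel" by (simp add: \<nu>_def assms(2))
  have int: "(\<integral>\<^sup>+x. f x \<partial>\<nu>) = ennreal (1 / b) * (\<integral>\<^sup>+x\<in>B. f x \<partial>\<eta>)" if [measurable]: "f \<in> borel_measurable borel" for f
  proof -
    have "(\<integral>\<^sup>+x. f x \<partial>\<nu>) = (\<integral>\<^sup>+x. ennreal (1 / b) * (f x * indicator B x) \<partial>\<eta>)"
      unfolding \<nu>_def by (subst nn_integral_density) (auto simp: mult_ac)
    also have "\<dots> = ennreal (1 / b) * (\<integral>\<^sup>+x\<in>B. f x \<partial>\<eta>)" by (rule nn_integral_cmult) measurable
    finally show ?thesis .
  qed
  have "\<nu> \<in> borel_probs_on A"
  proof (rule borel_probs_on_I[OF assms(3) sets_\<nu>])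
    have "emeasure \<nu> UNIV = ennreal (1 / b) * ennreal b"
      using int[of "\<lambda>_. 1"] sets_eq_imp_space_eq[OF sets_\<nu>] by (simp add: assms(2) b_def emeasure_eq_measure)
    then show "emeasure \<nu> UNIV = 1" using b by (simp add: ennreal_mult'[symmetric] b_def)
    have "(\<integral>\<^sup>+x\<in>B. indicator (- A) x \<partial>\<eta>) = (\<integral>\<^sup>+x. 0 \<partial>\<eta>)"
      using assms(5) by (intro nn_integral_cong_AE) (auto elim!: eventually_mono)
    then show "emeasure \<nu> (- A) = 0" using int[of "indicator (- A)"] sets_\<nu> by simp
  qed
  then show ?thesis using int unfolding b_def by blast
qed

lemma borel_probs_onD:
  assumes "\<mu> \<in> borel_probs_on A"
  shows "prob_space \<mu>" "finite_measure \<mu>" "sets \<mu> = sets borel" "AE x in \<mu>. x \<in> A"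
  using assms by (auto simp: borel_probs_on_def finite_borel_measure_def supported_on_def)

context riesz
begin

lemma nn_integral_potential_commute:
  assumes "finite_measure \<mu>" and [measurable_cong]: "sets \<mu> = sets (borel :: 'a measure)"
    and "finite_measure \<nu>" and [measurable_cong]: "sets \<nu> = sets (borel :: 'a measure)"
  shows "(\<integral>\<^sup>+x. potential s \<mu> x \<partial>\<nu>) = (\<integral>\<^sup>+x. potential s \<nu> x \<partial>\<mu>)"
proof -
  interpret M: finite_measure \<mu> by fact
  interpret N: finite_measure \<nu> by fact
  interpret pair_sigma_finite \<mu> \<nu> by unfold_locales
  show ?thesis unfolding potential_def
    by (subst Fubini') (auto simp: riesz_kernel_commute)
qed

lemma riesz_energy_eq:
  assumes "\<mu> \<in> borel_probs_on (A :: 'a set)"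
  shows "riesz_energy s A \<mu> = (\<integral>\<^sup>+x. potential s \<mu> x \<partial>\<mu>)"
proof -
  have ae: "AE x in \<mu>. x \<in> A" using assms by (rule borel_probs_onD)
  have "riesz_potential s A \<mu> x = potential s \<mu> x" for x
    unfolding riesz_potential_def potential_def using ae by (intro nn_integral_cong_AE) (auto elim: eventually_mono)
  then show ?thesis
    unfolding riesz_energy_def using ae by (intro nn_integral_cong_AE) (auto elim: eventually_mono)
qed

end

section \<open>Frostman's theorem for the equilibrium potential\<close>

locale equilibrium = riesz s T for s and T :: "'a::euclidean_space itself" +
  fixes A :: "'a set" and \<mu> :: "'a measure" and W :: real
  assumes compact_A: "compact A"
    and \<mu>: "\<mu> \<in> borel_probs_on A"
    and energy_\<mu>: "(\<integral>\<^sup>+x. potential s \<mu> x \<partial>\<mu>) = ennreal W"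
    and W_pos: "0 < W"
    and minimal: "\<And>\<nu>. \<nu> \<in> borel_probs_on A \<Longrightarrow> ennreal W \<le> (\<integral>\<^sup>+x. potential s \<nu> x \<partial>\<nu>)"
begin

sublocale prob_space \<mu> using \<mu> by (rule borel_probs_onD)

lemma sets_\<mu> [measurable_cong]: "sets \<mu> = sets borel" using \<mu> by (rule borel_probs_onD)

lemma space_\<mu>: "space \<mu> = UNIV" using sets_eq_imp_space_eq[OF sets_\<mu>] by simp

lemma A_borel [measurable]: "A \<in> sets borel" using compact_A by (simp add: borel_closed compact_imp_closed)

lemma borel_measurable_potential_\<mu> [measurable]: "potential s \<mu> \<in> borel_measurable borel"
  by (rule borel_measurable_potential) (auto simp: sets_\<mu> finite_measure_axioms)

text \<open>The energy of \<open>(1 - t) \<mu> + t \<nu>\<close> is a quadratic polynomial in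
  \<open>t\<close> with minimum on \<open>[0, 1]\<close> at 0, so its derivative at 0, twice the
  mutual energy minus \<open>2 W\<close>, is nonnegative. Finite energy of \<open>\<nu>\<close>
  makes the coefficients real.\<close>

lemma first_variation:
  assumes \<nu>: "\<nu> \<in> borel_probs_on A" and fin: "(\<integral>\<^sup>+x. potential s \<nu> x \<partial>\<nu>) < \<infinity>"
  shows "ennreal W \<le> (\<integral>\<^sup>+x. potential s \<mu> x \<partial>\<nu>)"
proof (rule ccontr)
  assume less: "\<not> ?thesis"
  note \<nu>' = borel_probs_onD[OF \<nu>]
  have [measurable_cong]: "sets \<nu> = sets borel" by fact
  have [measurable]: "potential s \<nu> \<in> borel_measurable borel" by (rule borel_measurable_potential) fact+
  obtain j where j: "(\<integral>\<^sup>+x. potential s \<mu> x \<partial>\<nu>) = ennreal j" "0 \<le> j" "j < W"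
    using less by (cases "\<integral>\<^sup>+x. potential s \<mu> x \<partial>\<nu>") (auto simp: not_le ennreal_less_iff)
  have j': "(\<integral>\<^sup>+x. potential s \<nu> x \<partial>\<mu>) = ennreal j"
    using j(1) by (subst nn_integral_potential_commute) (auto simp: \<nu>' sets_\<mu> finite_measure_axioms)
  obtain i where i: "(\<integral>\<^sup>+x. potential s \<nu> x \<partial>\<nu>) = ennreal i" "0 \<le> i"
    using fin by (cases "\<integral>\<^sup>+x. potential s \<nu> x \<partial>\<nu>") auto
  have quad: "W \<le> (1 - t) * ((1 - t) * W + t * j) + t * ((1 - t) * j + t * i)" if t: "0 \<le> t" "t \<le> 1" for t
  proof -
    obtain m where m: "m \<in> borel_probs_on A" and int: "\<And>f. f \<in> borel_measurable borel \<Longrightarrow>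
      (\<integral>\<^sup>+x. f x \<partial>m) = ennreal (1 - t) * (\<integral>\<^sup>+x. f x \<partial>\<mu>) + ennreal t * (\<integral>\<^sup>+x. f x \<partial>\<nu>)"
      using borel_probs_on_mixture[OF A_borel \<mu> \<nu> t] by blast
    have pot: "potential s m = (\<lambda>x. ennreal (1 - t) * potential s \<mu> x + ennreal t * potential s \<nu> x)"
      unfolding potential_def by (intro ext int) measurable
    have "ennreal W \<le> (\<integral>\<^sup>+x. potential s m x \<partial>m)" using m by (rule minimal)
    also have "\<dots> = ennreal (1 - t) * (ennreal (1 - t) * ennreal W + ennreal t * ennreal j)
          + ennreal t * (ennreal (1 - t) * ennreal j + ennreal t * ennreal i)"
      unfolding pot by (subst int) (auto simp: nn_integral_add nn_integral_cmult energy_\<mu> i j j')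
    also have "\<dots> = ennreal ((1 - t) * ((1 - t) * W + t * j) + t * ((1 - t) * j + t * i))"
      using t W_pos i j by (simp add: ennreal_mult'[symmetric] ennreal_plus[symmetric] del: ennreal_plus)
    finally show ?thesis using t W_pos i j by (subst (asm) ennreal_le_iff) auto
  qed
  \<comment> \<open>\<open>D\<close> is the coefficient of the square of \<open>t\<close>. The value
    \<open>t = 1\<close> shows \<open>D \<ge> 2 * (W - j) > 0\<close>, so that
    \<open>t = (W - j) / D\<close> is admissible and contradicts the inequality.\<close>
  define D where "D = W - 2 * j + i"
  have *: "2 * (W - j) \<le> t * D" if t: "0 < t" "t \<le> 1" for t
  proof -
    have "t * (2 * (W - j)) \<le> t * (t * D)"
      using quad[of t] t by (simp add: D_def algebra_simps)
    then show ?thesis using t by simp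
  qed
  have D: "D \<ge> 2 * (W - j)" using *[of 1] by simp
  then have "(W - j) / D * D = W - j" "0 < (W - j) / D" "(W - j) / D \<le> 1" using j by (auto simp: field_simps)
  then show False using *[of "(W - j) / D"] j by simp
qed

text \<open>If the potential were below \<open>W\<close> on a set \<open>B\<close> of positive mass,
  \<open>\<mu>\<close> conditioned on \<open>B\<close> would be a trial measure against which the
  potential has mean less than \<open>W\<close>, contrary to the first variation.\<close>

lemma potential_ge_AE: "AE x in \<mu>. ennreal W \<le> potential s \<mu> x"
proof -
  define B where "B = {x. potential s \<mu> x < ennreal W}"
  have B [measurable]: "B \<in> sets borel" unfolding B_def by measurable
  have "emeasure \<mu> B = 0"
  proof (rule ccontr)
    assume nz: "emeasure \<mu> B \<noteq> 0"
    define b where "b = measure \<mu> B"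
    have b: "b > 0" "emeasure \<mu> B = ennreal b"
      using nz by (auto simp: b_def emeasure_eq_measure zero_less_measure_iff)
    obtain \<nu> where \<nu>: "\<nu> \<in> borel_probs_on A" and int: "\<And>f. f \<in> borel_measurable borel \<Longrightarrow>
        (\<integral>\<^sup>+x. f x \<partial>\<nu>) = ennreal (1 / b) * (\<integral>\<^sup>+x\<in>B. f x \<partial>\<mu>)"
      using normalized_restriction[OF finite_measure_axioms sets_\<mu> A_borel B borel_probs_onD(4)[OF \<mu>]] b(1)
      unfolding b_def by blast
    have sets_\<nu> [measurable_cong]: "sets \<nu> = sets borel" using \<nu> by (rule borel_probs_onD)
    have [measurable]: "potential s \<nu> \<in> borel_measurable borel"
      by (rule borel_measurable_potential) (auto simp: borel_probs_onD[OF \<nu>])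
    \<comment> \<open>The conditioned measure is at most \<open>1 / b\<close> times
      \<open>\<mu>\<close>, so its energy is at most \<open>W / b^2\<close> and in particular
      finite.\<close>
    have pot_le: "potential s \<nu> x \<le> ennreal (1 / b) * potential s \<mu> x" for x
      unfolding potential_def by (subst int) (auto intro!: mult_left_mono nn_integral_mono simp: indicator_def)
    have "(\<integral>\<^sup>+x. potential s \<nu> x \<partial>\<nu>) \<le> ennreal (1 / b) * (\<integral>\<^sup>+x. potential s \<nu> x \<partial>\<mu>)"
      by (subst int) (auto intro!: mult_left_mono nn_integral_mono simp: indicator_def)
    also have "(\<integral>\<^sup>+x. potential s \<nu> x \<partial>\<mu>) \<le> ennreal (1 / b) * ennreal W"
      unfolding energy_\<mu>[symmetric] by (subst nn_integral_cmult[symmetric]) (auto intro!: nn_integral_mono pot_le)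
    also have "ennreal (1 / b) * (ennreal (1 / b) * ennreal W) < \<infinity>" by (simp add: ennreal_mult_less_top)
    finally have "(\<integral>\<^sup>+x. potential s \<nu> x \<partial>\<nu>) < \<infinity>" by (simp add: mult_left_mono)
    with \<nu> have "ennreal W \<le> (\<integral>\<^sup>+x. potential s \<mu> x \<partial>\<nu>)" by (rule first_variation)
    also have "\<dots> = ennreal (1 / b) * (\<integral>\<^sup>+x\<in>B. potential s \<mu> x \<partial>\<mu>)" by (rule int) measurable
    finally have "ennreal b * ennreal W \<le> ennreal b * (ennreal (1 / b) * (\<integral>\<^sup>+x\<in>B. potential s \<mu> x \<partial>\<mu>))"
      by (rule mult_left_mono) simp
    also have "\<dots> = (\<integral>\<^sup>+x\<in>B. potential s \<mu> x \<partial>\<mu>)"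
      using b(1) by (simp add: mult.assoc[symmetric] ennreal_mult'[symmetric])
    finally have ge: "ennreal b * ennreal W \<le> (\<integral>\<^sup>+x\<in>B. potential s \<mu> x \<partial>\<mu>)" .
    have "(\<integral>\<^sup>+x\<in>B. potential s \<mu> x \<partial>\<mu>) + (\<integral>\<^sup>+x\<in>B. (ennreal W - potential s \<mu> x) \<partial>\<mu>)
       = (\<integral>\<^sup>+x. ennreal W * indicator B x \<partial>\<mu>)"
      by (subst nn_integral_add[symmetric])
         (auto intro!: nn_integral_cong simp: indicator_def B_def add_diff_inverse_ennreal less_imp_le)
    also have "\<dots> = ennreal b * ennreal W" by (simp add: nn_integral_cmult_indicator b(2) mult.commute)
    finally have sum: "(\<integral>\<^sup>+x\<in>B. potential s \<mu> x \<partial>\<mu>) + (\<integral>\<^sup>+x\<in>B. (ennreal W - potential s \<mu> x) \<partial>\<mu>) = ennreal b * ennreal W" .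
    then have "(\<integral>\<^sup>+x\<in>B. potential s \<mu> x \<partial>\<mu>) + (\<integral>\<^sup>+x\<in>B. (ennreal W - potential s \<mu> x) \<partial>\<mu>)
       \<le> (\<integral>\<^sup>+x\<in>B. potential s \<mu> x \<partial>\<mu>) + 0" using ge by simp
    moreover have "(\<integral>\<^sup>+x\<in>B. potential s \<mu> x \<partial>\<mu>) \<noteq> \<infinity>"
    proof -
      have "(\<integral>\<^sup>+x\<in>B. potential s \<mu> x \<partial>\<mu>) \<le> ennreal b * ennreal W" unfolding sum[symmetric] by simp
      also have "\<dots> < \<infinity>" by (simp add: ennreal_mult_less_top)
      finally show ?thesis by simp
    qed
    ultimately have "(\<integral>\<^sup>+x\<in>B. (ennreal W - potential s \<mu> x) \<partial>\<mu>) = 0"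
      by (subst (asm) ennreal_add_left_cancel_le) auto
    then have "AE x in \<mu>. (ennreal W - potential s \<mu> x) * indicator B x = 0"
      by (subst (asm) nn_integral_0_iff_AE) auto
    \<comment> \<open>On \<open>B\<close> the difference \<open>W - potential s \<mu> x\<close> is
      positive, so its vanishing integral leaves no mass there.\<close>
    then have "AE x in \<mu>. x \<notin> B"
    proof eventually_elim
      case (elim x)
      then show ?case unfolding B_def by (auto simp: indicator_def dest!: ennreal_minus_eq_0 split: if_splits)
    qed
    then show False using nz by (subst (asm) AE_iff_measurable[OF _ refl]) (auto simp: space_\<mu>)
  qed
  then show ?thesis by (intro AE_I[of _ _ B]) (auto simp: B_def not_le)
qed

text \<open>The mean of the potential is \<open>W\<close>, and almost everywhere it is at least
  \<open>W\<close>.\<close>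

lemma potential_le_AE: "AE x in \<mu>. potential s \<mu> x \<le> ennreal W"
proof -
  have "ennreal W + (\<integral>\<^sup>+x. potential s \<mu> x - ennreal W \<partial>\<mu>) = (\<integral>\<^sup>+x. ennreal W + (potential s \<mu> x - ennreal W) \<partial>\<mu>)"
    by (subst nn_integral_add) (auto simp: emeasure_space_1)
  also have "\<dots> = (\<integral>\<^sup>+x. potential s \<mu> x \<partial>\<mu>)"
    using potential_ge_AE by (intro nn_integral_cong_AE) (auto elim!: eventually_mono simp: add_diff_inverse_ennreal)
  finally have "ennreal W + (\<integral>\<^sup>+x. potential s \<mu> x - ennreal W \<partial>\<mu>) \<le> ennreal W + 0"
    unfolding energy_\<mu> by simp
  then have "(\<integral>\<^sup>+x. potential s \<mu> x - ennreal W \<partial>\<mu>) = 0"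
    by (subst (asm) ennreal_add_left_cancel_le) auto
  then have "AE x in \<mu>. potential s \<mu> x - ennreal W = 0"
    by (subst (asm) nn_integral_0_iff_AE) auto
  then show ?thesis
    by eventually_elim (rule ennreal_minus_eq_0)
qed

text \<open>Constants are excessive, so domination by the constant \<open>W\<close> is a maximum
  principle.\<close>

lemma potential_le: "potential s \<mu> x \<le> ennreal W"
  using W_pos potential_le_AE borel_probs_onD[OF \<mu>] compact_imp_bounded[OF compact_A]
  by (intro domination_principle[where w = "\<lambda>_. ennreal W" and K = W and c = W and S = A])
     (auto simp: excessive_const)

end

section \<open>Separation of optimal configurations\<close>

context equilibrium
begin

section \<open>The equilibrium potential at points of regularity\<close>

text \<open>Let \<open>\<nu>\<close> be the regular measure \<open>\<eta>\<close> conditioned on the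
  ball of radius \<open>r\<close> about \<open>x\<close>. The first variation and symmetry bound
  \<open>W\<close> by the \<open>\<mu>\<close>-integral of the potential of \<open>\<nu>\<close>.
  Inside the ball of radius \<open>K r\<close> this contributes \<open>O(r powr (d - s))\<close>;
  outside, the potential of \<open>\<nu>\<close> is at most \<open>(1 - 1 / K) powr (- s)\<close>
  times the kernel at \<open>x\<close>. Let \<open>r\<close> tend to 0, then \<open>K\<close> to
  infinity.\<close>

lemma potential_ge_of_regular_at:
  assumes x: "x \<in> A" and reg: "regular_at l A x" and exponents: "s < d" "d \<le> l"
    and upper: "\<And>t. 0 < t \<Longrightarrow> measure \<mu> (ball x t) \<le> c * t powr d"
  shows "ennreal W \<le> potential s \<mu> x"
proof -
  obtain r\<^sub>1 where r1: "r\<^sub>1 > 0" "regular_set l (A \<inter> ball x r\<^sub>1)" using reg unfolding regular_at_def by auto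
  define E where "E = A \<inter> ball x r\<^sub>1"
  define D where "D = diameter E"
  have xE: "x \<in> E" using x r1 by (simp add: E_def)
  have D: "D > 0" using r1(2) unfolding regular_set_def D_def E_def by simp
  obtain \<eta> C\<^sub>0 where \<eta>: "finite_borel_measure \<eta>" "supported_on \<eta> E" and C0: "C\<^sub>0 > 0"
    and lo: "\<And>y r. y \<in> E \<Longrightarrow> 0 < r \<Longrightarrow> r < D \<Longrightarrow> inverse C\<^sub>0 * r powr l \<le> measure \<eta> (ball y r)"
    and up: "\<And>y r. y \<in> E \<Longrightarrow> 0 < r \<Longrightarrow> r < D \<Longrightarrow> measure \<eta> (ball y r) \<le> C\<^sub>0 * r powr l"
    using r1(2) unfolding regular_set_def D_def E_def by blast
  have fin: "finite_measure \<eta>" and sets_\<eta> [measurable_cong]: "sets \<eta> = sets borel" and ae: "AE y in \<eta>. y \<in> E"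
    using \<eta> by (auto simp: finite_borel_measure_def supported_on_def)
  interpret L: finite_measure \<eta> by fact
  have aeA: "AE y in \<eta>. y \<in> A" using ae by eventually_elim (simp add: E_def)
  have c: "c \<ge> 0" using order_trans[OF measure_nonneg upper[of 1]] by simp
  \<comment> \<open>The regularity bound is given for centres in \<open>E\<close> only. A ball that
    meets \<open>E\<close> lies in one of twice the radius centred in \<open>E\<close>, at the cost
    of \<open>2 powr l\<close>.\<close>
  have up': "measure \<eta> (ball y t) \<le> C\<^sub>0 * 2 powr l * t powr l" if t: "0 < t" "2 * t < D" for y t
  proof (cases "E \<inter> ball y t = {}")
    case True
    then have "AE z in \<eta>. z \<notin> ball y t" using ae by (auto elim!: eventually_mono)
    then have "emeasure \<eta> (ball y t) = 0" using AE_iff_null_sets[of "ball y t" \<eta>] by (auto simp: sets_\<eta>)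
    then show ?thesis using C0 by (simp add: measure_def)
  next
    case False
    then obtain x' where x': "x' \<in> E" "x' \<in> ball y t" by auto
    have "ball y t \<subseteq> ball x' (2 * t)"
    proof
      fix z assume "z \<in> ball y t"
      then show "z \<in> ball x' (2 * t)" using x'(2) dist_triangle[of x' z y] by (auto simp: dist_commute)
    qed
    then have "measure \<eta> (ball y t) \<le> measure \<eta> (ball x' (2 * t))" by (intro L.finite_measure_mono) auto
    also have "\<dots> \<le> C\<^sub>0 * (2 * t) powr l" using t x' by (intro up) auto
    finally show ?thesis using t by (simp add: powr_mult mult.assoc)
  qed
  define C\<^sub>1 where "C\<^sub>1 = C\<^sub>0 * 2 powr l * 2 powr s / (1 - 2 powr (s - l))"
  have C1: "C\<^sub>1 \<ge> 0" unfolding C\<^sub>1_def using C0 exponents powr_mono[of "s - l" 0 2] by (intro divide_nonneg_nonneg) auto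
  \<comment> \<open>The dyadic estimate for \<open>\<eta>\<close> with dimension
    \<open>l > s\<close>, uniform in the centre; \<open>C\<^sub>0 * 2 powr l\<close> plays the part
    of the upper regularity constant.\<close>
  have near: "(\<integral>\<^sup>+z\<in>ball y \<epsilon>. riesz_kernel s y z \<partial>\<eta>) \<le> ennreal (C\<^sub>1 * \<epsilon> powr (l - s))"
    if "0 < \<epsilon>" "2 * \<epsilon> < D" for y \<epsilon>
    unfolding C\<^sub>1_def using that C0 s_pos exponents by (intro near_potential_le fin sets_\<eta> up') auto
  define P where "P = enn2real (potential s \<mu> x)"
  have P: "potential s \<mu> x = ennreal P" "P \<ge> 0"
    using le_less_trans[OF potential_le[of x] ennreal_less_top] by (auto simp: P_def less_top)
  have bound: "W \<le> (1 - 1 / K) powr (- s) * P" if K: "K \<ge> 2" for K :: real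
  proof -
    define C\<^sub>2 where "C\<^sub>2 = C\<^sub>0 * C\<^sub>1 * (K + 1) powr (l - s)"
    have C2: "C\<^sub>2 \<ge> 0" using C0 C1 by (simp add: C\<^sub>2_def)
    define Q where "Q = (1 - 1 / K) powr (- s)"
    have step: "W \<le> C\<^sub>2 * c * K powr d * r powr (d - s) + Q * P" if r: "0 < r" "2 * ((K + 1) * r) < D" for r
    proof -
      define B where "B = ball x r"
      have [measurable]: "B \<in> sets borel" by (simp add: B_def)
      define b where "b = measure \<eta> B"
      define B' where "B' = ball x (K * r)"
      have [measurable]: "B' \<in> sets borel" by (simp add: B'_def)
      have "1 * r < (K + 1) * r" using K r(1) by (intro mult_strict_right_mono) auto
      moreover from this have "0 < (K + 1) * r" using r(1) by linarith
      ultimately have "r < (K + 1) * r" "0 < (K + 1) * r" by auto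
      then have rD: "r < D" using r by linarith
      have b: "inverse C\<^sub>0 * r powr l \<le> b" unfolding b_def B_def using xE r rD by (intro lo) auto
      moreover have "0 < inverse C\<^sub>0 * r powr l" using C0 r by simp
      ultimately have b0: "b > 0" by linarith
      obtain \<nu> where \<nu>: "\<nu> \<in> borel_probs_on A" and int: "\<And>f. f \<in> borel_measurable borel \<Longrightarrow>
          (\<integral>\<^sup>+y. f y \<partial>\<nu>) = ennreal (1 / b) * (\<integral>\<^sup>+y\<in>B. f y \<partial>\<eta>)"
        using normalized_restriction[OF fin sets_\<eta> A_borel \<open>B \<in> sets borel\<close> aeA] b0 unfolding b_def by blast
      have [measurable]: "potential s \<nu> \<in> borel_measurable borel"
        by (rule borel_measurable_potential) (auto simp: borel_probs_onD[OF \<nu>])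
      have pot: "potential s \<nu> y = ennreal (1 / b) * (\<integral>\<^sup>+z\<in>B. riesz_kernel s y z \<partial>\<eta>)" for y
        unfolding potential_def by (rule int) measurable
      \<comment> \<open>\<open>B\<close> lies in the ball of radius \<open>(K + 1) * r\<close> about
        \<open>y\<close>, and the lower regularity of \<open>\<eta>\<close> gives
        \<open>1 / b \<le> C\<^sub>0 * r powr (- l)\<close>; the powers of \<open>r\<close> combine
        to \<open>- s\<close>.\<close>
      have in_near: "potential s \<nu> y \<le> ennreal (C\<^sub>2 * r powr (- s))" if y: "y \<in> ball x (K * r)" for y
      proof -
        have "B \<subseteq> ball y ((K + 1) * r)"
        proof
          fix z assume "z \<in> B"
          then show "z \<in> ball y ((K + 1) * r)"
            using y dist_triangle[of y z x] by (auto simp: B_def dist_commute algebra_simps)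
        qed
        then have "(\<integral>\<^sup>+z\<in>B. riesz_kernel s y z \<partial>\<eta>) \<le> (\<integral>\<^sup>+z\<in>ball y ((K + 1) * r). riesz_kernel s y z \<partial>\<eta>)"
          by (intro nn_integral_mono) (auto simp: indicator_def)
        also have "\<dots> \<le> ennreal (C\<^sub>1 * ((K + 1) * r) powr (l - s))"
          using r \<open>0 < (K + 1) * r\<close> by (intro near)
        finally have "potential s \<nu> y \<le> ennreal (1 / b) * ennreal (C\<^sub>1 * ((K + 1) * r) powr (l - s))"
          unfolding pot by (rule mult_left_mono) simp
        also have "\<dots> \<le> ennreal (C\<^sub>0 * r powr (- l)) * ennreal (C\<^sub>1 * ((K + 1) * r) powr (l - s))"
        proof (intro mult_right_mono ennreal_leI)
          have "1 / b \<le> 1 / (inverse C\<^sub>0 * r powr l)"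
            using b C0 r b0 by (intro divide_left_mono) auto
          then show "1 / b \<le> C\<^sub>0 * r powr (- l)" using C0 by (simp add: powr_minus divide_inverse)
        qed simp
        also have "\<dots> = ennreal (C\<^sub>2 * (r powr (- l) * r powr (l - s)))"
          unfolding C\<^sub>2_def using C0 C1 K r by (simp add: ennreal_mult'[symmetric] powr_mult mult_ac)
        also have "r powr (- l) * r powr (l - s) = r powr (- s)" by (simp add: powr_add[symmetric])
        finally show ?thesis .
      qed
      \<comment> \<open>For \<open>y\<close> outside the ball of radius \<open>K r\<close>, every
        point of \<open>B\<close> is at distance at least \<open>(1 - 1 / K) * dist x y\<close> from
        \<open>y\<close>.\<close>
      have in_far: "potential s \<nu> y \<le> ennreal Q * riesz_kernel s x y" if y: "y \<notin> ball x (K * r)" for y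
      proof -
        have le: "riesz_kernel s y z \<le> ennreal Q * riesz_kernel s x y" if z: "z \<in> B" for z
        proof -
          have dxy: "K * r \<le> dist x y" using y by simp
          then have "r \<le> dist x y / K" using K by (simp add: field_simps)
          then have dd: "(1 - 1 / K) * dist x y \<le> dist y z"
            using z dist_triangle[of x y z] by (simp add: B_def dist_commute algebra_simps)
          have "0 < K * r" using K r by simp
          then have pos: "0 < dist x y" using dxy by linarith
          have pos': "0 < (1 - 1 / K) * dist x y" using pos K by (intro mult_pos_pos) (auto simp: field_simps)
          have "dist y z powr (- s) \<le> ((1 - 1 / K) * dist x y) powr (- s)"
            using dd pos' s_pos by (intro powr_mono2') auto
          also have "\<dots> = Q * dist x y powr (- s)" using K by (simp add: powr_mult Q_def)
          finally show ?thesis using pos pos' dd unfolding riesz_kernel_def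
            by (auto simp: ennreal_mult'[symmetric] Q_def intro!: ennreal_leI)
        qed
        have "potential s \<nu> y \<le> ennreal (1 / b) * (\<integral>\<^sup>+z\<in>B. ennreal Q * riesz_kernel s x y \<partial>\<eta>)"
          unfolding pot by (intro mult_left_mono nn_integral_mono) (auto simp: indicator_def le)
        also have "\<dots> = ennreal (1 / b) * (ennreal Q * riesz_kernel s x y * ennreal b)"
          by (simp add: nn_integral_cmult_indicator L.emeasure_eq_measure b_def)
        also have "\<dots> = (ennreal (1 / b) * ennreal b) * (ennreal Q * riesz_kernel s x y)" by (simp add: mult_ac)
        also have "ennreal (1 / b) * ennreal b = 1" using b0 by (simp add: ennreal_mult'[symmetric])
        finally show ?thesis by simp
      qed
      have "(\<integral>\<^sup>+y. potential s \<nu> y \<partial>\<nu>) \<le> ennreal (1 / b) * (\<integral>\<^sup>+y\<in>B. ennreal (C\<^sub>2 * r powr (- s)) \<partial>\<eta>)"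
      proof (subst int)
        have "1 * r \<le> K * r" using K r(1) by (intro mult_right_mono) auto
        then have "B \<subseteq> ball x (K * r)" unfolding B_def by (intro subset_ball) simp
        then show "ennreal (1 / b) * (\<integral>\<^sup>+y\<in>B. potential s \<nu> y \<partial>\<eta>) \<le> ennreal (1 / b) * (\<integral>\<^sup>+y\<in>B. ennreal (C\<^sub>2 * r powr (- s)) \<partial>\<eta>)"
          by (intro mult_left_mono nn_integral_mono) (auto simp: indicator_def in_near)
      qed simp
      also have "\<dots> < \<infinity>"
        by (simp add: nn_integral_cmult_indicator L.emeasure_eq_measure ennreal_mult_less_top)
      \<comment> \<open>The first variation asks for finite energy of \<open>\<nu>\<close>, which
        the near bound provides on \<open>B\<close>.\<close>
      finally have "ennreal W \<le> (\<integral>\<^sup>+y. potential s \<mu> y \<partial>\<nu>)" by (intro first_variation \<nu>)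
      also have "\<dots> = (\<integral>\<^sup>+y. potential s \<nu> y \<partial>\<mu>)"
        by (rule nn_integral_potential_commute) (auto simp: borel_probs_onD[OF \<nu>] sets_\<mu> finite_measure_axioms)
      also have "\<dots> \<le> (\<integral>\<^sup>+y. ennreal (C\<^sub>2 * r powr (- s)) * indicator B' y + ennreal Q * riesz_kernel s x y \<partial>\<mu>)"
      proof (rule nn_integral_mono)
        fix y show "potential s \<nu> y \<le> ennreal (C\<^sub>2 * r powr (- s)) * indicator B' y + ennreal Q * riesz_kernel s x y"
          using in_near[of y] in_far[of y] by (cases "y \<in> B'") (auto simp: B'_def intro: add_increasing2)
      qed
      also have "\<dots> = ennreal (C\<^sub>2 * r powr (- s)) * emeasure \<mu> B' + ennreal Q * potential s \<mu> x"
      proof -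
        have "(\<integral>\<^sup>+y. ennreal (C\<^sub>2 * r powr (- s)) * indicator B' y + ennreal Q * riesz_kernel s x y \<partial>\<mu>)
          = (\<integral>\<^sup>+y. ennreal (C\<^sub>2 * r powr (- s)) * indicator B' y \<partial>\<mu>) + (\<integral>\<^sup>+y. ennreal Q * riesz_kernel s x y \<partial>\<mu>)"
          by (rule nn_integral_add) measurable
        also have "(\<integral>\<^sup>+y. ennreal (C\<^sub>2 * r powr (- s)) * indicator B' y \<partial>\<mu>) = ennreal (C\<^sub>2 * r powr (- s)) * emeasure \<mu> B'"
          by (rule nn_integral_cmult_indicator) measurable
        also have "(\<integral>\<^sup>+y. ennreal Q * riesz_kernel s x y \<partial>\<mu>) = ennreal Q * potential s \<mu> x"
          unfolding potential_def by (rule nn_integral_cmult) measurable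
        finally show ?thesis .
      qed
      also have "\<dots> = ennreal (C\<^sub>2 * r powr (- s) * measure \<mu> B' + Q * P)"
        using C2 P by (simp add: emeasure_eq_measure ennreal_mult'[symmetric] ennreal_plus[symmetric] Q_def del: ennreal_plus)
      finally have "W \<le> C\<^sub>2 * r powr (- s) * measure \<mu> B' + Q * P"
        using C2 P by (subst (asm) ennreal_le_iff) (auto simp: Q_def)
      also have "C\<^sub>2 * r powr (- s) * measure \<mu> B' \<le> C\<^sub>2 * r powr (- s) * (c * (K * r) powr d)"
        unfolding B'_def using C2 K r by (intro mult_left_mono upper) auto
      also have "C\<^sub>2 * r powr (- s) * (c * (K * r) powr d) = C\<^sub>2 * c * K powr d * (r powr d * r powr (- s))"
        using K r by (simp add: powr_mult mult_ac)
      also have "r powr d * r powr (- s) = r powr (d - s)" by (simp add: powr_add[symmetric])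
      finally show ?thesis by simp
    qed
    \<comment> \<open>With \<open>K\<close> fixed, the near part disappears as \<open>r\<close>
      tends to 0 because \<open>s < d\<close>; its limit is
      \<open>0 powr (d - s) = 0\<close>.\<close>
    have "((\<lambda>r. C\<^sub>2 * c * K powr d * r powr (d - s) + Q * P) \<longlongrightarrow> C\<^sub>2 * c * K powr d * 0 powr (d - s) + Q * P) (at_right 0)"
    proof (intro tendsto_add tendsto_mult tendsto_const tendsto_powr' tendsto_ident_at)
      have "eventually (\<lambda>r::real. 0 \<le> r) (at_right 0)"
        by (rule eventually_at_rightI[of 0 1]) auto
      then show "(0::real) \<noteq> 0 \<or> 0 < d - s \<and> (eventually (\<lambda>r::real. 0 \<le> r) (at_right 0))"
        using exponents by simp
    qed
    moreover have "eventually (\<lambda>r. W \<le> C\<^sub>2 * c * K powr d * r powr (d - s) + Q * P) (at_right 0)"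
    proof (rule eventually_at_rightI[of 0 "D / (2 * (K + 1))"])
      show "0 < D / (2 * (K + 1))" using D K by simp
      show "W \<le> C\<^sub>2 * c * K powr d * r powr (d - s) + Q * P" if "r \<in> {0<..<D / (2 * (K + 1))}" for r
        using that K by (intro step) (auto simp: field_simps)
    qed
    ultimately have "W \<le> C\<^sub>2 * c * K powr d * 0 powr (d - s) + Q * P"
      by (intro tendsto_lowerbound) auto
    then show ?thesis by (simp add: Q_def)
  qed
  \<comment> \<open>Now \<open>K = n + 1\<close> tends to infinity; \<open>K \<ge> 2\<close> holds
    from \<open>n = 1\<close> on.\<close>
  have "(\<lambda>n. 1 / real (Suc n)) \<longlonglongrightarrow> 0" using LIMSEQ_inverse_real_of_nat by (simp add: inverse_eq_divide)
  then have "(\<lambda>n. (1 - 1 / real (Suc n)) powr (- s) * P) \<longlonglongrightarrow> (1 - 0) powr (- s) * P"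
    by (intro tendsto_intros) auto
  moreover have "\<exists>N. \<forall>n\<ge>N. W \<le> (1 - 1 / real (Suc n)) powr (- s) * P"
    by (intro exI[of _ 1] allI impI bound) auto
  ultimately have "W \<le> (1 - 0) powr (- s) * P" by (rule LIMSEQ_le_const)
  then show ?thesis using P by (simp add: ennreal_leI)
qed

section \<open>Optimal configurations and the potential of the remaining points\<close>

text \<open>The potential is bounded by \<open>W\<close> everywhere. On a finite \<open>A\<close>
  the sum of the kernels at its points would be infinite almost everywhere, yet have a finite
  integral.\<close>

lemma infinite_A: "infinite A"
proof
  assume fin: "finite A"
  have "(\<integral>\<^sup>+y. (\<Sum>z\<in>A. riesz_kernel s z y) \<partial>\<mu>) = (\<Sum>z\<in>A. potential s \<mu> z)"
    unfolding potential_def by (rule nn_integral_sum) measurable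
  also have "\<dots> \<le> (\<Sum>z\<in>A. ennreal W)" by (intro sum_mono potential_le)
  also have "\<dots> < \<infinity>" using fin by (simp add: ennreal_mult_less_top of_nat_less_top)
  finally have *: "(\<integral>\<^sup>+y. (\<Sum>z\<in>A. riesz_kernel s z y) \<partial>\<mu>) < \<infinity>" .
  have "AE y in \<mu>. (\<Sum>z\<in>A. riesz_kernel s z y) = \<infinity>"
    using borel_probs_onD(4)[OF \<mu>]
  proof eventually_elim
    case (elim y)
    then have "riesz_kernel s y y \<le> (\<Sum>z\<in>A. riesz_kernel s z y)" using fin by (intro member_le_sum[of y A "\<lambda>z. riesz_kernel s z y"]) auto
    then show ?case by (simp add: riesz_kernel_def top_unique)
  qed
  then have "(\<integral>\<^sup>+y. (\<Sum>z\<in>A. riesz_kernel s z y) \<partial>\<mu>) = (\<integral>\<^sup>+y. \<infinity> \<partial>\<mu>)" by (rule nn_integral_cong_AE)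
  then show False using * by (simp add: emeasure_space_1)
qed

text \<open>An injective sequence in \<open>A\<close> supplies a competitor without repetitions.
  Finiteness is what later permits cancelling common terms and excludes coinciding points.\<close>

lemma optimal_energy_finite:
  assumes "optimal_config s A N x"
  shows "config_energy s N x < \<infinity>"
proof -
  obtain f :: "nat \<Rightarrow> 'a" where f: "inj f" "range f \<subseteq> A" using infinite_countable_subset[OF infinite_A] by auto
  then have "config_energy s N x \<le> config_energy s N f"
    using assms unfolding optimal_config_def point_config_def by blast
  also have "\<dots> < \<infinity>"
    unfolding config_energy_def infinity_ennreal_def
    using f(1) by (auto simp: ennreal_sum_less_top riesz_kernel_def inj_eq)
  finally show ?thesis .
qed

end

text \<open>By symmetry each pair containing the point \<open>z j\<close> is counted twice. The
  second sum does not involve \<open>z j\<close>, so moving this point alone affects only the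
  first.\<close>

lemma config_energy_split:
  assumes "j \<in> {1..N}"
  shows "config_energy s N z = 2 * (\<Sum>i\<in>{1..N} - {j}. riesz_kernel s (z j) (z i))
     + (\<Sum>i\<in>{1..N} - {j}. \<Sum>i'\<in>{1..N} - {j} - {i}. riesz_kernel s (z i) (z i'))"
proof -
  have "config_energy s N z = (\<Sum>i\<in>{1..N} - {j}. riesz_kernel s (z j) (z i))
     + (\<Sum>i\<in>{1..N} - {j}. \<Sum>i'\<in>{1..N} - {i}. riesz_kernel s (z i) (z i'))"
    unfolding config_energy_def using assms by (intro sum.remove) auto
  also have "(\<Sum>i\<in>{1..N} - {j}. \<Sum>i'\<in>{1..N} - {i}. riesz_kernel s (z i) (z i'))
     = (\<Sum>i\<in>{1..N} - {j}. riesz_kernel s (z j) (z i) + (\<Sum>i'\<in>{1..N} - {j} - {i}. riesz_kernel s (z i) (z i')))"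
  proof (rule sum.cong)
    fix i assume i: "i \<in> {1..N} - {j}"
    have "{1..N} - {j} - {i} = {1..N} - {i} - {j}" by auto
    then show "(\<Sum>i'\<in>{1..N} - {i}. riesz_kernel s (z i) (z i'))
      = riesz_kernel s (z j) (z i) + (\<Sum>i'\<in>{1..N} - {j} - {i}. riesz_kernel s (z i) (z i'))"
      using assms i by (subst sum.remove[of _ j]) (auto simp: riesz_kernel_commute)
  qed simp
  finally show ?thesis by (simp add: sum.distrib mult_2 add.assoc)
qed

context equilibrium
begin

text \<open>Replacing \<open>x j\<close> by \<open>y\<close> keeps the interaction \<open>R\<close>
  of the other points, which is finite and cancels.\<close>

lemma optimal_point_minimizes:
  assumes opt: "optimal_config s A N x" and j: "j \<in> {1..N}" and y: "y \<in> A"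
  shows "(\<Sum>i\<in>{1..N} - {j}. riesz_kernel s (x j) (x i)) \<le> (\<Sum>i\<in>{1..N} - {j}. riesz_kernel s y (x i))"
proof -
  define R where "R = (\<Sum>i\<in>{1..N} - {j}. \<Sum>i'\<in>{1..N} - {j} - {i}. riesz_kernel s (x i) (x i'))"
  have "point_config A N (x(j := y))"
    using opt y unfolding optimal_config_def point_config_def by auto
  then have "config_energy s N x \<le> config_energy s N (x(j := y))" using opt unfolding optimal_config_def by blast
  moreover have "(\<Sum>i\<in>{1..N} - {j}. riesz_kernel s ((x(j := y)) j) ((x(j := y)) i)) = (\<Sum>i\<in>{1..N} - {j}. riesz_kernel s y (x i))"
    by (intro sum.cong) auto
  moreover have "(\<Sum>i\<in>{1..N} - {j}. \<Sum>i'\<in>{1..N} - {j} - {i}. riesz_kernel s ((x(j := y)) i) ((x(j := y)) i')) = R"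
    unfolding R_def by (intro sum.cong) auto
  ultimately have le: "2 * (\<Sum>i\<in>{1..N} - {j}. riesz_kernel s (x j) (x i)) + R \<le> 2 * (\<Sum>i\<in>{1..N} - {j}. riesz_kernel s y (x i)) + R"
    by (simp only: config_energy_split[OF j] R_def[symmetric])
  have "R \<le> config_energy s N x" unfolding config_energy_split[OF j] R_def by simp
  then have "R < \<infinity>" using optimal_energy_finite[OF opt] by simp
  then have "2 * (\<Sum>i\<in>{1..N} - {j}. riesz_kernel s (x j) (x i)) \<le> 2 * (\<Sum>i\<in>{1..N} - {j}. riesz_kernel s y (x i))"
    using le by (subst (asm) (1 2) add.commute, subst (asm) ennreal_add_left_cancel_le) auto
  then show ?thesis by (subst (asm) ennreal_mult_le_mult_iff) auto
qed

text \<open>A minimum over \<open>A\<close> is at most the \<open>\<mu>\<close>-average, and each of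
  the \<open>N - 1\<close> points contributes at most \<open>W\<close> to that average.\<close>

lemma optimal_point_potential_le:
  assumes opt: "optimal_config s A N x" and j: "j \<in> {1..N}"
  shows "(\<Sum>i\<in>{1..N} - {j}. riesz_kernel s (x j) (x i)) \<le> ennreal (real N * W)"
proof -
  define M where "M = (\<Sum>i\<in>{1..N} - {j}. riesz_kernel s (x j) (x i))"
  have "M = (\<integral>\<^sup>+y. M \<partial>\<mu>)" by (simp add: emeasure_space_1)
  also have "\<dots> \<le> (\<integral>\<^sup>+y. (\<Sum>i\<in>{1..N} - {j}. riesz_kernel s (x i) y) \<partial>\<mu>)"
  proof (rule nn_integral_mono_AE)
    show "AE y in \<mu>. M \<le> (\<Sum>i\<in>{1..N} - {j}. riesz_kernel s (x i) y)"
      using borel_probs_onD(4)[OF \<mu>]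
    proof eventually_elim
      case (elim y)
      have "(\<Sum>i\<in>{1..N} - {j}. riesz_kernel s (x i) y) = (\<Sum>i\<in>{1..N} - {j}. riesz_kernel s y (x i))"
        by (intro sum.cong refl riesz_kernel_commute)
      then show ?case using optimal_point_minimizes[OF opt j elim] unfolding M_def by simp
    qed
  qed
  also have "\<dots> = (\<Sum>i\<in>{1..N} - {j}. potential s \<mu> (x i))"
    unfolding potential_def by (rule nn_integral_sum) measurable
  also have "\<dots> \<le> (\<Sum>i\<in>{1..N} - {j}. ennreal W)" by (intro sum_mono potential_le)
  also have "\<dots> = ennreal (real (N - 1) * W)"
    using j W_pos by (simp add: ennreal_mult' ennreal_of_nat_eq_real_of_nat)
  also have "\<dots> \<le> ennreal (real N * W)" using W_pos by (intro ennreal_leI mult_right_mono) auto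
  finally show ?thesis unfolding M_def .
qed

section \<open>Separation of the points\<close>

text \<open>The constant depends on \<open>s\<close>, \<open>d\<close> and \<open>c\<close> alone:
  \<open>W\<close> drops out because the comparison measure carries the factor
  \<open>m / W \<le> N\<close>.\<close>

lemma optimal_separation:
  assumes opt: "optimal_config s A N x" and j: "j \<in> {1..N}" and k: "k \<in> {1..N}" "k \<noteq> j"
    and W_le: "ennreal W \<le> potential s \<mu> (x j)" and d: "s < d"
    and upper: "\<And>t. 0 < t \<Longrightarrow> measure \<mu> (ball (x j) t) \<le> c * t powr d"
  shows "(2 powr s + c * 2 powr s / (1 - 2 powr (s - d))) powr (- 1 / s) * real N powr (- 1 / d) \<le> dist (x j) (x k)"
proof -
  define a where "a = x j"
  define b where "b = x k"
  define r where "r = dist a b"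
  define c' where "c' = c * 2 powr s / (1 - 2 powr (s - d))"
  define \<epsilon> where "\<epsilon> = real N powr (- 1 / d)"
  \<comment> \<open>Chosen so that \<open>q powr (- s)\<close> is the coefficient of
    \<open>\<epsilon> powr (- s)\<close> in the final estimate; \<open>2 powr s\<close> accounts for
    the bound on the contribution of \<open>b\<close>, \<open>c'\<close> for the mass of
    \<open>\<mu>\<close> near \<open>a\<close>.\<close>
  define q where "q = (2 powr s + c') powr (- 1 / s)"
  have N: "real N > 0" using j by auto
  have d0: "d > 0" using s_pos d by simp
  have \<epsilon>: "\<epsilon> > 0" using N by (simp add: \<epsilon>_def)
  have N\<epsilon>: "real N = \<epsilon> powr (- d)" using N d0 by (simp add: \<epsilon>_def powr_powr)
  have c: "c \<ge> 0" using order_trans[OF measure_nonneg upper[of 1]] by simp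
  have c': "c' \<ge> 0" unfolding c'_def using c d powr_mono[of "s - d" 0 2] by (intro divide_nonneg_nonneg) auto
  have "0 < (2::real) powr s" by simp
  then have S: "0 < 2 powr s + c'" using c' by linarith
  have q: "q > 0" using S by (simp add: q_def)
  have q_powr: "q powr (- s) = 2 powr s + c'" using S s_pos by (simp add: q_def powr_powr)
  have q_half: "q \<le> 1 / 2"
  proof -
    have "q \<le> (2 powr s) powr (- 1 / s)" unfolding q_def using c' s_pos by (intro powr_mono2') auto
    also have "\<dots> = 1 / 2" using s_pos by (simp add: powr_powr powr_minus_divide)
    finally show ?thesis .
  qed
  have "q * \<epsilon> \<le> r"
  \<comment> \<open>For \<open>r \<ge> \<epsilon> / 2\<close> the claim is immediate from
    \<open>q \<le> 1 / 2\<close>.\<close>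
  proof (cases "\<epsilon> / 2 \<le> r")
    case True
    have "q * \<epsilon> \<le> 1 / 2 * \<epsilon>" using q_half \<epsilon> by (intro mult_right_mono) auto
    then show ?thesis using True by simp
  next
    case False
    define M where "M = (\<Sum>i\<in>{1..N} - {j}. riesz_kernel s a (x i))"
    define F' where "F' y = (\<Sum>i\<in>{1..N} - {j} - {k}. riesz_kernel s y (x i))" for y
    have F_split: "(\<Sum>i\<in>{1..N} - {j}. riesz_kernel s y (x i)) = riesz_kernel s y b + F' y" for y
      unfolding F'_def b_def using k by (intro sum.remove) auto
    have M_le: "M \<le> ennreal (real N * W)" unfolding M_def a_def by (rule optimal_point_potential_le[OF opt j])
    define m where "m = enn2real M"
    have m: "M = ennreal m" "m \<ge> 0" "m \<le> real N * W"
    proof -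
      show "M = ennreal m" using le_less_trans[OF M_le ennreal_less_top] by (simp add: m_def less_top)
      then show "m \<le> real N * W" using M_le N W_pos by (simp add: ennreal_le_iff)
    qed (simp add: m_def)
    have M_split: "M = riesz_kernel s a b + F' a" unfolding M_def by (rule F_split)
    have F'_fin: "F' a < \<infinity>" using m(1) M_split by (metis ennreal_less_top infinity_ennreal_def le_iff_add add.commute le_less_trans)
    have "riesz_kernel s a b < \<infinity>" using m(1) M_split by (metis ennreal_less_top infinity_ennreal_def le_iff_add le_less_trans)
    then have ab: "a \<noteq> b" by (auto simp: riesz_kernel_def)
    then have r0: "r > 0" by (simp add: r_def)
    define \<sigma> where "\<sigma> = density \<mu> (\<lambda>z. ennreal (m / W) * indicator (- ball a \<epsilon>) z)"
    have sets_\<sigma>: "sets \<sigma> = sets borel" by (simp add: \<sigma>_def sets_\<mu>)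
    have int: "(\<integral>\<^sup>+z. f z \<partial>\<sigma>) = ennreal (m / W) * (\<integral>\<^sup>+z\<in>- ball a \<epsilon>. f z \<partial>\<mu>)" if [measurable]: "f \<in> borel_measurable borel" for f
    proof -
      have "(\<integral>\<^sup>+z. f z \<partial>\<sigma>) = (\<integral>\<^sup>+z. ennreal (m / W) * (f z * indicator (- ball a \<epsilon>) z) \<partial>\<mu>)"
        unfolding \<sigma>_def by (subst nn_integral_density) (auto simp: mult_ac)
      also have "\<dots> = ennreal (m / W) * (\<integral>\<^sup>+z\<in>- ball a \<epsilon>. f z \<partial>\<mu>)" by (rule nn_integral_cmult) measurable
      finally show ?thesis .
    qed
    have fin_\<sigma>: "finite_measure \<sigma>"
    proof (rule finite_measureI)
      have "emeasure \<sigma> (space \<sigma>) = ennreal (m / W) * emeasure \<mu> (- ball a \<epsilon>)"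
        using int[of "\<lambda>_. 1"] by (simp add: sets_\<mu>)
      then show "emeasure \<sigma> (space \<sigma>) \<noteq> \<infinity>" by (simp add: emeasure_eq_measure ennreal_mult_eq_top_iff)
    qed
    have pot_\<sigma>: "potential s \<sigma> y = ennreal (m / W) * (\<integral>\<^sup>+z\<in>- ball a \<epsilon>. riesz_kernel s y z \<partial>\<mu>)" for y
      unfolding potential_def by (rule int) measurable
    have scale: "ennreal (m / W) * ennreal W = M" using m W_pos by (simp add: ennreal_mult'[symmetric])
    have pot_le_M: "potential s \<sigma> y \<le> M" for y
    proof -
      have "potential s \<sigma> y \<le> ennreal (m / W) * potential s \<mu> y"
        unfolding pot_\<sigma> unfolding potential_def by (intro mult_left_mono nn_integral_mono) (auto simp: indicator_def)
      also have "\<dots> \<le> ennreal (m / W) * ennreal W" by (intro mult_left_mono potential_le) simp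
      finally show ?thesis unfolding scale .
    qed
    define c\<^sub>0 where "c\<^sub>0 = (\<epsilon> / 2) powr (- s)"
    have c0: "c\<^sub>0 > 0" using \<epsilon> by (simp add: c\<^sub>0_def)
    have ae_\<sigma>: "AE z in \<sigma>. z \<in> A \<and> z \<notin> ball a \<epsilon>"
    proof -
      have "AE z in \<mu>. 0 < ennreal (m / W) * indicator (- ball a \<epsilon>) z \<longrightarrow> z \<in> A \<and> z \<notin> ball a \<epsilon>"
        using borel_probs_onD(4)[OF \<mu>] by eventually_elim (auto simp: indicator_def)
      then show ?thesis unfolding \<sigma>_def by (subst AE_density) auto
    qed
    \<comment> \<open>The bound \<open>(\<epsilon> / 2) powr (- s)\<close> for the contribution of
      \<open>b\<close> also serves as the positive constant that the domination principle
      requires.\<close>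
    have dom: "potential s \<sigma> a \<le> ennreal c\<^sub>0 + F' a"
    proof (rule domination_principle[OF fin_\<sigma> sets_\<sigma> compact_imp_bounded[OF compact_A]])
      show "AE z in \<sigma>. z \<in> A" using ae_\<sigma> by eventually_elim simp
      show "AE z in \<sigma>. potential s \<sigma> z \<le> ennreal m" using pot_le_M m(1) by simp
      show "excessive (\<lambda>y. ennreal c\<^sub>0 + F' y)"
        unfolding F'_def by (intro excessive_add excessive_const excessive_sum excessive_kernel) simp
      show "0 < c\<^sub>0" by fact
      show "ennreal c\<^sub>0 \<le> ennreal c\<^sub>0 + F' y" for y by simp
      show "AE z in \<sigma>. potential s \<sigma> z \<le> ennreal c\<^sub>0 + F' z"
        using ae_\<sigma>
      proof eventually_elim
        case (elim z)
        have "M \<le> riesz_kernel s z b + F' z"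
          unfolding M_def a_def F_split[symmetric] using opt j elim by (intro optimal_point_minimizes) auto
        moreover have "riesz_kernel s z b \<le> ennreal c\<^sub>0"
        proof -
          have "\<epsilon> \<le> dist a z" using elim by simp
          then have far: "\<epsilon> / 2 \<le> dist z b"
            using False dist_triangle[of a z b] by (simp add: r_def dist_commute)
          then have "dist z b powr (- s) \<le> c\<^sub>0" unfolding c\<^sub>0_def using \<epsilon> s_pos by (intro powr_mono2') auto
          then show ?thesis using far \<epsilon> by (auto simp: riesz_kernel_def intro: ennreal_leI)
        qed
        ultimately show ?case using pot_le_M[of z] by (meson add_right_mono order_trans)
      qed
    qed
    have near: "(\<integral>\<^sup>+z\<in>ball a \<epsilon>. riesz_kernel s a z \<partial>\<mu>) \<le> ennreal (c' * \<epsilon> powr (d - s))"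
      unfolding c'_def a_def using c d s_pos \<epsilon> upper
      by (intro near_potential_le sets_\<mu> finite_measure_axioms) auto
    \<comment> \<open>Here the lower bound \<open>W\<close> for the equilibrium potential at the
      point \<open>a\<close> itself enters; \<open>F' a\<close> then occurs on both sides and, being
      finite, cancels.\<close>
    have "riesz_kernel s a b + F' a = ennreal (m / W) * ennreal W" unfolding scale M_split ..
    also have "\<dots> \<le> ennreal (m / W) * potential s \<mu> a" using W_le unfolding a_def by (intro mult_left_mono) auto
    also have "potential s \<mu> a = (\<integral>\<^sup>+z\<in>- ball a \<epsilon>. riesz_kernel s a z \<partial>\<mu>) + (\<integral>\<^sup>+z\<in>ball a \<epsilon>. riesz_kernel s a z \<partial>\<mu>)"
      unfolding potential_def by (subst nn_integral_add[symmetric]) (auto intro!: nn_integral_cong simp: indicator_def)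
    also have "ennreal (m / W) * \<dots> = potential s \<sigma> a + ennreal (m / W) * (\<integral>\<^sup>+z\<in>ball a \<epsilon>. riesz_kernel s a z \<partial>\<mu>)"
      unfolding pot_\<sigma> by (rule distrib_left)
    also have "\<dots> \<le> (ennreal c\<^sub>0 + F' a) + ennreal (real N) * ennreal (c' * \<epsilon> powr (d - s))"
      using m W_pos by (intro add_mono dom mult_mono near ennreal_leI) (auto simp: field_simps)
    also have "\<dots> = F' a + ennreal (c\<^sub>0 + real N * (c' * \<epsilon> powr (d - s)))"
      using c0 c' by (simp add: ennreal_mult'[symmetric] ennreal_plus[symmetric] ac_simps del: ennreal_plus)
    finally have "riesz_kernel s a b \<le> ennreal (c\<^sub>0 + real N * (c' * \<epsilon> powr (d - s)))"
      using F'_fin by (subst (asm) add.commute, subst (asm) ennreal_add_left_cancel_le) auto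
    then have "r powr (- s) \<le> c\<^sub>0 + real N * (c' * \<epsilon> powr (d - s))"
      using ab c0 c' by (simp add: r_def ennreal_le_iff riesz_kernel_def del: ennreal_plus)
    also have "c\<^sub>0 = 2 powr s * \<epsilon> powr (- s)"
      unfolding c\<^sub>0_def by (simp add: powr_divide powr_minus_divide)
    also have "real N * (c' * \<epsilon> powr (d - s)) = c' * (\<epsilon> powr (- d) * \<epsilon> powr (d - s))" unfolding N\<epsilon> by simp
    also have "\<epsilon> powr (- d) * \<epsilon> powr (d - s) = \<epsilon> powr (- s)" by (simp add: powr_add[symmetric])
    also have "2 powr s * \<epsilon> powr (- s) + c' * \<epsilon> powr (- s) = (q * \<epsilon>) powr (- s)"
      using q \<epsilon> by (simp add: powr_mult q_powr algebra_simps)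
    finally have le: "r powr (- s) \<le> (q * \<epsilon>) powr (- s)" .
    show ?thesis
    proof (rule ccontr)
      assume "\<not> ?thesis"
      then have "(q * \<epsilon>) powr (- s) < r powr (- s)" using r0 s_pos by (intro powr_less_mono2_neg) auto
      then show False using le by simp
    qed
  qed
  then show ?thesis unfolding q_def \<epsilon>_def r_def a_def b_def c'_def by simp
qed

end

section \<open>The separation theorem\<close>

text \<open>On a bounded set the kernel has a positive lower bound. Positivity of the Wiener
  constant allows dividing by \<open>W\<close>.\<close>

lemma (in riesz) riesz_energy_pos:
  assumes "bounded A" and \<mu>: "\<mu> \<in> borel_probs_on (A :: 'a set)"
  shows "0 < riesz_energy s A \<mu>"
proof -
  interpret prob_space \<mu> using \<mu> by (rule borel_probs_onD)
  obtain e where e: "\<And>x y. x \<in> A \<Longrightarrow> y \<in> A \<Longrightarrow> dist x y \<le> e" using assms(1) unfolding bounded_two_points by auto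
  \<comment> \<open>\<open>max e 1\<close> keeps \<open>k\<close> positive also when
    \<open>e\<close> is 0, where \<open>powr\<close> would give 0.\<close>
  define k where "k = max e 1 powr (- s)"
  have k: "ennreal k \<le> riesz_kernel s x y" if "x \<in> A" "y \<in> A" for x y
    using e[OF that] s_pos unfolding riesz_kernel_def k_def by (auto intro!: ennreal_leI powr_mono2')
  have ae: "AE x in \<mu>. x \<in> A" using \<mu> by (rule borel_probs_onD)
  have "ennreal k = (\<integral>\<^sup>+x. (\<integral>\<^sup>+y. ennreal k \<partial>\<mu>) \<partial>\<mu>)" by (simp add: emeasure_space_1)
  also have "\<dots> \<le> (\<integral>\<^sup>+x. potential s \<mu> x \<partial>\<mu>)"
  proof (rule nn_integral_mono_AE)
    show "AE x in \<mu>. (\<integral>\<^sup>+y. ennreal k \<partial>\<mu>) \<le> potential s \<mu> x"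
      using ae
    proof eventually_elim
      case (elim x)
      show ?case unfolding potential_def using ae
        by (intro nn_integral_mono_AE) (auto elim!: eventually_mono intro: k elim)
    qed
  qed
  finally have "ennreal k \<le> riesz_energy s A \<mu>" unfolding riesz_energy_eq[OF \<mu>] .
  moreover have "0 < k" by (simp add: k_def)
  ultimately show ?thesis by (metis ennreal_less_zero_iff less_le_trans)
qed

theorem theorem2p3:
  fixes A A' :: "(real ^ 'n) set"
    and s d l c :: real
    and cc :: "real ^ 'n \<Rightarrow> real"
    and \<mu>\<^sub>s :: "(real ^ 'n) measure"
  assumes "compact A"
    and "0 \<le> real CARD('n) - 2" and "real CARD('n) - 2 < s"
    and "s < d" and "d \<le> l" and "l \<le> real CARD('n)"
    and "0 < riesz_capacity s A"
    and "equilibrium_measure s A \<mu>\<^sub>s"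
    and "A' \<subseteq> A"
    and "\<forall>x\<in>A'. regular_at l A x"
    and "\<forall>x\<in>A'. upper_regular_at d \<mu>\<^sub>s x (cc x)"
    and "0 < c" and "\<forall>x\<in>A'. cc x \<le> c"
  shows "\<exists>C>0. \<forall>N\<ge>2. \<forall>x. optimal_config s A N x \<longrightarrow>
    (\<forall>j\<in>{1..N}. \<forall>k\<in>{1..N}. x j \<in> A' \<and> k \<noteq> j \<longrightarrow>
       dist (x j) (x k) > C * real N powr (- 1 / d))"
proof -
  interpret riesz s "TYPE(real ^ 'n)"
    using assms(2-6) by unfold_locales auto
  have \<mu>: "\<mu>\<^sub>s \<in> borel_probs_on A" and energy: "riesz_energy s A \<mu>\<^sub>s = wiener_const s A"
    using assms(8) by (auto simp: equilibrium_measure_def)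
  have pos: "0 < wiener_const s A"
    using riesz_energy_pos[OF compact_imp_bounded[OF assms(1)] \<mu>] energy by simp
  \<comment> \<open>In \<open>ennreal\<close>, \<open>1 / \<infinity> = 0\<close>, so positive
    capacity excludes an infinite Wiener constant.\<close>
  have "wiener_const s A \<noteq> \<infinity>" using assms(7) unfolding riesz_capacity_def by auto
  then obtain W where W: "wiener_const s A = ennreal W" "0 < W"
    using pos by (cases "wiener_const s A") auto
  interpret equilibrium s "TYPE(real ^ 'n)" A \<mu>\<^sub>s W
  proof unfold_locales
    show "(\<integral>\<^sup>+x. potential s \<mu>\<^sub>s x \<partial>\<mu>\<^sub>s) = ennreal W" using energy W riesz_energy_eq[OF \<mu>] by simp
    show "ennreal W \<le> (\<integral>\<^sup>+x. potential s \<nu> x \<partial>\<nu>)" if \<nu>: "\<nu> \<in> borel_probs_on A" for \<nu>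
      unfolding W(1)[symmetric] wiener_const_def riesz_energy_eq[OF \<nu>, symmetric] using \<nu> by (rule INF_lower)
  qed (fact assms(1) \<mu> W(2))+
  define q where "q = (2 powr s + c * 2 powr s / (1 - 2 powr (s - d))) powr (- 1 / s)"
  have "(2::real) powr (s - d) < 1" using assms(4) by (intro powr_less_one) auto
  then have "2 powr s + c * 2 powr s / (1 - 2 powr (s - d)) > 0"
    using assms(12) by (intro add_pos_nonneg divide_nonneg_nonneg) auto
  then have q: "q > 0" by (simp add: q_def)
  \<comment> \<open>Halving \<open>q\<close> makes the inequality strict.\<close>
  have "q / 2 * real N powr (- 1 / d) < dist (x j) (x k)"
    if N: "N \<ge> 2" and opt: "optimal_config s A N x" and j: "j \<in> {1..N}" and k: "k \<in> {1..N}" and jk: "x j \<in> A'" "k \<noteq> j" for N x j k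
  proof -
    have upper: "measure \<mu>\<^sub>s (ball (x j) t) \<le> c * t powr d" if "t > 0" for t
    proof -
      have "measure \<mu>\<^sub>s (ball (x j) t) \<le> cc (x j) * t powr d"
        using assms(11) jk(1) that unfolding upper_regular_at_def by blast
      also have "\<dots> \<le> c * t powr d" using assms(13) jk(1) by (intro mult_right_mono) auto
      finally show ?thesis .
    qed
    have "ennreal W \<le> potential s \<mu>\<^sub>s (x j)"
      using assms(4,5,9,10) jk(1) upper by (intro potential_ge_of_regular_at[of _ l d c]) auto
    then have "q * real N powr (- 1 / d) \<le> dist (x j) (x k)"
      unfolding q_def using opt j k jk(2) assms(4) upper by (intro optimal_separation)
    moreover have "0 < q * real N powr (- 1 / d)" using q N by simp
    ultimately show ?thesis by simp
  qed
  then show ?thesis using q by (intro exI[of _ "q / 2"]) auto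
qed

end
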